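(* For $k\ge i\ge1$, \[ \sum_{m,n\ge0}O_{k,i}(m,n)x^mq^n=\sum_{N_1\ge\cdots\ge N_{k-1}\ge0}\frac{(-q^{2-2N_1};q^2)_{N_1-1}(-q^{1-2N_1};q^2)_{N_1}\,q^{2(N_1^2+\cdots+N_{k-1}^2+N_{i+1}+\cdots+N_{k-1})}(1+q^{2N_i})\,x^{N_1+\cdots+N_{k-1}}}{(q^2;q^2)_{N_1-N_2}\cdots(q^2;q^2)_{N_{k-2}-N_{k-1}}(q^2;q^2)_{N_{k-1}}}. \]
   Context: An overpartition of $n$ is a partition of $n$ in which the first occurrence of each part size may be overlined. For $t\ge1$, $f_t(\lambda)$ (resp. $f_{\overline t}(\lambda)$) is the number of non-overlined (resp. overlined) parts equal to $t$; $f_0=f_{\overline0}=0$. For $k\ge i\ge1$, $O_{k,i}(m,n)$ is the number of overpartitions $\lambda$ of $n$ with exactly $m$ parts such that (1) $f_{\overline1}(\lambda)+f_2(\lambda)\le i-1$; (2) $f_{\overline{2t}}(\lambda)+f_{2t}(\lambda)+f_{\overline{2t+1}}(\lambda)+f_{2t+2}(\lambda)\le k-1$ for every $t\ge0$; (3) for every $t\ge0$, if $f_{2t+1}(\lambda)\ge1$ then $f_{2t+2}(\lambda)\le k-2$. Notation: $(a;q)_\infty=\prod_{j\ge0}(1-aq^j)$, $(a;q)_n=(a;q)_\infty/(aq^n;q)_\infty$ for every integer $n$. The sum is over integer tuples $N_1\ge\cdots\ge N_{k-1}\ge0$; empty sums are $0$; when $i=k$, $N_k=0$. *)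

theory Defs
  imports
    "HOL-Analysis.Analysis"
    "HOL-Computational_Algebra.Computational_Algebra"
begin

text \<open>
  An overpartition is a pair of a partition (a multiset of positive integers) and the set of those
  part sizes whose first occurrence is overlined.
\<close>

type_synonym overpartition = "nat multiset \<times> nat set"

definition overpartitions :: "nat \<Rightarrow> overpartition set" where
  "overpartitions n =
    {(P, S). (\<forall>t \<in># P. t \<ge> 1) \<and> sum_mset P = n \<and> S \<subseteq> set_mset P}"

definition num_parts :: "overpartition \<Rightarrow> nat" where
  "num_parts L = size (fst L)"

definition f_over :: "overpartition \<Rightarrow> nat \<Rightarrow> nat" where
  "f_over L t = (if t \<in> snd L then 1 else 0)"

definition f_plain :: "overpartition \<Rightarrow> nat \<Rightarrow> nat" where
  "f_plain L t = count (fst L) t - f_over L t"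

text \<open>The bounds are stated over the integers because \<open>k - 2\<close> is negative for \<open>k = 1\<close>.\<close>

definition admissible :: "nat \<Rightarrow> nat \<Rightarrow> overpartition \<Rightarrow> bool" where
  "admissible k i L \<longleftrightarrow>
     int (f_over L 1 + f_plain L 2) \<le> int i - 1 \<and>
     (\<forall>t. int (f_over L (2*t) + f_plain L (2*t) + f_over L (2*t+1) + f_plain L (2*t+2)) \<le> int k - 1) \<and>
     (\<forall>t. f_plain L (2*t+1) \<ge> 1 \<longrightarrow> int (f_plain L (2*t+2)) \<le> int k - 2)"

definition O_num :: "nat \<Rightarrow> nat \<Rightarrow> nat \<Rightarrow> nat \<Rightarrow> nat" where
  "O_num k i m n = card {L \<in> overpartitions n. num_parts L = m \<and> admissible k i L}"

text \<open>
  Generating functions live in \<open>rat fls fps\<close>: formal power series in \<open>x\<close> whose coefficients are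
  formal Laurent series in \<open>q\<close>. Infinite products are taken in the \<open>q\<close>-adic metric on
  \<open>rat fls\<close>, infinite sums in the \<open>x\<close>-adic metric on \<open>rat fls fps\<close>.
\<close>

definition O_gf :: "nat \<Rightarrow> nat \<Rightarrow> rat fls fps" where
  "O_gf k i = Abs_fps (\<lambda>m. fps_to_fls (Abs_fps (\<lambda>n. of_nat (O_num k i m n))))"

definition qpoch_inf :: "'a::{t2_space,field} \<Rightarrow> 'a \<Rightarrow> 'a" where
  "qpoch_inf a q = (\<Prod>j. 1 - a * q ^ j)"

definition qpoch :: "'a::{t2_space,field} \<Rightarrow> 'a \<Rightarrow> int \<Rightarrow> 'a" where
  "qpoch a q n = qpoch_inf a q / qpoch_inf (a * q powi n) q"

text \<open>
  A tuple $(N_1,\ldots,N_{k-1})$ is a function vanishing outside \<open>{1..<k}\<close>; in particular it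
  satisfies the convention $N_k = 0$.
\<close>

definition tuples :: "nat \<Rightarrow> (nat \<Rightarrow> nat) set" where
  "tuples k = {N. (\<forall>j. j \<notin> {1..<k} \<longrightarrow> N j = 0) \<and> (\<forall>j \<in> {1..<k-1}. N j \<ge> N (j+1))}"

definition multisum_term :: "nat \<Rightarrow> nat \<Rightarrow> (nat \<Rightarrow> nat) \<Rightarrow> rat fls fps" where
  "multisum_term k i N =
    (let q = (fls_X :: rat fls) in
      fps_const
        (qpoch (- (q powi (2 - 2 * int (N 1)))) (q^2) (int (N 1) - 1) *
         qpoch (- (q powi (1 - 2 * int (N 1)))) (q^2) (int (N 1)) *
         q ^ (2 * ((\<Sum>j=1..k-1. (N j)^2) + (\<Sum>j=i+1..k-1. N j))) *
         (1 + q ^ (2 * N i)) /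
         ((\<Prod>j\<in>{1..<k-1}. qpoch (q^2) (q^2) (int (N j) - int (N (j+1)))) *
          qpoch (q^2) (q^2) (int (N (k-1))))) *
      fps_X ^ (\<Sum>j=1..k-1. N j))"

end

theory Submission
  imports Defs
begin

text \<open>
  Write $Q = q^2$. Both sides, viewed as power series in $x$, satisfy the same system of
  $q$-difference equations relating $G_i(x) - G_{i-1}(x)$ to $G_j(xQ)$ with $j$ around $k - i + 1$,
  and the system has only one solution with constant term $1$. For overpartitions the system comes
  from removing the parts of size at most $2$ and lowering all other parts by $2$.
  
  For the multisum, the sums over $N_{k-1}, \ldots, N_2$ are steps of the Bailey chain started at the
  unit Bailey pair: the indices $j > i$ run relative to $xQ$, the factor $1 + q^{2N_i}$ is a Bailey
  lattice step from $xQ$ to $x$, and the indices $j < i$ run relative to $x$. The sum over $N_1$ has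
  weight $q^{2N^2} (-q^{2-2N};q^2)_{N-1} (-q^{1-2N};q^2)_N = q^N (-q;q)_{2N-1}$ and is evaluated by the
  $q$-Gauss sum. The resulting single series satisfies the system term by term, up to telescoping.
\<close>

text \<open>The two solutions have different shapes at the ends of the index range. For
  overpartitions the index \<open>0\<close> contributes \<open>0\<close>, and the equations for
  \<open>i = 1\<close> and for $k = p + 1$ look different from the others. The single series
  satisfies one uniform recurrence, but this reaches the indices \<open>0\<close> and
  \<open>k + 1\<close>, where its values count nothing: there $c J_0 = - J_1$ and $J_{k+1} + x J_k =
  J_k + x J_{k-1}$, with $c = q$. These two relations turn the uniform recurrence into the system;
  for the index \<open>1\<close> a factor $1 + q$ cancels. The solution is unique because the
  equations for differences carry $x^p$ with $p \<ge> 1$ on the right: if all lower coefficients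
  vanish, the coefficient of $x^m$ is the same for all indices, and the equation for $G_1$ makes it
  equal to $q^{2m}$ times itself. No infinite product in $x$ is formed. The outer sum is known only
  through its q-difference equations, obtained by telescoping and compared by uniqueness.
  Convergence in $q$ enters only with the Pochhammer symbols of the statement.\<close>

unbundle no vec_syntax
unbundle fps_syntax

subsection \<open>The Bailey chain\<close>

text \<open>A limiting case of q-Chu-Vandermonde: \<open>d n\<close> plays $1/(Q;Q)_n$ and
  \<open>e n\<close> a multiple of $1/(AQ;Q)_n$. The proof is in the style of Zeilberger:
  \<open>c\<close> times the summand for \<open>Suc M\<close> differs from the summand for
  \<open>M\<close> by a telescoping difference. Only ratios of consecutive values of
  \<open>e\<close> enter, so a shifted sequence can later be put in place of
  \<open>e\<close>.\<close>

lemma q_vandermonde: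
  fixes Q A :: "'r::idom" and d e :: "nat \<Rightarrow> 'r"
  assumes d0: "d 0 = 1"
    and d: "\<And>n. d n = (1 - Q ^ Suc n) * d (Suc n)"
    and e: "\<And>n. e n = (1 - A * Q ^ Suc n) * e (Suc n)"
    and nzQ: "\<And>n. 1 - Q ^ Suc n \<noteq> 0"
    and nzA: "\<And>n. 1 - A * Q ^ Suc n \<noteq> 0"
  shows "(\<Sum>n\<le>M. A ^ n * Q ^ (n\<^sup>2) * d (M - n) * d n * e n) = d M * e M"
proof (induction M)
  case 0
  show ?case by (simp add: d0)
next
  case (Suc M)
  define t where "t n = A ^ n * Q ^ (n\<^sup>2) * d (Suc M - n) * d n * e n" for n
  \<comment> \<open>The certificate: it vanishes at \<open>n = 0\<close>, and at
    \<open>n = Suc M\<close> it is \<open>- c\<close> times the one summand without a counterpart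
    for \<open>M\<close>.\<close>
  define g where "g n = - t n * (1 - Q ^ n) * (1 - A * Q ^ n) * Q ^ (Suc M - n)" for n
  define c where "c = (1 - Q ^ Suc M) * (1 - A * Q ^ Suc M)"
  have step: "c * t n = A ^ n * Q ^ (n\<^sup>2) * d (M - n) * d n * e n + (g (Suc n) - g n)"
    if nM: "n \<le> M" for n
  proof -
    obtain l where l: "M = n + l" using le_Suc_ex[OF nM] by blast
    have dl: "d l = (1 - Q ^ Suc l) * d (Suc l)" by (rule d)
    have dn: "d n = (1 - Q * Q ^ n) * d (Suc n)" using d[of n] by simp
    have en: "e n = (1 - A * (Q * Q ^ n)) * e (Suc n)" using e[of n] by simp
    define y where "y = Q ^ n"
    define z where "z = Q ^ l"
    define T where "T = A ^ n * Q ^ (n\<^sup>2)"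
    have tn: "t n = T * d (Suc l) * d n * e n"
      unfolding t_def T_def by (simp add: l)
    have QM: "Q ^ Suc M = Q * y * z" by (simp add: l y_def z_def power_add)
    have T': "A ^ Suc n * Q ^ ((Suc n)\<^sup>2) = T * A * y\<^sup>2 * Q"
      by (simp add: T_def y_def power2_eq_square power_add mult_ac)
    have tS: "t (Suc n) = T * A * y\<^sup>2 * Q * d l * d (Suc n) * e (Suc n)"
      unfolding t_def T' by (simp add: l)
    have g1: "g n = - t n * (1 - y) * (1 - A * y) * (Q * z)"
      unfolding g_def by (simp add: y_def z_def l)
    have g2: "g (Suc n) = - t (Suc n) * (1 - Q * y) * (1 - A * (Q * y)) * z"
      unfolding g_def by (simp add: y_def z_def l)
    have dl': "d l = (1 - Q * z) * d (Suc l)" using dl by (simp add: z_def)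
    have t'n: "A ^ n * Q ^ n\<^sup>2 * d (M - n) * d n * e n = T * d l * d n * e n"
      by (simp add: T_def l)
    show ?thesis
      unfolding t'n g1 g2 tS tn c_def QM
      unfolding dl' dn[folded y_def] en[folded y_def]
      by (simp add: algebra_simps power2_eq_square)
  qed
  have last: "c * t (Suc M) = - g (Suc M)"
    unfolding g_def c_def by (simp add: mult_ac)
  have tel: "(\<Sum>n\<le>m. g (Suc n) - g n) = g (Suc m) - g 0" for m
    by (induction m) auto
  have g0: "g 0 = 0" by (simp add: g_def)
  have "c * (\<Sum>n\<le>Suc M. t n) = (\<Sum>n\<le>M. c * t n) + c * t (Suc M)"
    by (simp add: sum_distrib_left distrib_left)
  also have "(\<Sum>n\<le>M. c * t n) = (\<Sum>n\<le>M. A ^ n * Q ^ (n\<^sup>2) * d (M - n) * d n * e n) + (\<Sum>n\<le>M. g (Suc n) - g n)"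
    by (subst sum.distrib[symmetric], rule sum.cong) (auto simp: step)
  also have "\<dots> + c * t (Suc M) = d M * e M"
    unfolding tel Suc.IH last g0 by simp
  also have "\<dots> = c * (d (Suc M) * e (Suc M))"
    by (subst d, subst e) (simp only: c_def mult_ac)
  finally have "c * (\<Sum>n\<le>Suc M. t n) = c * (d (Suc M) * e (Suc M))" .
  moreover have "c \<noteq> 0"
    unfolding c_def using nzQ nzA by (metis mult_eq_0_iff)
  ultimately have "(\<Sum>n\<le>Suc M. t n) = d (Suc M) * e (Suc M)"
    using mult_left_cancel by blast
  then show ?case unfolding t_def .
qed


text \<open>
  Here \<open>d n\<close> is $1/(Q;Q)_n$ and \<open>e n\<close> is $1/(xQ;Q)_n$. They enter only through their recurrences, so that
  everything takes place in an integral domain.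
\<close>

locale bailey =
  fixes x Q :: "'r::idom" and d e :: "nat \<Rightarrow> 'r"
  assumes d0: "d 0 = 1"
    and e0: "e 0 = 1"
    and d_Suc: "\<And>n. d n = (1 - Q ^ Suc n) * d (Suc n)"
    and e_Suc: "\<And>n. e n = (1 - x * Q ^ Suc n) * e (Suc n)"
    and nzQ: "\<And>n. 1 - Q ^ Suc n \<noteq> 0"
    and nzx: "\<And>n. 1 - x * Q ^ n \<noteq> 0"
begin

text \<open>
  For \<open>s = 0\<close> this is the kernel of a Bailey pair relative to $x$; for \<open>s = 1\<close> it is the one relative to
  $xQ$, divided by $1 - xQ$.
\<close>

definition kernel :: "nat \<Rightarrow> nat \<Rightarrow> nat \<Rightarrow> 'r" where
  "kernel s n r = (if r \<le> n then d (n - r) * e (n + r + s) else 0)"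

text \<open>Bailey's lemma with both free parameters sent to infinity, for a single column
  \<open>r\<close>: each column of the kernel is an eigenvector of the summation step. After the
  shift $n = r + j$ this is \<open>q_vandermonde\<close> with $A = x Q^{2r+s}$.\<close>

lemma kernel_chain:
  "(\<Sum>n\<le>L. (x * Q ^ s) ^ n * Q ^ (n\<^sup>2) * kernel s n r * d (L - n)) =
     (x * Q ^ s) ^ r * Q ^ (r\<^sup>2) * kernel s L r"
proof (cases "r \<le> L")
  case False
  then show ?thesis by (auto simp: kernel_def intro!: sum.neutral)
next
  case True
  then obtain M where L: "L = r + M" using le_Suc_ex by blast
  define A where "A = x * Q ^ (2 * r + s)"
  have pw: "(x * Q ^ s) ^ (r + j) * Q ^ ((r + j)\<^sup>2) = (x * Q ^ s) ^ r * Q ^ (r\<^sup>2) * (A ^ j * Q ^ (j\<^sup>2))" for j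
    unfolding A_def
    by (simp add: power_add power_mult_distrib power2_eq_square algebra_simps mult_2_right flip: power_mult)
  have "(\<Sum>n\<le>L. (x * Q ^ s) ^ n * Q ^ (n\<^sup>2) * kernel s n r * d (L - n)) =
        (\<Sum>n\<in>{r..r+M}. (x * Q ^ s) ^ n * Q ^ (n\<^sup>2) * kernel s n r * d (L - n))"
    by (rule sum.mono_neutral_right) (auto simp: L kernel_def)
  also have "\<dots> = (\<Sum>j\<le>M. (x * Q ^ s) ^ (r+j) * Q ^ ((r+j)\<^sup>2) * kernel s (r+j) r * d (L - (r+j)))"
    by (rule sum.reindex_bij_witness[of _ "\<lambda>j. r + j" "\<lambda>n. n - r"]) auto
  also have "\<dots> = (x * Q ^ s) ^ r * Q ^ (r\<^sup>2) *
      (\<Sum>j\<le>M. A ^ j * Q ^ (j\<^sup>2) * d (M - j) * d j * e (2 * r + s + j))"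
    unfolding sum_distrib_left pw
    by (rule sum.cong) (auto simp: L kernel_def mult_ac add_ac mult_2 mult_2_right)
  also have "(\<Sum>j\<le>M. A ^ j * Q ^ (j\<^sup>2) * d (M - j) * d j * e (2 * r + s + j)) = d M * e (2 * r + s + M)"
  proof (rule q_vandermonde)
    show "1 - A * Q ^ Suc n \<noteq> 0" for n
      using nzx[of "2 * r + s + Suc n"] unfolding A_def by (simp add: power_add mult_ac)
    show "e (2 * r + s + n) = (1 - A * Q ^ Suc n) * e (2 * r + s + Suc n)" for n
      using e_Suc[of "2 * r + s + n"] unfolding A_def by (simp add: power_add mult_ac)
  qed (fact d0 d_Suc nzQ)+
  finally show ?thesis
    by (simp add: kernel_def L add_ac mult_2)
qed

text \<open>Over a common denominator this is $(1 - xQ^{n+r+1}) - xQ^{2r+1} (1 - Q^{n-r}) = 1 -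
  xQ^{2r+1}$. It passes from the kernel relative to $xQ$ to the one relative to $x$.\<close>

lemma kernel_lattice:
  "kernel 0 n r - x * Q ^ (2 * r + 1) * kernel 0 n (Suc r) = (1 - x * Q ^ (2 * r + 1)) * kernel 1 n r"
proof -
  consider "n < r" | "n = r" | l where "n = Suc r + l"
    by (metis less_imp_Suc_add linorder_neqE_nat add_Suc)
  then show ?thesis
  proof cases
    case 1
    then show ?thesis by (simp add: kernel_def)
  next
    case 2
    then show ?thesis using e_Suc[of "r + r"] by (simp add: kernel_def d0 mult_2)
  next
    case (3 l)
    define y where "y = Q ^ (2 * r)"
    have e': "e (2 * r + l + 1) = (1 - x * (y * Q ^ l * Q * Q)) * e (2 * r + l + 2)"
      using e_Suc[of "2*r+l+1"] by (simp add: y_def power_add mult_ac)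
    have k: "kernel 0 n r = d (Suc l) * e (2 * r + l + 1)" "kernel 0 n (Suc r) = d l * e (2 * r + l + 2)"
      "kernel 1 n r = d (Suc l) * e (2 * r + l + 2)"
      using 3 by (simp_all add: kernel_def mult_2 add_ac)
    have y': "Q ^ (2 * r + 1) = y * Q" by (simp add: y_def)
    show ?thesis
      unfolding k e' y' d_Suc[of l]
      by (simp add: algebra_simps)
  qed
qed

definition pochx :: "nat \<Rightarrow> 'r" where
  "pochx r = (\<Prod>j<r. 1 - x * Q ^ Suc j)"

text \<open>
  Multiplied by $1 - xQ^{2r+1}$, this is the unit Bailey pair relative to $xQ$.
\<close>

definition alpha :: "nat \<Rightarrow> 'r" where
  "alpha r = pochx r * (- 1) ^ r * Q ^ (r choose 2) * d r"

lemma alpha_Suc: "alpha (Suc r) * (1 - Q ^ Suc r) = - alpha r * (1 - x * Q ^ Suc r) * Q ^ r"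
proof -
  have "Suc r choose 2 = r + (r choose 2)" by (simp add: numeral_2_eq_2)
  then show ?thesis
    unfolding alpha_def pochx_def using d_Suc[of r]
    by (simp add: power_add mult_ac)
qed

text \<open>The sum defining the unit pair is indefinitely summable; $1 - Q^n$ clears the
  denominator of the closed form. At $R = n - 1$ the closed form cancels the last summand, which
  gives \<open>unit_pair\<close>.\<close>

lemma unit_partial:
  assumes "R < n"
  shows "(1 - Q ^ n) * (\<Sum>r\<le>R. alpha r * (1 - x * Q ^ (2 * r + 1)) * kernel 1 n r) =
    alpha R * (1 - x * Q ^ Suc R) * Q ^ R * d (n - Suc R) * e (n + R + 1)"
  using assms
proof (induction R)
  case 0
  then obtain l where l: "n = Suc l" by (cases n) auto
  show ?case using d_Suc[of l] by (simp add: l kernel_def mult_ac)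
next
  case (Suc R)
  then obtain l where l: "n = Suc (Suc R) + l" using less_iff_Suc_add by auto
  have IH: "(1 - Q ^ n) * (\<Sum>r\<le>R. alpha r * (1 - x * Q ^ (2 * r + 1)) * kernel 1 n r) =
    alpha R * (1 - x * Q ^ Suc R) * Q ^ R * d (n - Suc R) * e (n + R + 1)" using Suc by simp
  have 1: "alpha R * (1 - x * Q ^ Suc R) * Q ^ R = - alpha (Suc R) * (1 - Q ^ Suc R)"
    using alpha_Suc[of R] by simp
  have dl: "d l = (1 - Q ^ Suc l) * d (Suc l)" by (rule d_Suc)
  have el: "e (n + R + 1) = (1 - x * (Q ^ n * (Q ^ R * Q * Q))) * e (n + R + 2)"
    using e_Suc[of "n + R + 1"] by (simp add: power_add mult_ac)
  have k: "kernel 1 n (Suc R) = d (Suc l) * e (n + R + 2)"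
    by (simp add: kernel_def l)
  have "(1 - Q ^ n) * (\<Sum>r\<le>Suc R. alpha r * (1 - x * Q ^ (2 * r + 1)) * kernel 1 n r) =
    - alpha (Suc R) * (1 - Q ^ Suc R) * d (Suc l) * e (n + R + 1)
     + (1 - Q ^ n) * (alpha (Suc R) * (1 - x * Q ^ (2 * Suc R + 1)) * (d (Suc l) * e (n + R + 2)))"
    unfolding sum.atMost_Suc distrib_left IH 1 k by (simp add: l)
  also have "\<dots> = alpha (Suc R) * (1 - x * Q ^ Suc (Suc R)) * Q ^ Suc R * d l * e (n + R + 2)"
    unfolding el dl by (simp add: l power_add mult_2 mult_2_right algebra_simps)
  finally show ?case by (simp add: l)
qed

lemma unit_pair:
  "(\<Sum>r\<le>n. alpha r * (1 - x * Q ^ (2 * r + 1)) * kernel 1 n r) = (if n = 0 then 1 else 0)"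
proof (cases n)
  case 0
  then show ?thesis using e_Suc[of 0] by (simp add: kernel_def alpha_def pochx_def d0 e0 binomial_eq_0)
next
  case (Suc m)
  have 1: "alpha m * (1 - x * Q ^ Suc m) * Q ^ m = - alpha (Suc m) * (1 - Q ^ Suc m)"
    using alpha_Suc[of m] by simp
  have e1: "e (n + m + 1) = (1 - x * Q ^ (2 * n + 1)) * e (2 * n + 1)"
    using e_Suc[of "n+m+1"] by (simp add: Suc mult_2)
  have "(1 - Q ^ n) * (\<Sum>r\<le>n. alpha r * (1 - x * Q ^ (2 * r + 1)) * kernel 1 n r) =
    alpha m * (1 - x * Q ^ Suc m) * Q ^ m * d (n - Suc m) * e (n + m + 1)
    + (1 - Q ^ n) * (alpha n * (1 - x * Q ^ (2 * n + 1)) * kernel 1 n n)"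
    using unit_partial[of m n] by (simp add: Suc distrib_left)
  also have "\<dots> = 0"
    unfolding 1 e1 by (simp add: Suc kernel_def d0 mult_2)
  finally show ?thesis using nzQ[of m] Suc by simp
qed

text \<open>The contribution of $N_j = m$ to the summand, apart from the denominators. At
  \<open>j = k\<close>, where \<open>m = 0\<close>, it is \<open>1\<close> unless
  \<open>i = k\<close>; then it is the factor $1 + q^0 = 2$ of the statement.\<close>

definition step_weight :: "nat \<Rightarrow> nat \<Rightarrow> nat \<Rightarrow> 'r" where
  "step_weight i j m = x ^ m * Q ^ (m\<^sup>2) * (if j > i then Q ^ m else if j = i then 1 + Q ^ m else 1)"

text \<open>
  \<open>beta k i l n\<close> is the sum over $N_{k-l+1}, \ldots, N_{k-1}$ with $N_{k-l} = n$ fixed; the step for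
  $N_k = 0$ is included.
\<close>

primrec beta :: "nat \<Rightarrow> nat \<Rightarrow> nat \<Rightarrow> nat \<Rightarrow> 'r" where
  "beta k i 0 n = (if n = 0 then 1 else 0)"
| "beta k i (Suc l) n = (\<Sum>m\<le>n. step_weight i (k - l) m * beta k i l m * d (n - m))"

lemma kernel_sum_swap:
  fixes f :: "nat \<Rightarrow> nat \<Rightarrow> 'r"
  assumes "\<And>m r. m < r \<Longrightarrow> f m r = 0"
  shows "(\<Sum>m\<le>n. u m * (\<Sum>r\<le>m. c r * f m r) * v m) = (\<Sum>r\<le>n. c r * (\<Sum>m\<le>n. u m * f m r * v m))"
proof -
  have "(\<Sum>r\<le>m. c r * f m r) = (\<Sum>r\<le>n. c r * f m r)" if "m \<le> n" for m
    by (rule sum.mono_neutral_left) (use that assms in auto)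
  then have "(\<Sum>m\<le>n. u m * (\<Sum>r\<le>m. c r * f m r) * v m) = (\<Sum>m\<le>n. \<Sum>r\<le>n. u m * (c r * f m r) * v m)"
    by (simp add: sum_distrib_left sum_distrib_right)
  also have "\<dots> = (\<Sum>r\<le>n. c r * (\<Sum>m\<le>n. u m * f m r * v m))"
    by (subst sum.swap) (simp add: sum_distrib_left mult_ac)
  finally show ?thesis .
qed

text \<open>The first \<open>k - i\<close> steps belong to the indices above \<open>i\<close> and
  all have the chain weight of \<open>s = 1\<close>, so each of them multiplies column
  \<open>r\<close> of the unit pair by the same factor.\<close>

lemma beta_above:
  assumes "l \<le> k - i"
  shows "beta k i l n = (\<Sum>r\<le>n. alpha r * (1 - x * Q ^ (2 * r + 1)) * ((x * Q) ^ r * Q ^ (r\<^sup>2)) ^ l * kernel 1 n r)"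
  using assms
proof (induction l arbitrary: n)
  case 0
  then show ?case using unit_pair[of n] by simp
next
  case (Suc l)
  define c where "c r = alpha r * (1 - x * Q ^ (2 * r + 1)) * ((x * Q) ^ r * Q ^ (r\<^sup>2)) ^ l" for r
  have "step_weight i (k - l) m = (x * Q) ^ m * Q ^ (m\<^sup>2)" for m
    using Suc.prems by (auto simp: step_weight_def power_mult_distrib mult_ac)
  then have "beta k i (Suc l) n = (\<Sum>m\<le>n. ((x * Q) ^ m * Q ^ (m\<^sup>2)) * (\<Sum>r\<le>m. c r * kernel 1 m r) * d (n - m))"
    using Suc by (simp add: c_def)
  also have "\<dots> = (\<Sum>r\<le>n. c r * (\<Sum>m\<le>n. (x * Q) ^ m * Q ^ (m\<^sup>2) * kernel 1 m r * d (n - m)))"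
    by (rule kernel_sum_swap) (simp add: kernel_def)
  also have "\<dots> = (\<Sum>r\<le>n. c r * ((x * Q) ^ r * Q ^ (r\<^sup>2) * kernel 1 n r))"
    using kernel_chain[where s = 1] by simp
  finally show ?case by (simp add: c_def mult_ac)
qed

text \<open>The weight $1 + Q^m$ is the sum of a chain step relative to $x$ and one relative to
  $xQ$. For the first, the lattice identity is applied before the chain step, for the second after
  it; both results then live in the kernel relative to $x$.\<close>

lemma kernel_cross:
  "(1 - x * Q ^ (2 * r + 1)) * (\<Sum>m\<le>n. x ^ m * Q ^ (m\<^sup>2) * (1 + Q ^ m) * kernel 1 m r * d (n - m)) =
     (1 + Q ^ r) * (x ^ r * Q ^ (r\<^sup>2)) * kernel 0 n r
     - Q ^ r * (1 + x * Q ^ Suc r) * (x ^ Suc r * Q ^ ((Suc r)\<^sup>2)) * kernel 0 n (Suc r)"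
proof -
  define z where "z = x * Q ^ (2 * r + 1)"
  have "(1 - z) * (\<Sum>m\<le>n. x ^ m * Q ^ (m\<^sup>2) * (1 + Q ^ m) * kernel 1 m r * d (n - m)) =
    (\<Sum>m\<le>n. x ^ m * Q ^ (m\<^sup>2) * ((1 - z) * kernel 1 m r) * d (n - m))
     + (1 - z) * (\<Sum>m\<le>n. (x * Q) ^ m * Q ^ (m\<^sup>2) * kernel 1 m r * d (n - m))"
    unfolding sum_distrib_left sum.distrib[symmetric]
    by (rule sum.cong) (auto simp: algebra_simps power_mult_distrib)
  also have "(\<Sum>m\<le>n. x ^ m * Q ^ (m\<^sup>2) * ((1 - z) * kernel 1 m r) * d (n - m)) =
    (\<Sum>m\<le>n. x ^ m * Q ^ (m\<^sup>2) * kernel 0 m r * d (n - m))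
     - z * (\<Sum>m\<le>n. x ^ m * Q ^ (m\<^sup>2) * kernel 0 m (Suc r) * d (n - m))"
    unfolding z_def kernel_lattice[symmetric] sum_distrib_left sum_subtractf[symmetric]
    by (rule sum.cong) (auto simp: algebra_simps)
  also have "(\<Sum>m\<le>n. x ^ m * Q ^ (m\<^sup>2) * kernel 0 m r * d (n - m)) = x ^ r * Q ^ (r\<^sup>2) * kernel 0 n r"
    using kernel_chain[where s = 0] by simp
  also have "(\<Sum>m\<le>n. x ^ m * Q ^ (m\<^sup>2) * kernel 0 m (Suc r) * d (n - m)) = x ^ Suc r * Q ^ ((Suc r)\<^sup>2) * kernel 0 n (Suc r)"
    using kernel_chain[where s = 0 and r = "Suc r"] by simp
  also have "(\<Sum>m\<le>n. (x * Q) ^ m * Q ^ (m\<^sup>2) * kernel 1 m r * d (n - m)) = (x * Q) ^ r * Q ^ (r\<^sup>2) * kernel 1 n r"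
    using kernel_chain[where s = 1] by simp
  also have "(1 - z) * ((x * Q) ^ r * Q ^ (r\<^sup>2) * kernel 1 n r) =
     (x * Q) ^ r * Q ^ (r\<^sup>2) * (kernel 0 n r - z * kernel 0 n (Suc r))"
    unfolding z_def kernel_lattice by (simp add: mult_ac)
  \<comment> \<open>The chain factor of column \<open>Suc r\<close> is \<open>z\<close> times that
    of column \<open>r\<close>; hence the two contributions to this column add up to the factor $Q^r
    (1 + xQ^{r+1})$.\<close>
  also have "x ^ Suc r * Q ^ ((Suc r)\<^sup>2) = x ^ r * Q ^ (r\<^sup>2) * z"
    unfolding z_def by (simp add: power_add power2_eq_square mult_2 mult_2_right mult_ac)
  also have "x ^ r * Q ^ r\<^sup>2 * kernel 0 n r - z * (x ^ r * Q ^ r\<^sup>2 * z * kernel 0 n (Suc r)) +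
      (x * Q) ^ r * Q ^ r\<^sup>2 * (kernel 0 n r - z * kernel 0 n (Suc r)) =
      (1 + Q ^ r) * (x ^ r * Q ^ (r\<^sup>2)) * kernel 0 n r
     - Q ^ r * (1 + x * Q ^ Suc r) * (x ^ r * Q ^ (r\<^sup>2) * z) * kernel 0 n (Suc r)"
    unfolding z_def
    by (simp add: algebra_simps power_mult_distrib power_add mult_2 mult_2_right)
  finally show ?thesis
    unfolding z_def
    by (simp add: power_add power2_eq_square mult_2 mult_2_right mult_ac)
qed

text \<open>After the crossing at index \<open>i\<close> the chain runs relative to $x$, and
  \<open>p\<close> counts the steps below \<open>i\<close>. The two columns left by the crossing
  evolve separately, each with its own chain factor.\<close>

lemma beta_below:
  assumes "1 \<le> i" "i \<le> k" "p + 1 \<le> i"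
  shows "beta k i (k - i + 1 + p) n = (\<Sum>r\<le>n. alpha r * ((x * Q) ^ r * Q ^ (r\<^sup>2)) ^ (k - i) *
     ((1 + Q ^ r) * (x ^ r * Q ^ (r\<^sup>2)) ^ Suc p * kernel 0 n r
     - Q ^ r * (1 + x * Q ^ Suc r) * (x ^ Suc r * Q ^ ((Suc r)\<^sup>2)) ^ Suc p * kernel 0 n (Suc r)))"
  using assms
proof (induction p arbitrary: n)
  case 0
  define c where "c r = alpha r * (1 - x * Q ^ (2 * r + 1)) * ((x * Q) ^ r * Q ^ (r\<^sup>2)) ^ (k - i)" for r
  have "step_weight i (k - (k - i)) m = x ^ m * Q ^ (m\<^sup>2) * (1 + Q ^ m)" for m
    using 0 by (auto simp: step_weight_def)
  then have "beta k i (k - i + 1 + 0) n =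
      (\<Sum>m\<le>n. (x ^ m * Q ^ (m\<^sup>2) * (1 + Q ^ m)) * (\<Sum>r\<le>m. c r * kernel 1 m r) * d (n - m))"
    using beta_above[of "k - i" k i] by (simp add: c_def)
  also have "\<dots> = (\<Sum>r\<le>n. c r * (\<Sum>m\<le>n. (x ^ m * Q ^ (m\<^sup>2) * (1 + Q ^ m)) * kernel 1 m r * d (n - m)))"
    by (rule kernel_sum_swap) (simp add: kernel_def)
  also have "\<dots> = (\<Sum>r\<le>n. alpha r * ((x * Q) ^ r * Q ^ (r\<^sup>2)) ^ (k - i) *
      ((1 - x * Q ^ (2 * r + 1)) * (\<Sum>m\<le>n. x ^ m * Q ^ (m\<^sup>2) * (1 + Q ^ m) * kernel 1 m r * d (n - m))))"
    by (simp add: c_def mult_ac)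
  finally show ?case unfolding kernel_cross by simp
next
  case (Suc p)
  define c where "c r = alpha r * ((x * Q) ^ r * Q ^ (r\<^sup>2)) ^ (k - i)" for r
  define f where "f p n r = (1 + Q ^ r) * (x ^ r * Q ^ (r\<^sup>2)) ^ Suc p * kernel 0 n r
     - Q ^ r * (1 + x * Q ^ Suc r) * (x ^ Suc r * Q ^ ((Suc r)\<^sup>2)) ^ Suc p * kernel 0 n (Suc r)" for p n r
  have "step_weight i (k - (k - i + 1 + p)) m = x ^ m * Q ^ (m\<^sup>2)" for m
    using Suc.prems by (auto simp: step_weight_def)
  then have "beta k i (k - i + 1 + Suc p) n =
      (\<Sum>m\<le>n. (x ^ m * Q ^ (m\<^sup>2)) * (\<Sum>r\<le>m. c r * f p m r) * d (n - m))"
    using Suc by (simp add: c_def f_def)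
  also have "\<dots> = (\<Sum>r\<le>n. c r * (\<Sum>m\<le>n. (x ^ m * Q ^ (m\<^sup>2)) * f p m r * d (n - m)))"
    by (rule kernel_sum_swap) (simp add: kernel_def f_def)
  also have "\<dots> = (\<Sum>r\<le>n. c r * f (Suc p) n r)"
  proof (rule sum.cong[OF refl], rule arg_cong[where f = "\<lambda>y. c _ * y"])
    fix r
    have ch: "(\<Sum>m\<le>n. x ^ m * Q ^ (m\<^sup>2) * kernel 0 m r * d (n - m)) = x ^ r * Q ^ (r\<^sup>2) * kernel 0 n r" for r
      using kernel_chain[where s = 0] by simp
    have "(\<Sum>m\<le>n. (x ^ m * Q ^ (m\<^sup>2)) * f p m r * d (n - m)) =
      (1 + Q ^ r) * (x ^ r * Q ^ (r\<^sup>2)) ^ Suc p * (\<Sum>m\<le>n. x ^ m * Q ^ (m\<^sup>2) * kernel 0 m r * d (n - m))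
      - Q ^ r * (1 + x * Q ^ Suc r) * (x ^ Suc r * Q ^ ((Suc r)\<^sup>2)) ^ Suc p *
        (\<Sum>m\<le>n. x ^ m * Q ^ (m\<^sup>2) * kernel 0 m (Suc r) * d (n - m))"
      unfolding f_def sum_distrib_left sum_subtractf[symmetric]
      by (rule sum.cong) (auto simp: right_diff_distrib left_diff_distrib mult_ac)
    then show "(\<Sum>m\<le>n. (x ^ m * Q ^ (m\<^sup>2)) * f p m r * d (n - m)) = f (Suc p) n r"
      unfolding ch by (simp add: f_def mult_ac)
  qed
  finally show ?case by (simp add: c_def f_def)
qed

end

subsection \<open>Formal sums and dilations of power series\<close>

definition adic :: "(nat \<Rightarrow> 'a::comm_ring_1 fps) \<Rightarrow> bool" where
  "adic g \<longleftrightarrow> (\<forall>n. fps_X ^ n dvd g n)"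

text \<open>The coefficient of $x^m$ is cut off at \<open>n = m\<close>. For an \<open>adic\<close>
  family this is the value of the infinite sum, so that identities between infinite sums are finite
  in each coefficient and need no topology.\<close>

definition adic_sum :: "(nat \<Rightarrow> 'a::comm_ring_1 fps) \<Rightarrow> 'a fps" where
  "adic_sum g = Abs_fps (\<lambda>m. \<Sum>n\<le>m. g n $ m)"

lemma adicI: "(\<And>n. fps_X ^ n dvd g n) \<Longrightarrow> adic g"
  by (simp add: adic_def)

lemma adic_nth:
  assumes "adic g" "m < n"
  shows "g n $ m = 0"
proof -
  obtain h where "g n = fps_X ^ n * h" using assms(1) unfolding adic_def dvd_def by blast
  then show ?thesis using assms(2) by (simp add: fps_X_power_mult_nth)
qed

lemma adic_mult: "adic g \<Longrightarrow> adic (\<lambda>n. h n * g n)"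
  unfolding adic_def by simp

lemma adic_sum_nth:
  assumes "adic g" "m \<le> M"
  shows "adic_sum g $ m = (\<Sum>n\<le>M. g n $ m)"
  unfolding adic_sum_def fps_nth_Abs_fps
  by (rule sum.mono_neutral_left) (use assms adic_nth[OF assms(1)] in auto)

lemma adic_sum_add: "adic_sum (\<lambda>n. g n + h n) = adic_sum g + adic_sum h"
  by (rule fps_ext) (simp add: adic_sum_def sum.distrib)

lemma adic_sum_diff: "adic_sum (\<lambda>n. g n - h n) = adic_sum g - adic_sum h"
  by (rule fps_ext) (simp add: adic_sum_def sum_subtractf)

lemma adic_sum_mult:
  assumes "adic g"
  shows "adic_sum (\<lambda>n. c * g n) = c * adic_sum g"
proof (rule fps_ext)
  fix m
  have "(c * adic_sum g) $ m = (\<Sum>i=0..m. c $ i * (\<Sum>n\<le>m. g n $ (m - i)))"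
    unfolding fps_mult_nth using adic_sum_nth[OF assms, of _ m] by (intro sum.cong) auto
  also have "\<dots> = (\<Sum>n\<le>m. (c * g n) $ m)"
    unfolding fps_mult_nth sum_distrib_left by (rule sum.swap)
  finally show "adic_sum (\<lambda>n. c * g n) $ m = (c * adic_sum g) $ m"
    by (simp add: adic_sum_def)
qed

lemma adic_sum_telescope:
  assumes "adic g"
  shows "adic_sum (\<lambda>n. g (Suc n) - g n) = - g 0"
proof (rule fps_ext)
  fix m
  have "(\<Sum>n\<le>m. g (Suc n) $ m - g n $ m) = g (Suc m) $ m - g 0 $ m"
    using sum_Suc_diff[of 0 m "\<lambda>n. g n $ m"] by (simp add: atMost_atLeast0)
  then show "adic_sum (\<lambda>n. g (Suc n) - g n) $ m = (- g 0) $ m"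
    using adic_nth[OF assms, of m "Suc m"] by (simp add: adic_sum_def)
qed

lemma adic_sum_shift:
  assumes "adic g" "\<And>n. n < r \<Longrightarrow> g n = 0"
  shows "adic_sum g = adic_sum (\<lambda>j. g (r + j))"
proof (rule fps_ext)
  fix m
  have "adic_sum g $ m = (\<Sum>n\<le>r+m. g n $ m)" by (rule adic_sum_nth[OF assms(1)]) simp
  also have "\<dots> = (\<Sum>n\<in>{r..r+m}. g n $ m)"
    by (rule sum.mono_neutral_right) (use assms in auto)
  also have "\<dots> = (\<Sum>j\<le>m. g (r + j) $ m)"
    by (rule sum.reindex_bij_witness[of _ "\<lambda>j. r + j" "\<lambda>n. n - r"]) auto
  finally show "adic_sum g $ m = adic_sum (\<lambda>j. g (r + j)) $ m" by (simp add: adic_sum_def)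
qed

text \<open>The exchange of sums in the Bailey transform: triangularity in \<open>r\<close> makes
  both orders finite in each coefficient.\<close>

lemma adic_sum_swap:
  assumes adic: "\<And>r. adic (\<lambda>n. u n * f n r)"
    and zero: "\<And>n r. n < r \<Longrightarrow> f n r = 0"
  shows "adic_sum (\<lambda>n. u n * (\<Sum>r\<le>n. c r * f n r)) = adic_sum (\<lambda>r. c r * adic_sum (\<lambda>n. u n * f n r))"
proof (rule fps_ext)
  fix m
  have "adic_sum (\<lambda>n. u n * (\<Sum>r\<le>n. c r * f n r)) $ m = (\<Sum>n\<le>m. (\<Sum>r\<le>n. c r * (u n * f n r)) $ m)"
    by (simp add: adic_sum_def sum_distrib_left mult_ac)
  also have "\<dots> = (\<Sum>n\<le>m. (\<Sum>r\<le>m. c r * (u n * f n r)) $ m)"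
    by (intro sum.cong refl arg_cong[where f = "\<lambda>g. g $ m"] sum.mono_neutral_left) (auto simp: zero)
  also have "\<dots> = (\<Sum>r\<le>m. (\<Sum>n\<le>m. (c r * (u n * f n r)) $ m))"
    unfolding fps_sum_nth by (rule sum.swap)
  also have "\<dots> = (\<Sum>r\<le>m. adic_sum (\<lambda>n. c r * (u n * f n r)) $ m)"
    by (simp add: adic_sum_def)
  also have "\<dots> = adic_sum (\<lambda>r. c r * adic_sum (\<lambda>n. u n * f n r)) $ m"
    unfolding adic_sum_mult[OF adic] by (simp add: adic_sum_def)
  finally show "adic_sum (\<lambda>n. u n * (\<Sum>r\<le>n. c r * f n r)) $ m = adic_sum (\<lambda>r. c r * adic_sum (\<lambda>n. u n * f n r)) $ m" .
qed

definition dilate :: "'a \<Rightarrow> 'a::comm_ring_1 fps \<Rightarrow> 'a fps" where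
  "dilate a f = Abs_fps (\<lambda>n. a ^ n * f $ n)"

lemma dilate_nth [simp]: "dilate a f $ n = a ^ n * f $ n"
  by (simp add: dilate_def)

lemma dilate_add: "dilate a (f + g) = dilate a f + dilate a g"
  by (rule fps_ext) (simp add: algebra_simps)

lemma dilate_diff: "dilate a (f - g) = dilate a f - dilate a g"
  by (rule fps_ext) (simp add: algebra_simps)

lemma dilate_uminus: "dilate a (- f) = - dilate a f"
  by (rule fps_ext) simp

lemma dilate_const: "dilate a (fps_const c) = fps_const c"
  by (rule fps_ext) simp

lemma dilate_1: "dilate a 1 = 1"
  by (rule fps_ext) simp

lemma dilate_X: "dilate a fps_X = fps_X * fps_const a"
  by (rule fps_ext) simp

lemma dilate_mult: "dilate a (f * g) = dilate a f * dilate a g"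
proof (rule fps_ext)
  fix n
  have "a ^ n * (\<Sum>i=0..n. f $ i * g $ (n - i)) = (\<Sum>i=0..n. (a ^ i * f $ i) * (a ^ (n - i) * g $ (n - i)))"
    unfolding sum_distrib_left
  proof (rule sum.cong[OF refl])
    fix i assume "i \<in> {0..n}"
    then have "a ^ n = a ^ i * a ^ (n - i)" by (simp flip: power_add)
    then show "a ^ n * (f $ i * g $ (n - i)) = (a ^ i * f $ i) * (a ^ (n - i) * g $ (n - i))"
      by (simp add: mult_ac)
  qed
  then show "dilate a (f * g) $ n = (dilate a f * dilate a g) $ n"
    by (simp add: fps_mult_nth)
qed

lemma dilate_power: "dilate a (f ^ n) = dilate a f ^ n"
  by (induction n) (simp_all add: dilate_1 dilate_mult)

lemma dilate_prod: "dilate a (prod f A) = (\<Prod>i\<in>A. dilate a (f i))"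
  by (induction A rule: infinite_finite_induct) (simp_all add: dilate_1 dilate_mult)

lemma dilate_adic_sum: "dilate a (adic_sum g) = adic_sum (\<lambda>n. dilate a (g n))"
  by (rule fps_ext) (simp add: adic_sum_def sum_distrib_left)

lemmas dilate_simps = dilate_add dilate_diff dilate_uminus dilate_const dilate_1
  dilate_X dilate_mult dilate_power dilate_prod

text \<open>If all lower coefficients vanish, the coefficient of $x^m$ in the equation reads $a^m
  f_m = f_m$. This takes the place of solving q-difference equations by infinite products.\<close>

lemma dilate_eq_unique:
  fixes f :: "'a::idom fps"
  assumes eq: "u * dilate a f = v * f" and "u $ 0 = 1" "v $ 0 = 1" "f $ 0 = 0"
    and a: "\<And>n. a ^ Suc n \<noteq> 1"
  shows "f = 0"
proof (rule fps_ext)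
  fix m
  show "f $ m = 0 $ m"
  proof (induction m rule: less_induct)
    case (less m)
    have *: "(h * g) $ m = g $ m" if "h $ 0 = 1" "\<And>i. i < m \<Longrightarrow> g $ i = 0" for h g :: "'a fps"
    proof -
      have "(h * g) $ m = (\<Sum>i=0..m. h $ i * g $ (m - i))" by (rule fps_mult_nth)
      also have "\<dots> = (\<Sum>i\<in>{0}. h $ i * g $ (m - i))"
        by (rule sum.mono_neutral_right) (auto simp: that)
      finally show ?thesis using that by simp
    qed
    have "a ^ m * f $ m = f $ m"
      using arg_cong[OF eq, of "\<lambda>g. g $ m"] *[of u "dilate a f"] *[of v f] assms less by simp
    then show ?case using a[of "m - 1"] assms by (cases m) auto
  qed
qed

subsection \<open>The outermost sum\<close>

text \<open>Only these properties of $q$ enter the part about series in $x$. The assumption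
  \<open>two_nz\<close> serves the weight at $N_1 = 0$, which is $1/2$.\<close>

locale qbase =
  fixes q :: "'a::field"
  assumes q_nz: "q \<noteq> 0" and q_root: "\<And>n. q ^ Suc n \<noteq> 1" and two_nz: "(2::'a) \<noteq> 0"
begin

definition c :: "'a fps" where "c = fps_const q"

definition Q :: "'a fps" where "Q = c\<^sup>2"

lemma Q_const: "Q = fps_const (q\<^sup>2)"
  by (simp add: Q_def c_def fps_const_power)

lemma q2_root: "(q\<^sup>2) ^ Suc n \<noteq> 1"
proof -
  have "2 * Suc n = Suc (2 * n + 1)" by simp
  then show ?thesis using q_root[of "2 * n + 1"] unfolding power_mult[symmetric] by metis
qed

definition d :: "nat \<Rightarrow> 'a fps" where
  "d n = fps_const (inverse (\<Prod>j<n. 1 - (q\<^sup>2) ^ Suc j))"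

definition e :: "nat \<Rightarrow> 'a fps" where
  "e n = inverse (\<Prod>j<n. 1 - fps_X * Q ^ Suc j)"

lemma poch_nth_0: "(\<Prod>j<n. 1 - fps_X * Q ^ Suc j) $ 0 = 1"
  by (induction n) simp_all

lemma e_mult: "(\<Prod>j<n. 1 - fps_X * Q ^ Suc j) * e n = 1"
  unfolding e_def by (rule inverse_mult_eq_1') (simp add: poch_nth_0 del: power_Suc)

sublocale bailey "fps_X" Q d e
proof
  show "d 0 = 1" by (simp add: d_def)
  show "e 0 = 1" using e_mult[of 0] by simp
  show "d n = (1 - Q ^ Suc n) * d (Suc n)" for n
  proof -
    have "1 - Q ^ Suc n = fps_const (1 - (q\<^sup>2) ^ Suc n)"
      by (simp add: Q_const fps_const_power flip: fps_const_mult fps_const_sub)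
    then have "(1 - Q ^ Suc n) * d (Suc n) = fps_const ((1 - (q\<^sup>2) ^ Suc n) * inverse (\<Prod>j<Suc n. 1 - (q\<^sup>2) ^ Suc j))"
      unfolding d_def by simp
    also have "(1 - (q\<^sup>2) ^ Suc n) * inverse (\<Prod>j<Suc n. 1 - (q\<^sup>2) ^ Suc j) = inverse (\<Prod>j<n. 1 - (q\<^sup>2) ^ Suc j)"
    proof -
      have "a * inverse (P * a) = inverse P" if "a \<noteq> 0" for a P :: 'a
        using that by (simp add: field_simps)
      then show ?thesis using q2_root[of n] unfolding prod.lessThan_Suc by auto
    qed
    finally show ?thesis by (simp only: d_def)
  qed
  show "e n = (1 - fps_X * Q ^ Suc n) * e (Suc n)" for n
  proof -
    define P where "P = (\<Prod>j<n. 1 - fps_X * Q ^ Suc j)"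
    have "P * e n = P * ((1 - fps_X * Q ^ Suc n) * e (Suc n))"
      using e_mult[of n] e_mult[of "Suc n"] by (simp add: P_def mult_ac)
    moreover have "P \<noteq> 0" using e_mult[of n] unfolding P_def by (metis mult_zero_left zero_neq_one)
    ultimately show ?thesis by simp
  qed
  show "1 - Q ^ Suc n \<noteq> 0" for n
  proof
    assume "1 - Q ^ Suc n = 0"
    then have "(1 - Q ^ Suc n) $ 0 = 0" by simp
    then show False using q2_root[of n] by (simp add: Q_const fps_const_power del: power_Suc)
  qed
  show "1 - fps_X * Q ^ n \<noteq> 0" for n
  proof
    assume "1 - fps_X * Q ^ n = 0"
    then have "(1 - fps_X * Q ^ n) $ 0 = 0" by simp
    then show False by simp
  qed
qed

abbreviation dil :: "'a fps \<Rightarrow> 'a fps" where "dil \<equiv> dilate (q\<^sup>2)"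

lemma dil_c: "dil c = c" by (simp add: c_def dilate_const)

lemma dil_Q: "dil Q = Q" by (simp add: Q_const dilate_const)

lemma dil_X: "dil fps_X = fps_X * Q" by (simp add: Q_const dilate_X)

lemma dil_d: "dil (d n) = d n" by (simp add: d_def dilate_const)

lemma dil_pochx: "(1 - fps_X * Q) * dil (pochx n) = pochx (Suc n)"
  unfolding pochx_def prod.lessThan_Suc_shift
  by (simp add: dilate_simps dil_Q dil_X mult_ac del: dilate_X prod.lessThan_Suc)

lemma dil_e: "dil (e n) = (1 - fps_X * Q) * e (Suc n)"
proof -
  have 1: "pochx n * e n = 1" for n
    using e_mult[of n] by (simp add: pochx_def)
  have "dil (pochx n) * dil (e n) = 1"
    using 1[of n] by (metis dilate_1 dilate_mult)
  then have "pochx (Suc n) * dil (e n) = (1 - fps_X * Q)"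
    unfolding dil_pochx[symmetric] by (simp add: mult_ac)
  then have "pochx (Suc n) * dil (e n) = pochx (Suc n) * ((1 - fps_X * Q) * e (Suc n))"
    using 1[of "Suc n"] by (metis mult.left_commute mult.right_neutral)
  moreover have "pochx (Suc n) \<noteq> 0" using 1[of "Suc n"] by auto
  ultimately show ?thesis by simp
qed

lemma e_nth_0: "e n $ 0 = 1"
  by (simp add: e_def poch_nth_0 del: power_Suc)

section \<open>The q-Gauss sum\<close>

definition poch :: "'a fps \<Rightarrow> nat \<Rightarrow> 'a fps" where
  "poch A n = (\<Prod>j<n. 1 - A * Q ^ j)"

lemma poch_0 [simp]: "poch A 0 = 1"
  by (simp add: poch_def)

lemma poch_Suc: "poch A (Suc n) = poch A n * (1 - A * Q ^ n)"
  by (simp add: poch_def)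

lemma dil_poch: "dil A = A \<Longrightarrow> dil (poch A n) = poch A n"
  by (simp add: poch_def dilate_simps dil_Q)

text \<open>The summand of the basic hypergeometric series 2-phi-1 with numerator parameters
  \<open>A\<close>, \<open>B\<close>, denominator parameter $xQ^{N+1}$, base \<open>Q\<close> and
  argument $xc$, divided by $(xQ;Q)_N$.\<close>

definition gauss :: "nat \<Rightarrow> 'a fps \<Rightarrow> 'a fps \<Rightarrow> nat \<Rightarrow> 'a fps" where
  "gauss N A B j = poch A j * poch B j * d j * e (N + j) * c ^ j * fps_X ^ j"

lemma adic_gauss: "adic (gauss N A B)"
  by (rule adicI) (simp add: gauss_def)

text \<open>
  The telescoping certificate of the $q$-Gauss sum, divided by the common factor of its terms.
\<close>

lemma gauss_certificate:
  fixes z A B y :: "'r::comm_ring_1"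
  shows "(1 - z) * (1 - z * A * B * y) - (1 - z * A) * (1 - z * B) * y =
     (1 - y) * (1 - z * A * B * y) - z * (1 - A * y) * (1 - B * y)"
  by (simp add: algebra_simps)

text \<open>The hypothesis on \<open>c * A * B\<close> is the q-Gauss condition that the argument
  $xc$ equals $C/(AB)$ for $C = xQ^{N+1}$. The sum would be $(xcA;Q)_\<infinity> (xcB;Q)_\<infinity>
  / ((xc;Q)_\<infinity> (xQ;Q)_\<infinity>)$, and the equation is the effect of replacing $x$ by
  $xQ$ in it; telescoping gives it directly.\<close>

lemma q_gauss:
  assumes AB: "c * A * B = Q ^ Suc N" and dA: "dil A = A" and dB: "dil B = B"
  shows "(1 - fps_X * c * A) * (1 - fps_X * c * B) * dil (adic_sum (gauss N A B)) =
     (1 - fps_X * c) * (1 - fps_X * Q) * adic_sum (gauss N A B)"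
proof -
  define g where "g j = - ((1 - fps_X * Q) * (1 - Q ^ j) * gauss N A B j)" for j
  have adic_dil: "adic (\<lambda>j. dil (gauss N A B j))"
    by (rule adicI) (simp add: gauss_def dilate_mult dilate_power dil_X power_mult_distrib)
  have step: "(1 - fps_X * c) * (1 - fps_X * Q) * gauss N A B j
      - (1 - fps_X * c * A) * (1 - fps_X * c * B) * dil (gauss N A B j) = g (Suc j) - g j" for j
  proof -
    define y where "y = Q ^ j"
    define z where "z = fps_X * c"
    \<comment> \<open>The common factor of the summand, its dilation, \<open>g j\<close> and
      \<open>g (Suc j)\<close>; what remains after its removal is
      \<open>gauss_certificate\<close>.\<close>
    define P where "P = poch A j * poch B j * d (Suc j) * e (Suc (N + j)) * c ^ j * fps_X ^ j * (1 - Q * y) * (1 - fps_X * Q)"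
    have dj: "d j = (1 - Q * y) * d (Suc j)" using d_Suc[of j] by (simp add: y_def)
    have "Q ^ Suc (N + j) = c * A * B * y" unfolding AB y_def by (simp add: power_add)
    then have ej: "e (N + j) = (1 - z * A * B * y) * e (Suc (N + j))"
      using e_Suc[of "N + j"] by (simp add: z_def mult_ac)
    have t: "(1 - fps_X * Q) * gauss N A B j = P * (1 - z * A * B * y)"
      unfolding gauss_def P_def dj ej by (simp only: mult_ac)
    have dt: "dil (gauss N A B j) = P * y"
      unfolding gauss_def P_def
      by (simp add: dilate_simps dil_poch dA dB dil_c dil_X dil_d dil_e power_mult_distrib del: dilate_X)
        (simp add: y_def[symmetric] dj mult_ac)
    have gS: "g (Suc j) = - (P * (z * (1 - A * y) * (1 - B * y)))"
      unfolding g_def gauss_def P_def poch_Suc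
      by (simp add: y_def z_def mult_ac)
    have gj: "g j = - (P * ((1 - y) * (1 - z * A * B * y)))"
      unfolding g_def using t by (simp add: y_def mult_ac)
    have "(1 - z) * ((1 - fps_X * Q) * gauss N A B j) - (1 - z * A) * (1 - z * B) * dil (gauss N A B j)
       = P * ((1 - z) * (1 - z * A * B * y) - (1 - z * A) * (1 - z * B) * y)"
      unfolding t dt by (simp add: algebra_simps)
    also have "\<dots> = g (Suc j) - g j"
      unfolding gauss_certificate gS gj by (simp add: right_diff_distrib)
    finally show ?thesis by (simp add: z_def mult_ac)
  qed
  have "(1 - fps_X * c) * (1 - fps_X * Q) * adic_sum (gauss N A B)
     - (1 - fps_X * c * A) * (1 - fps_X * c * B) * dil (adic_sum (gauss N A B)) = adic_sum (\<lambda>j. g (Suc j) - g j)"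
    unfolding dilate_adic_sum adic_sum_mult[OF adic_gauss, symmetric] adic_sum_mult[OF adic_dil, symmetric]
      adic_sum_diff[symmetric] step ..
  also have "\<dots> = - g 0"
    by (rule adic_sum_telescope) (use adic_mult[OF adic_gauss] in \<open>simp add: g_def[abs_def] adic_def\<close>)
  also have "\<dots> = 0" by (simp add: g_def)
  finally show ?thesis by simp
qed

lemma gauss_nth_0: "adic_sum (gauss N A B) $ 0 = 1"
  by (simp add: adic_sum_def gauss_def d0 e_nth_0)

text \<open>
  By the $q$-Gauss sum, \<open>F r\<close> is $(-xq^{2r+1};q)_\infty / (xq;q)_\infty$. Only the consequences of this for
  $r \mapsto r + 1$ and $x \mapsto xQ$ are needed.
\<close>

definition F :: "nat \<Rightarrow> 'a fps" where
  "F r = adic_sum (gauss (2 * r) (- (Q ^ r)) (- (c * Q ^ r)))"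

text \<open>By the q-Gauss sum this is $(-xq^{2r+2};q)_\<infinity> / (xq;q)_\<infinity>$. It arises
  for \<open>i = 1\<close>, where the factor $1 + q^{2N_1}$ changes the first parameter.\<close>

definition E :: "nat \<Rightarrow> 'a fps" where
  "E r = adic_sum (gauss (2 * r + 1) (- (Q ^ Suc r)) (- (c * Q ^ r)))"

lemma F_dil0: "(1 + fps_X * c * Q ^ r) * (1 + fps_X * Q ^ Suc r) * dil (F r) =
    (1 - fps_X * c) * (1 - fps_X * Q) * F r"
proof -
  have "c * (- (Q ^ r)) * (- (c * Q ^ r)) = Q ^ Suc (2 * r)"
    by (simp add: Q_def power2_eq_square power_add mult_2 mult_2_right mult_ac power_mult_distrib)
  from q_gauss[OF this] show ?thesis
    by (simp add: F_def dilate_simps dil_c dil_Q) (simp add: Q_def power2_eq_square mult_ac)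
qed

lemma E_dil0: "(1 + fps_X * c * Q ^ Suc r) * (1 + fps_X * Q ^ Suc r) * dil (E r) =
    (1 - fps_X * c) * (1 - fps_X * Q) * E r"
proof -
  have "c * (- (Q ^ Suc r)) * (- (c * Q ^ r)) = Q ^ Suc (2 * r + 1)"
    by (simp add: Q_def power2_eq_square power_add mult_2 mult_2_right mult_ac power_mult_distrib)
  from q_gauss[OF this] show ?thesis
    by (simp add: E_def dilate_simps dil_c dil_Q) (simp add: Q_def power2_eq_square mult_ac)
qed

text \<open>Both sides solve the q-difference equation of \<open>F r\<close> with constant term $1$,
  so \<open>dilate_eq_unique\<close> applies to their difference. The proof of \<open>E_rec\<close>
  is the same.\<close>

lemma F_rec: "F r = (1 + fps_X * c * Q ^ r) * (1 + fps_X * Q ^ Suc r) * F (Suc r)"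
proof -
  define u where "u = (1 + fps_X * c * Q ^ r) * (1 + fps_X * Q ^ Suc r)"
  define v where "v = (1 - fps_X * c) * (1 - fps_X * Q)"
  have F: "u * dil (F r) = v * F r" unfolding u_def v_def by (rule F_dil0)
  have du: "dil u = (1 + fps_X * c * Q ^ Suc r) * (1 + fps_X * Q ^ Suc (Suc r))"
    by (simp add: u_def dilate_simps dil_c dil_Q dil_X mult_ac del: dilate_X)
  have FS: "dil u * dil (F (Suc r)) = v * F (Suc r)" unfolding du v_def by (rule F_dil0)
  have "F r - u * F (Suc r) = 0"
  proof (rule dilate_eq_unique[where u = u and v = v and a = "q\<^sup>2"])
    have "u * dil (F r - u * F (Suc r)) = u * dil (F r) - u * (dil u * dil (F (Suc r)))"
      by (simp add: dilate_diff dilate_mult right_diff_distrib)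
    also have "\<dots> = v * (F r - u * F (Suc r))"
      unfolding F FS by (simp add: right_diff_distrib mult_ac)
    finally show "u * dil (F r - u * F (Suc r)) = v * (F r - u * F (Suc r))" .
  qed (use q2_root in \<open>auto simp: u_def v_def F_def gauss_nth_0\<close>)
  then show ?thesis by (simp add: u_def)
qed

lemma dil_F: "dil (F r) = (1 - fps_X * c) * (1 - fps_X * Q) * F (Suc r)"
proof -
  define u where "u = (1 + fps_X * c * Q ^ r) * (1 + fps_X * Q ^ Suc r)"
  have "u * dil (F r) = u * ((1 - fps_X * c) * (1 - fps_X * Q) * F (Suc r))"
    using F_dil0[of r] F_rec[of r] unfolding u_def by (simp add: mult_ac)
  moreover have "u $ 0 = 1" by (simp add: u_def)
  then have "u \<noteq> 0" by auto
  ultimately show ?thesis by simp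
qed

lemma E_rec: "E r = (1 + fps_X * Q ^ Suc r) * F (Suc r)"
proof -
  define u1 where "u1 = 1 + fps_X * c * Q ^ Suc r"
  define u2 where "u2 = 1 + fps_X * Q ^ Suc r"
  define v where "v = (1 - fps_X * c) * (1 - fps_X * Q)"
  have E: "u1 * u2 * dil (E r) = v * E r" unfolding u1_def u2_def v_def by (rule E_dil0)
  have du: "dil u2 = 1 + fps_X * Q ^ Suc (Suc r)"
    by (simp add: u2_def dilate_simps dil_c dil_Q dil_X mult_ac del: dilate_X)
  have FS: "u1 * dil u2 * dil (F (Suc r)) = v * F (Suc r)" unfolding u1_def du v_def by (rule F_dil0)
  have "E r - u2 * F (Suc r) = 0"
  proof (rule dilate_eq_unique[where u = "u1 * u2" and v = v and a = "q\<^sup>2"])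
    have "u1 * u2 * dil (E r - u2 * F (Suc r)) = u1 * u2 * dil (E r) - u2 * (u1 * dil u2 * dil (F (Suc r)))"
      by (simp add: dilate_diff dilate_mult right_diff_distrib mult_ac)
    also have "\<dots> = v * (E r - u2 * F (Suc r))"
      unfolding E FS by (simp add: right_diff_distrib mult_ac)
    finally show "u1 * u2 * dil (E r - u2 * F (Suc r)) = v * (E r - u2 * F (Suc r))" .
  qed (use q2_root in \<open>auto simp: u1_def u2_def v_def E_def F_def gauss_nth_0\<close>)
  then show ?thesis by (simp add: u2_def)
qed

text \<open>
  \<open>w n\<close> is $q^n (-q;q)_{2n-1}$; the value at \<open>0\<close> agrees with the convention $(-q;q)_{-1} = 1/2$.
\<close>

primrec w :: "nat \<Rightarrow> 'a fps" where
  "w 0 = fps_const (inverse 2)"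
| "w (Suc n) = w n * c * (1 + Q ^ n) * (1 + c * Q ^ n)"

lemma w_add: "w (r + j) = w r * poch (- (Q ^ r)) j * poch (- (c * Q ^ r)) j * c ^ j"
  by (induction j) (simp_all add: poch_Suc power_add mult_ac)

text \<open>The factor $1 + Q^{r+j}$ turns $(-Q^r;Q)_j$ into $(1 + Q^r) (-Q^{r+1};Q)_j$.\<close>

lemma w_add':
  "w (r + j) * (1 + Q ^ (r + j)) = w r * (1 + Q ^ r) * poch (- (Q ^ Suc r)) j * poch (- (c * Q ^ r)) j * c ^ j"
proof (induction j)
  case (Suc j)
  have "w (r + Suc j) * (1 + Q ^ (r + Suc j)) =
     w (r + j) * (1 + Q ^ (r + j)) * (c * (1 + c * Q ^ (r + j)) * (1 + Q ^ (r + Suc j)))"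
    by (simp add: mult_ac)
  also have "\<dots> = w r * (1 + Q ^ r) * poch (- (Q ^ Suc r)) (Suc j) * poch (- (c * Q ^ r)) (Suc j) * c ^ Suc j"
    unfolding Suc by (simp add: poch_Suc power_add mult_ac)
  finally show ?case .
qed simp

text \<open>The kernel vanishes for \<open>n < r\<close>; after the shift by \<open>r\<close> the
  summand is a fixed multiple of the q-Gauss summand with the parameters of
  \<open>F r\<close>.\<close>

lemma sum_kernel_0: "adic_sum (\<lambda>n. w n * fps_X ^ n * kernel 0 n r) = w r * fps_X ^ r * F r"
proof -
  have "adic_sum (\<lambda>n. w n * fps_X ^ n * kernel 0 n r) = adic_sum (\<lambda>j. w (r + j) * fps_X ^ (r + j) * kernel 0 (r + j) r)"
    by (rule adic_sum_shift) (auto intro!: adicI simp: kernel_def)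
  also have "(\<lambda>j. w (r + j) * fps_X ^ (r + j) * kernel 0 (r + j) r) =
     (\<lambda>j. (w r * fps_X ^ r) * gauss (2 * r) (- (Q ^ r)) (- (c * Q ^ r)) j)"
  proof (rule ext)
    fix j
    have k: "kernel 0 (r + j) r = d j * e (2 * r + j)"
      by (simp add: kernel_def mult_2 add_ac)
    show "w (r + j) * fps_X ^ (r + j) * kernel 0 (r + j) r =
      (w r * fps_X ^ r) * gauss (2 * r) (- (Q ^ r)) (- (c * Q ^ r)) j"
      unfolding w_add k gauss_def unfolding power_add by (simp only: mult_ac)
  qed
  finally show ?thesis by (simp add: adic_sum_mult adic_gauss F_def)
qed

lemma sum_kernel_1: "adic_sum (\<lambda>n. w n * fps_X ^ n * (1 + Q ^ n) * kernel 1 n r) = w r * (1 + Q ^ r) * fps_X ^ r * E r"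
proof -
  have "adic_sum (\<lambda>n. w n * fps_X ^ n * (1 + Q ^ n) * kernel 1 n r) =
      adic_sum (\<lambda>j. w (r + j) * fps_X ^ (r + j) * (1 + Q ^ (r + j)) * kernel 1 (r + j) r)"
    by (rule adic_sum_shift) (auto intro!: adicI simp: kernel_def)
  also have "(\<lambda>j. w (r + j) * fps_X ^ (r + j) * (1 + Q ^ (r + j)) * kernel 1 (r + j) r) =
     (\<lambda>j. (w r * (1 + Q ^ r) * fps_X ^ r) * gauss (2 * r + 1) (- (Q ^ Suc r)) (- (c * Q ^ r)) j)"
  proof (rule ext)
    fix j
    have k: "kernel 1 (r + j) r = d j * e (2 * r + 1 + j)"
      by (simp add: kernel_def mult_2 add_ac)
    have "w (r + j) * fps_X ^ (r + j) * (1 + Q ^ (r + j)) * kernel 1 (r + j) r =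
      (w (r + j) * (1 + Q ^ (r + j))) * fps_X ^ (r + j) * kernel 1 (r + j) r"
      by (simp only: mult_ac)
    also have "\<dots> = (w r * (1 + Q ^ r) * fps_X ^ r) * gauss (2 * r + 1) (- (Q ^ Suc r)) (- (c * Q ^ r)) j"
      unfolding w_add' k gauss_def unfolding power_add by (simp only: mult_ac)
    finally show "w (r + j) * fps_X ^ (r + j) * (1 + Q ^ (r + j)) * kernel 1 (r + j) r =
      (w r * (1 + Q ^ r) * fps_X ^ r) * gauss (2 * r + 1) (- (Q ^ Suc r)) (- (c * Q ^ r)) j" .
  qed
  finally show ?thesis by (simp add: adic_sum_mult adic_gauss E_def)
qed


subsection \<open>The single series and its q-difference equations\<close>

text \<open>The index $N_1 = n$ is not a chain step, since its weight is \<open>w\<close>. For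
  \<open>i = 1\<close> it also has to carry $1 + Q^n$, because all remaining indices then lie above
  \<open>i\<close>.\<close>

definition multisum :: "nat \<Rightarrow> nat \<Rightarrow> 'a fps" where
  "multisum k i = adic_sum (\<lambda>n. w n * fps_X ^ n * (if i = 1 then 1 + Q ^ n else 1) * beta k i (k - 1) n)"

definition s :: "nat \<Rightarrow> 'a fps" where "s r = c * Q ^ r"

text \<open>The part of the term that does not involve \<open>i\<close>. The natural exponents for
  $1 \<le> i \<le> k$ are \<open>k - i\<close> and \<open>i - 1\<close>; the inverse, which is
  $1/(s_r Q^r)$, raises them to \<open>k + 1 - i\<close> and \<open>i\<close> in
  \<open>single_term\<close>, so that \<open>i = 0\<close> and \<open>i = k + 1\<close> become
  possible.\<close>

definition D :: "nat \<Rightarrow> nat \<Rightarrow> 'a fps" where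
  "D k r = alpha r * fps_X ^ (k * r) * Q ^ ((k - 1) * r\<^sup>2) * w r * (1 + Q ^ r) * fps_const (inverse (q * (q\<^sup>2) ^ (2 * r)))"

text \<open>
  The definition makes sense for \<open>0 \<le> i \<le> k + 1\<close>. The values at the two extra indices are not of interest in
  themselves, but with them one equation, \<open>single_rec\<close>, covers all \<open>i\<close>.
\<close>

definition single_term :: "nat \<Rightarrow> nat \<Rightarrow> nat \<Rightarrow> 'a fps" where
  "single_term k i r = D k r * (1 + fps_X * Q ^ Suc r) * F (Suc r) * Q ^ ((k + 1 - i) * r) *
     ((1 + fps_X * s r) * s r - (1 + s r) * (fps_X * (s r)\<^sup>2) ^ i)"

lemma s_sq: "(s r)\<^sup>2 = Q ^ (2 * r + 1)"
  by (simp add: s_def Q_def power_mult_distrib mult_ac flip: power_mult)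

lemma D_mult: "D k r * (s r * Q ^ r) = alpha r * fps_X ^ (k * r) * Q ^ ((k - 1) * r\<^sup>2) * w r * (1 + Q ^ r)"
proof -
  have "s r * Q ^ r = fps_const (q * (q\<^sup>2) ^ (2 * r))"
    by (simp add: s_def c_def Q_const fps_const_power mult_2 mult_2_right power_add mult_ac)
  then have "fps_const (inverse (q * (q\<^sup>2) ^ (2 * r))) * (s r * Q ^ r) = 1"
    using q_nz by (simp add: field_simps)
  then show ?thesis unfolding D_def by (simp add: mult.assoc)
qed

text \<open>The contribution of \<open>alpha r\<close> after the outer sum, with $p = i - 1$. Its
  two columns bring in \<open>F r\<close> and \<open>F (Suc r)\<close>, which \<open>F_rec\<close>
  reduces to one of them.\<close>

lemma single_term_below:
  "alpha r * ((fps_X * Q) ^ r * Q ^ (r\<^sup>2)) ^ u *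
     ((1 + Q ^ r) * (fps_X ^ r * Q ^ (r\<^sup>2)) ^ p * (w r * fps_X ^ r * F r)
     - Q ^ r * (1 + fps_X * Q ^ Suc r) * (fps_X ^ Suc r * Q ^ ((Suc r)\<^sup>2)) ^ p * (w (Suc r) * fps_X ^ Suc r * F (Suc r)))
   = single_term (Suc p + u) (Suc p) r" (is "?lhs = _")
proof -
  define X where "X = (fps_X :: 'a fps)"
  define y where "y = Q ^ r"
  define t where "t = s r"
  define k where "k = Suc p + u"
  define C where "C = alpha r * X ^ (k * r) * Q ^ ((k - 1) * r\<^sup>2) * w r * (1 + y)"
  define G where "G = (1 + X * Q ^ Suc r) * F (Suc r)"
  have Fr: "F r = (1 + X * t) * G"
    unfolding F_rec[of r] G_def t_def X_def s_def by (simp only: mult_ac)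
  have e1: "((X * Q) ^ r * Q ^ (r\<^sup>2)) ^ u * (X ^ r * Q ^ (r\<^sup>2)) ^ p * X ^ r = X ^ (k * r) * Q ^ ((k - 1) * r\<^sup>2) * y ^ u"
    unfolding k_def y_def
    by (simp add: power_add power_mult_distrib algebra_simps flip: power_mult)
  \<comment> \<open>Passing from column \<open>r\<close> to column \<open>Suc r\<close> multiplies
    the chain factor by $xQ^{2r+1} = x s_r^2$; this is the origin of the power with exponent
    \<open>i\<close> in \<open>single_term\<close>.\<close>
  have e2: "(X ^ Suc r * Q ^ ((Suc r)\<^sup>2)) ^ p = (X ^ r * Q ^ (r\<^sup>2)) ^ p * (X * t\<^sup>2) ^ p"
    unfolding t_def s_sq power_mult_distrib[symmetric]
    by (rule arg_cong[where f = "\<lambda>z. z ^ p"]) (simp add: power_add power2_eq_square mult_2_right mult_2 mult_ac)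
  have wS: "w (Suc r) = w r * c * (1 + y) * (1 + t)" by (simp add: y_def t_def s_def)
  have cy: "c * y = t" by (simp add: y_def t_def s_def)
  define B where "B = ((X * Q) ^ r * Q ^ (r\<^sup>2)) ^ u * (X ^ r * Q ^ (r\<^sup>2)) ^ p * X ^ r"
  have "?lhs = alpha r * B * w r * (1 + y) * G *
     ((1 + X * t) - (c * y) * X * (1 + t) * (X * t\<^sup>2) ^ p)"
    unfolding X_def[symmetric] Fr wS e2 y_def[symmetric] B_def
    by (simp add: G_def algebra_simps)
  also have "\<dots> = C * y ^ u * G * ((1 + X * t) - t * X * (1 + t) * (X * t\<^sup>2) ^ p)"
    unfolding B_def e1 cy C_def by (simp only: mult_ac)
  also have "C = D k r * (t * y)"
    unfolding C_def X_def y_def t_def D_mult ..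
  also have "D k r * (t * y) * y ^ u * G * ((1 + X * t) - t * X * (1 + t) * (X * t\<^sup>2) ^ p) =
     D k r * G * (y * y ^ u) * ((1 + X * t) * t - (1 + t) * (X * t\<^sup>2) ^ Suc p)"
    by (simp add: algebra_simps power2_eq_square)
  also have "y * y ^ u = Q ^ ((k + 1 - Suc p) * r)"
    unfolding y_def k_def by (simp add: power_add mult.commute flip: power_mult)
  finally show ?thesis unfolding single_term_def G_def X_def t_def k_def by (simp only: mult_ac)
qed

text \<open>For \<open>i = 1\<close> there is only one column. The factor $1 - xQ^{2r+1}$ of the
  unit pair supplies the bracket, since $s (1 - xs^2) = (1 + xs) s - (1 + s) xs^2$.\<close>

lemma single_term_1:
  "alpha r * (1 - fps_X * Q ^ (2 * r + 1)) * ((fps_X * Q) ^ r * Q ^ (r\<^sup>2)) ^ u * (w r * (1 + Q ^ r) * fps_X ^ r * E r)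
   = single_term (Suc u) 1 r" (is "?lhs = _")
proof -
  define X where "X = (fps_X :: 'a fps)"
  define y where "y = Q ^ r"
  define t where "t = s r"
  define k where "k = Suc u"
  define G where "G = (1 + X * Q ^ Suc r) * F (Suc r)"
  have e1: "((X * Q) ^ r * Q ^ (r\<^sup>2)) ^ u * X ^ r = X ^ (k * r) * Q ^ ((k - 1) * r\<^sup>2) * y ^ u"
    unfolding k_def y_def
    by (simp add: power_add power_mult_distrib algebra_simps flip: power_mult)
  have "?lhs = alpha r * (1 - X * t\<^sup>2) * (((X * Q) ^ r * Q ^ (r\<^sup>2)) ^ u * X ^ r) * (w r * (1 + y) * G)"
    unfolding E_rec X_def[symmetric] t_def s_sq y_def G_def by (simp only: mult_ac)
  also have "\<dots> = (alpha r * X ^ (k * r) * Q ^ ((k - 1) * r\<^sup>2) * w r * (1 + y)) * (1 - X * t\<^sup>2) * y ^ u * G"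
    unfolding e1 by (simp only: mult_ac)
  also have "\<dots> = D k r * (t * y) * (1 - X * t\<^sup>2) * y ^ u * G"
    unfolding X_def y_def t_def D_mult ..
  also have "\<dots> = D k r * G * (y * y ^ u) * ((1 + X * t) * t - (1 + t) * (X * t\<^sup>2) ^ 1)"
    by (simp add: algebra_simps power2_eq_square)
  also have "y * y ^ u = Q ^ ((k + 1 - 1) * r)"
    unfolding y_def k_def by (simp add: power_add mult.commute flip: power_mult)
  finally show ?thesis unfolding single_term_def G_def X_def t_def k_def by (simp only: mult_ac)
qed

text \<open>Bailey transform: insert the pair, exchange the sums, evaluate the inner one by q-Gauss.
  The case \<open>i = 1\<close> is separate because its chain over $N_2, ...$ contains no lattice
  step.\<close>

lemma multisum_eq_single:
  assumes "1 \<le> i" "i \<le> k"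
  shows "multisum k i = adic_sum (single_term k i)"
proof (cases "i = 1")
  case True
  define cf where "cf r = alpha r * (1 - fps_X * Q ^ (2 * r + 1)) * ((fps_X * Q) ^ r * Q ^ (r\<^sup>2)) ^ (k - 1)" for r
  have "multisum k i = adic_sum (\<lambda>n. (w n * fps_X ^ n * (1 + Q ^ n)) * (\<Sum>r\<le>n. cf r * kernel 1 n r))"
    unfolding multisum_def cf_def using beta_above[of "k - 1" k 1] True by simp
  also have "\<dots> = adic_sum (\<lambda>r. cf r * adic_sum (\<lambda>n. (w n * fps_X ^ n * (1 + Q ^ n)) * kernel 1 n r))"
    by (rule adic_sum_swap) (auto intro!: adicI simp: kernel_def)
  also have "\<dots> = adic_sum (\<lambda>r. cf r * (w r * (1 + Q ^ r) * fps_X ^ r * E r))"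
    unfolding sum_kernel_1 ..
  also have "(\<lambda>r. cf r * (w r * (1 + Q ^ r) * fps_X ^ r * E r)) = single_term k i"
    using single_term_1[of _ "k - 1"] assms True by (auto simp: cf_def)
  finally show ?thesis .
next
  case False
  obtain p where i: "i = Suc (Suc p)" using assms False by (metis One_nat_def Suc_le_D not0_implies_Suc)
  define u where "u = k - i"
  have k: "k = Suc (Suc p) + u" using assms i by (simp add: u_def)
  define cf where "cf r = alpha r * ((fps_X * Q) ^ r * Q ^ (r\<^sup>2)) ^ u" for r
  define a1 where "a1 r = (1 + Q ^ r) * (fps_X ^ r * Q ^ (r\<^sup>2)) ^ Suc p" for r
  define a2 where "a2 r = Q ^ r * (1 + fps_X * Q ^ Suc r) * (fps_X ^ Suc r * Q ^ ((Suc r)\<^sup>2)) ^ Suc p" for r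
  define f where "f n r = a1 r * kernel 0 n r - a2 r * kernel 0 n (Suc r)" for n r
  have ad: "adic (\<lambda>n. w n * fps_X ^ n * h n)" for h :: "nat \<Rightarrow> 'a fps"
    by (rule adicI) simp
  have "k - i + 1 + p = k - 1" using i k by simp
  then have b: "beta k i (k - 1) n = (\<Sum>r\<le>n. cf r * f n r)" for n
    using beta_below[of i k p n] assms i by (simp only: cf_def f_def a1_def a2_def u_def)
  have "multisum k i = adic_sum (\<lambda>n. (w n * fps_X ^ n) * (\<Sum>r\<le>n. cf r * f n r))"
    unfolding multisum_def b using False by simp
  also have "\<dots> = adic_sum (\<lambda>r. cf r * adic_sum (\<lambda>n. (w n * fps_X ^ n) * f n r))"
    by (rule adic_sum_swap[OF ad]) (auto simp: kernel_def f_def)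
  also have "(\<lambda>r. cf r * adic_sum (\<lambda>n. (w n * fps_X ^ n) * f n r)) = single_term k i"
  proof (rule ext)
    fix r
    have "adic_sum (\<lambda>n. (w n * fps_X ^ n) * f n r) =
       adic_sum (\<lambda>n. a1 r * (w n * fps_X ^ n * kernel 0 n r) - a2 r * (w n * fps_X ^ n * kernel 0 n (Suc r)))"
      by (simp add: f_def right_diff_distrib mult_ac)
    also have "\<dots> = a1 r * (w r * fps_X ^ r * F r) - a2 r * (w (Suc r) * fps_X ^ Suc r * F (Suc r))"
      unfolding adic_sum_diff adic_sum_mult[OF ad] sum_kernel_0 ..
    finally show "cf r * adic_sum (\<lambda>n. (w n * fps_X ^ n) * f n r) = single_term k i r"
      using single_term_below[of r u "Suc p"] by (simp only: cf_def a1_def a2_def i k)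
  qed
  finally show ?thesis .
qed

lemma adic_single_term: "1 \<le> k \<Longrightarrow> adic (single_term k i)"
proof (rule adicI)
  fix n assume "1 \<le> k"
  then have "fps_X ^ n dvd (fps_X :: 'a fps) ^ (k * n)" by (intro le_imp_power_dvd) simp
  then show "fps_X ^ n dvd single_term k i n" unfolding single_term_def D_def
    by (metis dvd_mult dvd_mult2)
qed

text \<open>Only \<open>r = 0\<close> survives at $x = 0$. There $1 + Q^0 = 2$ cancels
  \<open>w 0\<close>, and $s_0 = q$ cancels the inverse in \<open>D\<close>.\<close>

lemma single_nth_0:
  assumes "1 \<le> k" "1 \<le> i"
  shows "adic_sum (single_term k i) $ 0 = 1"
proof -
  have "F (Suc 0) $ 0 = 1" by (simp add: F_def gauss_nth_0)
  moreover have "alpha 0 = 1" by (simp add: alpha_def pochx_def d0 binomial_eq_0)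
  moreover have "(fps_X * (s 0)\<^sup>2) ^ i $ 0 = 0"
    using assms by (simp add: fps_nth_power_0)
  ultimately show ?thesis
    using two_nz q_nz by (simp add: adic_sum_def single_term_def D_def s_def c_def field_simps)
qed


lemma dil_s: "dil (s r) = s r"
  by (simp add: s_def dilate_simps dil_c dil_Q)

lemma dil_w: "dil (w n) = w n"
  by (induction n) (simp_all add: dilate_simps dil_c dil_Q)

lemma s_Suc: "s (Suc r) = s r * Q"
  by (simp add: s_def mult_ac)

lemma dil_alpha: "(1 - fps_X * Q) * dil (alpha r) = alpha r * (1 - fps_X * Q ^ Suc r)"
proof -
  have "(1 - fps_X * Q) * dil (alpha r) = ((1 - fps_X * Q) * dil (pochx r)) * ((- 1) ^ r * Q ^ (r choose 2) * d r)"
    unfolding alpha_def by (simp add: dilate_simps dil_Q dil_d mult_ac)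
  also have "\<dots> = alpha r * (1 - fps_X * Q ^ Suc r)"
    unfolding dil_pochx by (simp add: alpha_def pochx_def mult_ac)
  finally show ?thesis .
qed

lemma dil_D: "(1 - fps_X * Q) * dil (D k r) = D k r * (1 - fps_X * Q ^ Suc r) * Q ^ (k * r)"
proof -
  have "(1 - fps_X * Q) * dil (D k r) = ((1 - fps_X * Q) * dil (alpha r)) *
    ((fps_X * Q) ^ (k * r) * Q ^ ((k - 1) * r\<^sup>2) * w r * (1 + Q ^ r) * fps_const (inverse (q * (q\<^sup>2) ^ (2 * r))))"
    unfolding D_def by (simp add: dilate_add dilate_mult dilate_power dilate_1 dilate_const dil_Q dil_X dil_w mult_ac)
  then show ?thesis unfolding dil_alpha D_def power_mult_distrib by (simp only: mult_ac)
qed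

lemma D_Suc: "D (Suc m) (Suc r) * (1 - Q ^ Suc r) * Q\<^sup>2 =
   - (D (Suc m) r * (1 - fps_X * Q ^ Suc r) * Q ^ r * fps_X ^ Suc m * ((s r)\<^sup>2) ^ m * c * (1 + s r) * (1 + Q ^ Suc r))"
proof -
  define ir where "ir r = fps_const (inverse (q * (q\<^sup>2) ^ (2 * r)))" for r
  have ir: "ir (Suc r) * Q\<^sup>2 = ir r"
    using q_nz by (simp add: ir_def Q_const fps_const_power power2_eq_square field_simps)
  have e: "Q ^ (m * (Suc r)\<^sup>2) = Q ^ (m * r\<^sup>2) * ((s r)\<^sup>2) ^ m"
    unfolding s_sq power_mult[symmetric] power_add[symmetric]
    by (rule arg_cong[where f = "\<lambda>n. Q ^ n"]) (simp add: power2_eq_square algebra_simps)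
  have x: "fps_X ^ (Suc m * Suc r) = (fps_X :: 'a fps) ^ (Suc m * r) * fps_X ^ Suc m"
    unfolding power_add[symmetric] by (rule arg_cong[where f = "\<lambda>n. fps_X ^ n"]) simp
  have w: "w (Suc r) = w r * c * (1 + Q ^ r) * (1 + s r)" by (simp add: s_def)
  have "D (Suc m) (Suc r) * (1 - Q ^ Suc r) * Q\<^sup>2 =
    (alpha (Suc r) * (1 - Q ^ Suc r)) * fps_X ^ (Suc m * Suc r) * Q ^ (m * (Suc r)\<^sup>2) * w (Suc r) * (1 + Q ^ Suc r) * (ir (Suc r) * Q\<^sup>2)"
    unfolding D_def ir_def[symmetric] by (simp only: mult_ac diff_Suc_1)
  also have "\<dots> = - (D (Suc m) r * (1 - fps_X * Q ^ Suc r) * Q ^ r * fps_X ^ Suc m * ((s r)\<^sup>2) ^ m * c * (1 + s r) * (1 + Q ^ Suc r))"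
    unfolding alpha_Suc ir e x w D_def ir_def[symmetric] by (simp only: mult_ac diff_Suc_1 mult_minus_left mult_minus_right)
  finally show ?thesis .
qed

text \<open>The telescoping quantity: up to a power of $Q^r$ it is what a difference of neighbouring
  \<open>single_term\<close>s leaves when the powers of $x s_r^2$ are dropped. The factor $1 - Q^r$
  makes it vanish at \<open>r = 0\<close>.\<close>

definition U :: "nat \<Rightarrow> nat \<Rightarrow> 'a fps" where
  "U k r = D k r * F r * s r * (1 - Q ^ r)"

lemma adic_U: "1 \<le> k \<Longrightarrow> adic (\<lambda>r. h r * U k r)"
proof (rule adicI)
  fix n assume "1 \<le> k"
  then have "fps_X ^ n dvd (fps_X :: 'a fps) ^ (k * n)" by (intro le_imp_power_dvd) simp
  then show "fps_X ^ n dvd h n * U k n" unfolding U_def D_def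
    by (metis dvd_mult dvd_mult2)
qed

lemma U_0: "U k 0 = 0" by (simp add: U_def)

lemma U_Suc: "Q * U (Suc m) (Suc r) =
   - (D (Suc m) r * F (Suc r) * (1 - fps_X * Q ^ Suc r) * Q ^ r * fps_X ^ Suc m * ((s r)\<^sup>2) ^ m * (c * s r) * (1 + s r) * (1 + Q ^ Suc r))"
proof -
  have "Q * U (Suc m) (Suc r) = (D (Suc m) (Suc r) * (1 - Q ^ Suc r) * Q\<^sup>2) * F (Suc r) * s r"
    unfolding U_def s_Suc by (simp only: mult_ac power2_eq_square)
  then show ?thesis unfolding D_Suc by (simp add: mult_ac)
qed

text \<open>Each side has two parts. On the left, the part without powers of $x s_r^2$ is
  \<open>U\<close> at \<open>r\<close>, and the other one equals the first half of the dilated right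
  side. The second half of the right side is \<open>U\<close> at \<open>Suc r\<close>, so the sides
  agree only after a shift of \<open>r\<close>, that is, up to telescoping.\<close>

lemma single_term_diff:
  fixes p u r :: nat
  defines "k \<equiv> Suc (p + u)"
  shows "c * (1 - fps_X * c) * (single_term k (Suc p) r - single_term k p r)
     - dil (fps_X ^ p * (c * (single_term k (Suc u) r + fps_X * single_term k u r) + single_term k (Suc (Suc u)) r + fps_X * single_term k (Suc u) r))
   = (- (c * (1 - fps_X * c) * Q ^ (Suc u * Suc r) * U k (Suc r))) - (- (c * (1 - fps_X * c) * Q ^ (Suc u * r) * U k r))"
proof -
  define X where "X = (fps_X :: 'a fps)"
  define y where "y = Q ^ r"
  define Y where "Y = Q ^ Suc r"
  define t where "t = s r"
  define Z where "Z = X * t\<^sup>2"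
  define G where "G = D k r * F (Suc r)"
  have Yy: "Y = Q * y" by (simp add: y_def Y_def)
  have tc: "t = c * y" by (simp add: t_def y_def s_def)
  have t2: "t\<^sup>2 = Y * y" unfolding tc Yy by (simp add: Q_def power2_eq_square mult_ac)
  have Fr: "F r = (1 + X * t) * (1 + X * Y) * F (Suc r)"
    unfolding F_rec[of r] t_def X_def s_def Y_def by (simp only: mult_ac)
  have pw: "Q ^ (n * r) = y ^ n" for n by (simp add: y_def mult.commute flip: power_mult)
  have ku: "k + 1 - Suc p = Suc u" "k + 1 - p = Suc (Suc u)" "k + 1 - Suc u = Suc p"
     "k + 1 - u = Suc (Suc p)" "k + 1 - Suc (Suc u) = p" by (simp_all add: k_def)
  have t: "single_term k i r = G * (1 + X * Y) * y ^ (k + 1 - i) * ((1 + X * t) * t - (1 + t) * Z ^ i)" for i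
    unfolding single_term_def G_def X_def t_def Z_def Y_def pw by (simp only: mult_ac)
  have L: "c * (1 - X * c) * (single_term k (Suc p) r - single_term k p r) =
      c * (1 - X * c) * y ^ Suc u * U k r + c * (1 - X * c) * G * (1 + X * Y) * y ^ Suc u * (1 + t) * Z ^ p * (y - Z)"
    unfolding t ku U_def Fr t_def[symmetric] y_def[symmetric] G_def by (simp add: algebra_simps)
  have yZ: "y - Z = y * (1 - X * Y)" unfolding Z_def t2 by (simp add: algebra_simps)
  have s2: "t\<^sup>2 + y = y * (1 + Y)" unfolding t2 by (simp add: algebra_simps)
  have "c * (single_term k (Suc u) r + X * single_term k u r) + single_term k (Suc (Suc u)) r + X * single_term k (Suc u) r =
     G * (1 + X * Y) * y ^ p * (t * (1 + X * t) * (c * y + c * y * X * y + 1 + X * y)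
       - (1 + t) * Z ^ u * (c * y * Z + c * y * X * y + Z * Z + X * y * Z))"
    unfolding t ku by (simp add: algebra_simps)
  \<comment> \<open>Both brackets factor for this combination of four neighbours, and the common
    factor $1 + x s_r$ restores \<open>F r\<close>, whose dilation is known from
    \<open>dil_F\<close>.\<close>
  also have "c * y + c * y * X * y + 1 + X * y = (1 + t) * (1 + X * y)"
    unfolding tc by (simp add: algebra_simps)
  also have "c * y * Z + c * y * X * y + Z * Z + X * y * Z = X * t * (t\<^sup>2 + y) * (1 + X * t)"
    unfolding Z_def tc[symmetric] by (simp add: algebra_simps power2_eq_square)
  also have "G * (1 + X * Y) * y ^ p * (t * (1 + X * t) * ((1 + t) * (1 + X * y))
       - (1 + t) * Z ^ u * (X * t * (t\<^sup>2 + y) * (1 + X * t))) =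
      D k r * F r * (y ^ p * t * (1 + t) * ((1 + X * y) - Z ^ u * (X * (y * (1 + Y)))))"
    unfolding s2 Fr G_def by (simp add: algebra_simps)
  finally have R0: "c * (single_term k (Suc u) r + X * single_term k u r) + single_term k (Suc (Suc u)) r + X * single_term k (Suc u) r =
     D k r * F r * (y ^ p * t * (1 + t) * ((1 + X * y) - Z ^ u * (X * (y * (1 + Y)))))" .
  have dil': "dil y = y" "dil t = t" "dil Y = Y" "dil X = X * Q" "dil Z = Z * Q"
    unfolding Z_def by (simp_all add: y_def t_def Y_def X_def dilate_simps dil_Q dil_s dil_X mult_ac del: dilate_X)
  have dDF: "dil (D k r * F r) = D k r * (1 - X * Y) * y ^ k * (1 - X * c) * F (Suc r)"
  proof -
    have "dil (D k r * F r) = ((1 - X * Q) * dil (D k r)) * ((1 - X * c) * F (Suc r))"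
      unfolding dilate_mult dil_F X_def by (simp only: mult_ac)
    also have "\<dots> = D k r * (1 - X * Y) * y ^ k * (1 - X * c) * F (Suc r)"
      unfolding X_def dil_D pw Y_def[symmetric] by (simp only: mult_ac)
    finally show ?thesis .
  qed
  have R: "dil (X ^ p * (c * (single_term k (Suc u) r + X * single_term k u r) + single_term k (Suc (Suc u)) r + X * single_term k (Suc u) r)) =
     (X * Q) ^ p * (G * (1 - X * Y) * y ^ k * (1 - X * c)) *
       (y ^ p * t * (1 + t) * ((1 + X * Y) - (Z * Q) ^ u * (X * (Y * (1 + Y)))))"
    unfolding R0 dilate_mult[of _ "X ^ p"] dilate_mult[of _ "D k r * F r"] dDF G_def
    by (simp add: dilate_mult dilate_add dilate_diff dilate_power dilate_1 dil' dil_Q Yy mult_ac)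
  have US: "Q ^ (Suc u * Suc r) * U k (Suc r) =
     - (Q ^ u * y ^ Suc u * G * (1 - X * Y) * y * X ^ k * (t\<^sup>2) ^ (p + u) * (c * t) * (1 + t) * (1 + Y))"
  proof -
    have "Q ^ (Suc u * Suc r) = Q ^ u * y ^ Suc u * Q"
      unfolding pw[symmetric] by (simp add: power_add mult_ac)
    then have "Q ^ (Suc u * Suc r) * U k (Suc r) = Q ^ u * y ^ Suc u * (Q * U k (Suc r))" by (simp only: mult_ac)
    then show ?thesis unfolding k_def U_Suc
      unfolding k_def[symmetric] y_def[symmetric] Y_def[symmetric] t_def[symmetric] X_def[symmetric] G_def
      by (simp add: mult_ac)
  qed
  have Qy: "Q * y * y = t\<^sup>2" unfolding t2 Yy ..
  \<comment> \<open>\<open>m1\<close> matches the second part of the left side with the first half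
    of the right side, \<open>m2\<close> matches \<open>U\<close> at \<open>Suc r\<close> with the
    other half.\<close>
  have m1: "c * y ^ Suc u * Z ^ p * y = (X * Q) ^ p * y ^ k * y ^ p * t"
  proof -
    have "(X * Q) ^ p * y ^ k * y ^ p * t = X ^ p * (Q * y * y) ^ p * y ^ Suc u * t"
      unfolding k_def by (simp add: power_add power_mult_distrib mult_ac)
    also have "\<dots> = c * y ^ Suc u * Z ^ p * y"
      unfolding Qy unfolding Z_def tc by (simp add: power_mult_distrib mult_ac)
    finally show ?thesis ..
  qed
  have m2: "c * Q ^ u * y ^ Suc u * y * X ^ k * (t\<^sup>2) ^ (p + u) * (c * t) =
     (X * Q) ^ p * y ^ k * y ^ p * t * (Z * Q) ^ u * (X * Y)"
  proof -
    have "(X * Q) ^ p * y ^ k * y ^ p * t * (Z * Q) ^ u * (X * Y)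
       = X ^ p * (Q * y * y) ^ p * y ^ Suc u * t * (X * t\<^sup>2 * Q) ^ u * (X * Y)"
      unfolding k_def Z_def by (simp add: power_add power_mult_distrib mult_ac)
    also have "\<dots> = X ^ p * (t\<^sup>2) ^ p * y ^ Suc u * t * (X * t\<^sup>2 * Q) ^ u * (X * (c\<^sup>2 * y))"
      unfolding Qy unfolding Yy Q_def ..
    also have "\<dots> = c * Q ^ u * y ^ Suc u * y * X ^ k * (t\<^sup>2) ^ (p + u) * (c * t)"
      unfolding k_def by (simp add: power_add power_mult_distrib power2_eq_square mult_ac)
    finally show ?thesis ..
  qed
  define H where "H = (1 - X * c) * G * (1 - X * Y) * (1 + t)"
  have A1: "c * (1 - X * c) * (single_term k (Suc p) r - single_term k p r) - c * (1 - X * c) * y ^ Suc u * U k r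
      = H * (1 + X * Y) * (c * y ^ Suc u * Z ^ p * y)"
    unfolding L yZ H_def by (simp add: algebra_simps)
  have A2: "c * (1 - X * c) * Q ^ (Suc u * Suc r) * U k (Suc r) =
     - (H * (1 + Y) * (c * Q ^ u * y ^ Suc u * y * X ^ k * (t\<^sup>2) ^ (p + u) * (c * t)))"
  proof -
    have "c * (1 - X * c) * Q ^ (Suc u * Suc r) * U k (Suc r) = c * (1 - X * c) * (Q ^ (Suc u * Suc r) * U k (Suc r))"
      by (simp only: mult_ac)
    then show ?thesis unfolding US H_def by (simp only: mult_ac mult_minus_left mult_minus_right)
  qed
  have A3: "dil (X ^ p * (c * (single_term k (Suc u) r + X * single_term k u r) + single_term k (Suc (Suc u)) r + X * single_term k (Suc u) r)) =
     H * (1 + X * Y) * ((X * Q) ^ p * y ^ k * y ^ p * t)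
      - H * (1 + Y) * ((X * Q) ^ p * y ^ k * y ^ p * t * (Z * Q) ^ u * (X * Y))"
    unfolding R H_def by (simp add: right_diff_distrib mult_ac)
  have "a - b = (- e) - (- f)" if "a - f = P" "e = - N" "b = P - N" for a b e f P N :: "'a fps"
    using that by (simp add: algebra_simps)
  from this[OF A1[unfolded m1] A2[unfolded m2] A3] show ?thesis
    unfolding X_def pw .
qed

text \<open>Summed over \<open>r\<close>, the telescoping part disappears. The instance
  \<open>p = 0\<close> involves both extra indices \<open>0\<close> and \<open>k + 1\<close>, the
  instance \<open>u = 0\<close> the index \<open>0\<close>.\<close>

lemma single_rec:
  fixes p u :: nat
  defines "k \<equiv> Suc (p + u)"
  defines "J \<equiv> \<lambda>i. adic_sum (single_term k i)"
  shows "c * (1 - fps_X * c) * (J (Suc p) - J p) =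
     dil (fps_X ^ p * (c * (J (Suc u) + fps_X * J u) + J (Suc (Suc u)) + fps_X * J (Suc u)))"
proof -
  have k1: "1 \<le> k" by (simp add: k_def)
  note ad = adic_single_term[OF k1]
  have ad2: "adic (\<lambda>r. f r + g r)" if "adic f" "adic g" for f g :: "nat \<Rightarrow> 'a fps"
    using that by (simp add: adic_def)
  have ad3: "adic (\<lambda>r. f r - g r)" if "adic f" "adic g" for f g :: "nat \<Rightarrow> 'a fps"
    using that by (simp add: adic_def)
  define g where "g r = - (c * (1 - fps_X * c) * Q ^ (Suc u * r) * U k r)" for r
  have adg: "adic g" using adic_U[OF k1, of "\<lambda>r. - (c * (1 - fps_X * c) * Q ^ (Suc u * r))"]
    by (simp add: g_def[abs_def])
  have "adic_sum (\<lambda>r. c * (1 - fps_X * c) * (single_term k (Suc p) r - single_term k p r)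
     - dil (fps_X ^ p * (c * (single_term k (Suc u) r + fps_X * single_term k u r) + single_term k (Suc (Suc u)) r + fps_X * single_term k (Suc u) r)))
     = adic_sum (\<lambda>r. g (Suc r) - g r)"
    unfolding g_def k_def single_term_diff ..
  also have "\<dots> = 0" unfolding adic_sum_telescope[OF adg] by (simp add: g_def U_0)
  finally have "adic_sum (\<lambda>r. c * (1 - fps_X * c) * (single_term k (Suc p) r - single_term k p r)) =
    dil (adic_sum (\<lambda>r. fps_X ^ p * (c * (single_term k (Suc u) r + fps_X * single_term k u r) + single_term k (Suc (Suc u)) r + fps_X * single_term k (Suc u) r)))"
    unfolding adic_sum_diff dilate_adic_sum[symmetric] by simp
  then show ?thesis
    unfolding J_def
    by (simp add: adic_sum_mult adic_sum_add adic_sum_diff ad ad2 ad3 adic_mult)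
qed

text \<open>Termwise: the bracket of \<open>single_term\<close> is $x s_r^2 - 1$ at
  \<open>i = 0\<close> and $s_r (1 - x s_r^2)$ at \<open>i = 1\<close>, and $c Q^r = s_r$.\<close>

lemma single_0: "c * adic_sum (single_term k 0) = - adic_sum (single_term k 1)" if "1 \<le> k"
proof -
  have "c * single_term k 0 r + single_term k 1 r = 0" for r
  proof -
    have "Q ^ ((k + 1 - 0) * r) = Q ^ ((k + 1 - 1) * r) * Q ^ r" by (simp add: power_add mult_ac)
    then show ?thesis unfolding single_term_def by (simp add: s_def algebra_simps power2_eq_square)
  qed
  then have "adic_sum (\<lambda>r. c * single_term k 0 r + single_term k 1 r) = 0" by (simp add: adic_sum_def fps_eq_iff)
  then show ?thesis
    unfolding adic_sum_add adic_sum_mult[OF adic_single_term[OF that]] by (simp add: eq_neg_iff_add_eq_0)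
qed

text \<open>Eliminates the index \<open>k + 1\<close>. The difference of the two sides telescopes
  without any dilation, with $(1 + xQ^r) U$ as the telescoping quantity.\<close>

lemma single_top:
  fixes m :: nat
  defines "k \<equiv> Suc m"
  defines "J \<equiv> \<lambda>i. adic_sum (single_term k i)"
  shows "J (Suc k) + fps_X * J k = J k + fps_X * J m"
proof -
  have k1: "1 \<le> k" by (simp add: k_def)
  note ad = adic_single_term[OF k1]
  define g where "g r = - ((1 + fps_X * Q ^ r) * U k r)" for r
  have adg: "adic g" using adic_U[OF k1, of "\<lambda>r. - (1 + fps_X * Q ^ r)"]
    unfolding g_def[abs_def] by (simp only: mult_minus_left)
  \<comment> \<open>The factor \<open>Q\<close> is there because \<open>U_Suc\<close> determines
    \<open>Q * U\<close>.\<close>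
  have step: "Q * (single_term k (Suc k) r - single_term k k r + fps_X * (single_term k k r - single_term k m r)) = Q * (g (Suc r) - g r)" for r
  proof -
    define X where "X = (fps_X :: 'a fps)"
    define y where "y = Q ^ r"
    define Y where "Y = Q ^ Suc r"
    define t where "t = s r"
    define Z where "Z = X * t\<^sup>2"
    define G where "G = D k r * F (Suc r)"
    have Yy: "Y = Q * y" by (simp add: y_def Y_def)
    have tc: "t = c * y" by (simp add: t_def y_def s_def)
    have t2: "t\<^sup>2 = Y * y" unfolding tc Yy by (simp add: Q_def power2_eq_square mult_ac)
    have ct: "c * t = Y" unfolding tc Yy by (simp add: Q_def power2_eq_square mult_ac)
    have Fr: "F r = (1 + X * t) * (1 + X * Y) * F (Suc r)"
      unfolding F_rec[of r] t_def X_def s_def Y_def by (simp only: mult_ac)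
    have pw: "Q ^ (n * r) = y ^ n" for n by (simp add: y_def mult.commute flip: power_mult)
    have t: "single_term k i r = G * (1 + X * Y) * y ^ (k + 1 - i) * ((1 + X * t) * t - (1 + t) * Z ^ i)" for i
      unfolding single_term_def G_def X_def t_def Z_def Y_def pw by (simp only: mult_ac)
    have ku: "k + 1 - Suc k = 0" "k + 1 - k = 1" "k + 1 - m = 2" by (simp_all add: k_def)
    have "single_term k (Suc k) r - single_term k k r + X * (single_term k k r - single_term k m r) =
       (1 + X * y) * U k r - G * (1 + X * Y) * (1 + t) * Z ^ m * (Z * Z - y * Z + X * (y * Z - y * y))"
      unfolding t ku U_def Fr t_def[symmetric] y_def[symmetric] G_def
      by (simp add: k_def algebra_simps power2_eq_square)
    also have "Z * Z - y * Z + X * (y * Z - y * y) = - (X * y * y * (1 + Y) * (1 - X * Y))"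
      unfolding Z_def t2 by (simp add: algebra_simps)
    finally have L: "single_term k (Suc k) r - single_term k k r + X * (single_term k k r - single_term k m r) =
      (1 + X * y) * U k r + G * (1 + X * Y) * (1 + t) * Z ^ m * (X * y * y * (1 + Y) * (1 - X * Y))"
      by simp
    have "Q * ((1 + X * Y) * U k (Suc r)) = (1 + X * Y) * (Q * U (Suc m) (Suc r))"
      unfolding k_def by (simp only: mult_ac)
    also have "\<dots> = - ((1 + X * Y) * (G * (1 - X * Y) * y * X ^ k * (t\<^sup>2) ^ m * (c * t) * (1 + t) * (1 + Y)))"
      unfolding U_Suc unfolding k_def[symmetric] y_def[symmetric] Y_def[symmetric] t_def[symmetric] X_def[symmetric] G_def
      by (simp only: mult_minus_right mult_ac)
    also have "\<dots> = - (Q * (G * (1 + X * Y) * (1 + t) * Z ^ m * (X * y * y * (1 + Y) * (1 - X * Y))))"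
      unfolding ct Z_def k_def Yy by (simp add: power_mult_distrib mult_ac)
    finally show ?thesis
      using L unfolding g_def X_def[symmetric] y_def[symmetric] Y_def[symmetric]
      by (simp add: right_diff_distrib distrib_left)
  qed
  have "Q \<noteq> 0" using q_nz by (simp add: Q_const)
  then have "adic_sum (\<lambda>r. single_term k (Suc k) r - single_term k k r + fps_X * (single_term k k r - single_term k m r)) = adic_sum (\<lambda>r. g (Suc r) - g r)"
    using step by simp
  also have "\<dots> = 0" unfolding adic_sum_telescope[OF adg] by (simp add: g_def U_0)
  finally have "adic_sum (single_term k (Suc k)) - adic_sum (single_term k k) + fps_X * (adic_sum (single_term k k) - adic_sum (single_term k m)) = 0"
    using adic_sum_mult[of "\<lambda>r. single_term k k r - single_term k m r" fps_X] ad
    by (simp add: adic_sum_add adic_sum_diff adic_def)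
  then show ?thesis unfolding J_def by (simp add: algebra_simps)
qed


subsection \<open>Uniqueness of the solution\<close>

text \<open>The equations in the form in which removing small parts produces them. For $k = p + 1$ a
  layer with $k - 1$ plain parts 2 admits no plain part 1, so its equation is not the instance
  \<open>u = 0\<close> of the last one; for \<open>k = 1\<close> the first equation differs for the
  same reason.\<close>

definition op_system :: "nat \<Rightarrow> (nat \<Rightarrow> 'a fps) \<Rightarrow> bool" where
  "op_system k G \<longleftrightarrow>
     (k = 1 \<longrightarrow> G 1 = dil (G 1)) \<and>
     (k \<ge> 2 \<longrightarrow> (1 - fps_X * c) * G 1 = dil (G k + fps_X * G (k - 1))) \<and>
     (\<forall>p\<ge>1. k = Suc p \<longrightarrow>
        c * (1 - fps_X * c) * (G k - G p) = dil (fps_X ^ p * (c * G 1 + G 2))) \<and>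
     (\<forall>p\<ge>1. \<forall>u\<ge>1. k = Suc (p + u) \<longrightarrow>
        c * (1 - fps_X * c) * (G (Suc p) - G p) =
        dil (fps_X ^ p * (c * (G (Suc u) + fps_X * G u) + G (Suc (Suc u)) + fps_X * G (Suc u))))"

lemma op_systemD:
  assumes "op_system k G"
  shows "k = 1 \<Longrightarrow> G 1 = dil (G 1)"
    "k \<ge> 2 \<Longrightarrow> (1 - fps_X * c) * G 1 = dil (G k + fps_X * G (k - 1))"
    "p \<ge> 1 \<Longrightarrow> k = Suc p \<Longrightarrow>
        c * (1 - fps_X * c) * (G k - G p) = dil (fps_X ^ p * (c * G 1 + G 2))"
    "p \<ge> 1 \<Longrightarrow> u \<ge> 1 \<Longrightarrow> k = Suc (p + u) \<Longrightarrow>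
        c * (1 - fps_X * c) * (G (Suc p) - G p) =
        dil (fps_X ^ p * (c * (G (Suc u) + fps_X * G u) + G (Suc (Suc u)) + fps_X * G (Suc u)))"
  using assms unfolding op_system_def by blast+

lemma op_system_diff:
  assumes G: "op_system k G" and H: "op_system k H"
  shows "op_system k (\<lambda>i. G i - H i)"
  unfolding op_system_def
proof (intro conjI allI impI)
  assume "k = 1"
  from op_systemD(1)[OF G this] op_systemD(1)[OF H this] show "G 1 - H 1 = dil (G 1 - H 1)"
    by (simp add: dilate_diff)
next
  assume "k \<ge> 2"
  from op_systemD(2)[OF G this] op_systemD(2)[OF H this]
  have "(1 - fps_X * c) * G 1 - (1 - fps_X * c) * H 1 =
     dil (G k + fps_X * G (k - 1)) - dil (H k + fps_X * H (k - 1))" by simp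
  then show "(1 - fps_X * c) * (G 1 - H 1) = dil (G k - H k + fps_X * (G (k - 1) - H (k - 1)))"
    unfolding dilate_diff[symmetric] right_diff_distrib by (simp add: algebra_simps)
next
  fix p assume a: "p \<ge> 1" "k = Suc p"
  from op_systemD(3)[OF G a] op_systemD(3)[OF H a]
  have "c * (1 - fps_X * c) * (G k - G p) - c * (1 - fps_X * c) * (H k - H p) =
    dil (fps_X ^ p * (c * G 1 + G 2)) - dil (fps_X ^ p * (c * H 1 + H 2))" by simp
  then show "c * (1 - fps_X * c) * (G k - H k - (G p - H p)) = dil (fps_X ^ p * (c * (G 1 - H 1) + (G 2 - H 2)))"
    unfolding dilate_diff[symmetric] right_diff_distrib[symmetric] by (simp add: algebra_simps)
next
  fix p u assume a: "p \<ge> 1" "u \<ge> 1" "k = Suc (p + u)"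
  from op_systemD(4)[OF G a] op_systemD(4)[OF H a]
  have "c * (1 - fps_X * c) * (G (Suc p) - G p) - c * (1 - fps_X * c) * (H (Suc p) - H p) =
     dil (fps_X ^ p * (c * (G (Suc u) + fps_X * G u) + G (Suc (Suc u)) + fps_X * G (Suc u))) -
     dil (fps_X ^ p * (c * (H (Suc u) + fps_X * H u) + H (Suc (Suc u)) + fps_X * H (Suc u)))" by simp
  then show "c * (1 - fps_X * c) * (G (Suc p) - H (Suc p) - (G p - H p)) =
    dil (fps_X ^ p * (c * (G (Suc u) - H (Suc u) + fps_X * (G u - H u)) + (G (Suc (Suc u)) - H (Suc (Suc u)))
      + fps_X * (G (Suc u) - H (Suc u))))"
    unfolding dilate_diff[symmetric] right_diff_distrib[symmetric] by (simp add: algebra_simps)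
qed

text \<open>Induction on the exponent of $x$. The factor $x^p$ lets only vanishing coefficients
  reach the right sides, so all \<open>G i\<close> share their coefficient of $x^m$; the equation of
  \<open>G 1\<close> then multiplies it by $q^{2m}$, which is not $1$ for $m > 0$.\<close>

lemma op_system_zero:
  assumes sys: "op_system k G" and zero: "\<And>i. 1 \<le> i \<Longrightarrow> i \<le> k \<Longrightarrow> G i $ 0 = 0"
  shows "1 \<le> i \<Longrightarrow> i \<le> k \<Longrightarrow> G i $ m = 0"
proof (induction m arbitrary: i rule: less_induct)
  case (less m)
  show ?case
  proof (cases m)
    case 0
    then show ?thesis using zero less.prems by simp
  next
    case (Suc n)
    have IH: "G j $ l = 0" if "1 \<le> j" "j \<le> k" "l \<le> n" for j l
      using less.IH[of l j] that Suc by simp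
    have XnI: "(fps_X * f) $ m = 0" if "f $ n = 0" for f :: "'a fps"
      using that Suc by simp
    have cn: "(c * f) $ l = q * f $ l" for f l by (simp add: c_def)
    have lhs: "((1 - fps_X * c) * f) $ m = f $ m" if "f $ n = 0" for f
    proof -
      have "(1 - fps_X * c) * f = f - fps_X * (c * f)" by (simp add: algebra_simps)
      then show ?thesis using XnI[of "c * f"] that by (simp add: cn)
    qed
    have rhs: "dil (fps_X ^ p * f) $ m = 0" if "1 \<le> p" "\<And>l. l \<le> n \<Longrightarrow> f $ l = 0" for p f
      using that Suc by (simp add: fps_X_power_mult_nth)
    have stepeq: "G (Suc p) $ m = G p $ m" if p: "1 \<le> p" "Suc p \<le> k" for p
    proof -
      have "(c * ((1 - fps_X * c) * (G (Suc p) - G p))) $ m = 0"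
      proof (cases "k = Suc p")
        case True
        then have eq: "c * ((1 - fps_X * c) * (G (Suc p) - G p)) = dil (fps_X ^ p * (c * G 1 + G 2))"
          using op_systemD(3)[OF sys p(1)] by (simp add: mult.assoc)
        show ?thesis unfolding eq
          by (rule rhs) (use p IH True in \<open>auto simp: cn\<close>)
      next
        case False
        define u where "u = k - Suc p"
        have u: "1 \<le> u" "k = Suc (p + u)" using False p by (auto simp: u_def)
        have eq: "c * ((1 - fps_X * c) * (G (Suc p) - G p)) =
          dil (fps_X ^ p * (c * (G (Suc u) + fps_X * G u) + G (Suc (Suc u)) + fps_X * G (Suc u)))"
          using op_systemD(4)[OF sys p(1) u] by (simp add: mult.assoc)
        have Xl: "(fps_X * G j) $ l = 0" if "1 \<le> j" "j \<le> k" "l \<le> n" for j l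
          using IH[OF that(1,2), of "l - 1"] that by simp
        show ?thesis unfolding eq
          by (rule rhs) (use p u IH Xl in \<open>auto simp: cn distrib_left\<close>)
      qed
      moreover have "((1 - fps_X * c) * (G (Suc p) - G p)) $ m = G (Suc p) $ m - G p $ m"
        using lhs[of "G (Suc p) - G p"] IH p by simp
      ultimately show ?thesis using q_nz by (simp add: cn)
    qed
    have all: "G (Suc p) $ m = G 1 $ m" if "Suc p \<le> k" for p
      using that
    proof (induction p)
      case (Suc p)
      then show ?case using stepeq[of "Suc p"] by simp
    qed simp
    have "G 1 $ m = (q\<^sup>2) ^ m * G 1 $ m"
    proof (cases "k = 1")
      case True
      from op_systemD(1)[OF sys this] show ?thesis by (metis dilate_nth)
    next
      case False
      then have k2: "k \<ge> 2" using less.prems by simp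
      have "G 1 $ m = ((1 - fps_X * c) * G 1) $ m"
        using lhs[of "G 1"] IH[of 1 n] k2 by simp
      also have "\<dots> = (q\<^sup>2) ^ m * (G k $ m + (fps_X * G (k - 1)) $ m)"
        unfolding op_systemD(2)[OF sys k2] by simp
      also have "(fps_X * G (k - 1)) $ m = 0"
        by (rule XnI) (use IH k2 in auto)
      also have "G k $ m = G 1 $ m" using all[of "k - 1"] k2 by simp
      finally show ?thesis by simp
    qed
    then have "G 1 $ m = 0"
      using q2_root[of n] Suc by (simp del: power_Suc)
    then show ?thesis using all[of "i - 1"] less.prems by simp
  qed
qed

lemma op_system_unique:
  assumes "op_system k G" "op_system k H" "\<And>i. 1 \<le> i \<Longrightarrow> i \<le> k \<Longrightarrow> G i $ 0 = H i $ 0" "1 \<le> i" "i \<le> k"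
  shows "G i = H i"
  using op_system_zero[OF op_system_diff[OF assms(1,2)]] assms(3-) by (simp add: fps_eq_iff)

lemma op_system_single:
  assumes "1 \<le> k"
  shows "op_system k (\<lambda>i. adic_sum (single_term k i))"
proof -
  define J where "J i = adic_sum (single_term k i)" for i
  have J0: "c * J 0 = - J 1" unfolding J_def by (rule single_0[OF assms])
  have rec: "c * (1 - fps_X * c) * (J (Suc p) - J p) =
     dil (fps_X ^ p * (c * (J (Suc u) + fps_X * J u) + J (Suc (Suc u)) + fps_X * J (Suc u)))"
    if "k = Suc (p + u)" for p u
    using single_rec[of p u] that unfolding J_def by simp
  have top: "J (Suc k) + fps_X * J k = J k + fps_X * J (k - 1)"
    using single_top[of "k - 1"] assms unfolding J_def by simp
  have c1: "c + 1 \<noteq> 0"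
  proof
    assume "c + 1 = 0"
    then have "(c + 1) $ 0 = 0" by simp
    then have "q = - 1" by (simp add: c_def eq_neg_iff_add_eq_0)
    then show False using q_root[of 1] by simp
  qed
  have cc: "c + 1 = fps_const (q + 1)" by (simp add: c_def fps_const_add[symmetric] del: fps_const_add)
  have base: "(1 - fps_X * c) * J 1 = dil (J k + fps_X * J (k - 1))"
  proof -
    \<comment> \<open>The recurrence at \<open>p = 0\<close>: \<open>top\<close> produces a factor
      $c + 1$ on the right, \<open>J0\<close> produces the same factor on the left.\<close>
    have "c * (1 - fps_X * c) * (J 1 - J 0) = dil (c * (J k + fps_X * J (k - 1)) + (J (Suc k) + fps_X * J k))"
      using rec[of 0 "k - 1"] assms by (simp add: add.assoc)
    also have "\<dots> = dil ((c + 1) * (J k + fps_X * J (k - 1)))"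
      unfolding top by (simp add: algebra_simps)
    also have "\<dots> = (c + 1) * dil (J k + fps_X * J (k - 1))"
      unfolding cc by (simp add: dilate_mult dilate_const)
    also have "c * (1 - fps_X * c) * (J 1 - J 0) = (1 - fps_X * c) * (c * J 1 - c * J 0)"
      by (simp add: algebra_simps)
    also have "\<dots> = (c + 1) * ((1 - fps_X * c) * J 1)"
      unfolding J0 by (simp add: algebra_simps)
    finally show ?thesis using c1 by simp
  qed
  have "op_system k J"
    unfolding op_system_def
  proof (intro conjI allI impI)
    assume k: "k = 1"
    \<comment> \<open>For \<open>k = 1\<close> the right side becomes $(c - xQ)$ times the dilation
      of $J_1$, and $c - xQ = c (1 - xc)$ because $Q = c^2$.\<close>
    have "c * ((1 - fps_X * c) * J 1) = dil (c * J 1 + fps_X * (c * J 0))"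
      unfolding base using k by (simp add: dilate_mult dilate_add dil_c algebra_simps)
    also have "\<dots> = c * ((1 - fps_X * c) * dil (J 1))"
    proof -
      have "Q = c * c" by (simp add: Q_def power2_eq_square)
      then show ?thesis unfolding J0
        by (simp add: dilate_mult dilate_add dilate_diff dilate_uminus dil_c dil_X algebra_simps)
    qed
    finally have "c * (1 - fps_X * c) * J 1 = c * (1 - fps_X * c) * dil (J 1)" by (simp add: mult.assoc)
    moreover have "c \<noteq> 0" using q_nz by (simp add: c_def)
    moreover have "1 - fps_X * c \<noteq> 0"
    proof
      assume "1 - fps_X * c = 0"
      then have "(1 - fps_X * c) $ 0 = 0" by simp
      then show False by simp
    qed
    ultimately show "J 1 = dil (J 1)" by simp
  next
    show "(1 - fps_X * c) * J 1 = dil (J k + fps_X * J (k - 1))" by (rule base)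
  next
    fix p assume "1 \<le> p" and k: "k = Suc p"
    have "c * (J (Suc 0) + fps_X * J 0) + J (Suc (Suc 0)) + fps_X * J (Suc 0) =
       c * J 1 + fps_X * (c * J 0) + J 2 + fps_X * J 1"
      by (simp add: algebra_simps numeral_2_eq_2)
    also have "\<dots> = c * J 1 + J 2" unfolding J0 by simp
    finally show "c * (1 - fps_X * c) * (J k - J p) = dil (fps_X ^ p * (c * J 1 + J 2))"
      using rec[of p 0] k by simp
  next
    fix p u assume "k = Suc (p + u)"
    then show "c * (1 - fps_X * c) * (J (Suc p) - J p) =
     dil (fps_X ^ p * (c * (J (Suc u) + fps_X * J u) + J (Suc (Suc u)) + fps_X * J (Suc u)))"
      by (rule rec)
  qed
  then show ?thesis by (simp only: J_def[abs_def])
qed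

lemma multisum_unique:
  assumes "op_system k G" "\<And>i. 1 \<le> i \<Longrightarrow> i \<le> k \<Longrightarrow> G i $ 0 = 1" "1 \<le> i" "i \<le> k"
  shows "G i = multisum k i"
  unfolding multisum_eq_single[OF assms(3,4)]
  by (rule op_system_unique[OF assms(1) op_system_single]) (use assms single_nth_0 in auto)

end

subsection \<open>Overpartitions\<close>

text \<open>
  An overpartition, given by the multiset of its non-overlined parts and the set of its overlined parts.
\<close>

type_synonym split_op = "nat multiset \<times> nat set"

definition ops :: "split_op set" where
  "ops = {(U, V). 0 \<notin># U \<and> finite V \<and> 0 \<notin> V}"

definition parts :: "split_op \<Rightarrow> nat" where
  "parts z = size (fst z) + card (snd z)"

definition weight :: "split_op \<Rightarrow> nat" where
  "weight z = sum_mset (fst z) + \<Sum>(snd z)"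

definition over :: "split_op \<Rightarrow> nat \<Rightarrow> nat" where
  "over z t = (if t \<in> snd z then 1 else 0)"

definition plain :: "split_op \<Rightarrow> nat \<Rightarrow> nat" where
  "plain z t = count (fst z) t"

definition slice :: "split_op set \<Rightarrow> nat \<Rightarrow> nat \<Rightarrow> split_op set" where
  "slice Z m n = {z \<in> Z. parts z = m \<and> weight z = n}"

definition gf :: "split_op set \<Rightarrow> rat fls fps" where
  "gf Z = Abs_fps (\<lambda>m. fps_to_fls (Abs_fps (\<lambda>n. of_nat (card (slice Z m n)))))"

lemma finite_slice:
  assumes "Z \<subseteq> ops"
  shows "finite (slice Z m n)"
proof -
  have "slice Z m n \<subseteq> (\<Union>l\<le>m. multisets_of_size {..n} l) \<times> Pow {..n}"
  proof
    fix z assume z: "z \<in> slice Z m n"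
    obtain U V where zUV: "z = (U, V)" by (cases z)
    have *: "finite V" "size U + card V = m" "sum_mset U + \<Sum>V = n"
      using z assms by (auto simp: slice_def ops_def parts_def weight_def zUV)
    have "t \<le> n" if tU: "t \<in># U" for t
    proof -
      obtain U' where "U = add_mset t U'" using multi_member_split[OF tU] by blast
      then have "t \<le> sum_mset U" by simp
      then show ?thesis using * by simp
    qed
    moreover have "t \<le> n" if "t \<in> V" for t
    proof -
      have "t \<le> \<Sum>V" using that *(1) by (simp add: member_le_sum[where f = "\<lambda>t. t"])
      then show ?thesis using * by simp
    qed
    ultimately show "z \<in> (\<Union>l\<le>m. multisets_of_size {..n} l) \<times> Pow {..n}"
      using * by (auto simp: zUV multisets_of_size_def)
  qed
  then show ?thesis by (rule finite_subset) (auto simp: finite_multisets_of_size)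
qed

lemma gf_Un:
  assumes "X \<subseteq> ops" "Y \<subseteq> ops" "X \<inter> Y = {}"
  shows "gf (X \<union> Y) = gf X + gf Y"
proof -
  have "card (slice (X \<union> Y) m n) = card (slice X m n) + card (slice Y m n)" for m n
  proof -
    have "slice (X \<union> Y) m n = slice X m n \<union> slice Y m n" by (auto simp: slice_def)
    moreover have "slice X m n \<inter> slice Y m n = {}" using assms by (auto simp: slice_def)
    ultimately show ?thesis using card_Un_disjoint finite_slice assms by metis
  qed
  moreover have "Abs_fps (\<lambda>n. f n + g n) = Abs_fps f + Abs_fps g" for f g :: "nat \<Rightarrow> rat"
    by (rule fps_ext) simp
  ultimately show ?thesis
    by (intro fps_ext) (simp add: gf_def)
qed

lemma gf_empty: "gf {} = 0"
  by (rule fps_ext) (simp add: gf_def slice_def fps_zero_def[symmetric])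

text \<open>Raising every part by \<open>e\<close> substitutes $x q^e$ for $x$; \<open>a\<close> and
  \<open>b\<close> are the number and the total size of the parts that are added.\<close>

lemma gf_bij:
  assumes bij: "bij_betw f X Y"
    and parts: "\<And>z. z \<in> X \<Longrightarrow> parts (f z) = parts z + a"
    and weight: "\<And>z. z \<in> X \<Longrightarrow> weight (f z) = weight z + e * parts z + b"
  shows "gf Y = fps_X ^ a * fps_const (fls_X ^ b) * dilate (fls_X ^ e) (gf X)"
proof (rule fps_ext)
  fix m
  have Y: "Y = f ` X" using bij by (simp add: bij_betw_def)
  have inj: "inj_on f X" using bij by (simp add: bij_betw_def)
  show "gf Y $ m = (fps_X ^ a * fps_const (fls_X ^ b) * dilate (fls_X ^ e) (gf X)) $ m"
  proof (cases "m < a")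
    case True
    then have "slice Y m n = {}" for n by (auto simp: slice_def Y parts)
    then have "gf Y $ m = 0" by (simp add: gf_def fps_zero_def[symmetric])
    then show ?thesis using True by (simp add: mult.assoc fps_X_power_mult_nth)
  next
    case False
    define l where "l = m - a"
    have m: "m = l + a" using False by (simp add: l_def)
    define h where "h = b + e * l"
    have "card (slice Y m n) = (if n < h then 0 else card (slice X l (n - h)))" for n
    proof -
      have eq: "slice Y m n = f ` {z \<in> X. parts z = l \<and> weight z + h = n}"
        by (auto simp: slice_def Y parts weight m h_def)
      show ?thesis
      proof (cases "n < h")
        case True
        then show ?thesis unfolding eq by auto
      next
        case False
        then have "{z \<in> X. parts z = l \<and> weight z + h = n} = slice X l (n - h)"
          by (auto simp: slice_def)
        moreover have "inj_on f (slice X l (n - h))"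
          by (rule inj_on_subset[OF inj]) (auto simp: slice_def)
        ultimately show ?thesis unfolding eq using False by (simp add: card_image)
      qed
    qed
    then have "Abs_fps (\<lambda>n. of_nat (card (slice Y m n)) :: rat) = fps_X ^ h * Abs_fps (\<lambda>n. of_nat (card (slice X l n)))"
      by (intro fps_ext) (simp add: fps_X_power_mult_nth)
    then have "gf Y $ m = fls_X ^ h * gf X $ l"
      by (simp add: gf_def fls_times_fps_to_fls fps_to_fls_power)
    also have "\<dots> = (fps_X ^ a * fps_const (fls_X ^ b) * dilate (fls_X ^ e) (gf X)) $ m"
      by (simp add: mult.assoc fps_X_power_mult_nth m h_def power_add power_mult)
    finally show ?thesis .
  qed
qed

context
  fixes k :: nat
begin

text \<open>Strict bounds over the naturals express the integer bounds of \<open>admissible\<close>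
  without subtraction, also for \<open>k = 1\<close>.\<close>

definition gap_ops :: "split_op set" where
  "gap_ops = {z \<in> ops.
     (\<forall>t. over z (2*t) + plain z (2*t) + over z (2*t+1) + plain z (2*t+2) < k) \<and>
     (\<forall>t. plain z (2*t+1) \<ge> 1 \<longrightarrow> plain z (2*t+2) + 1 < k)}"

definition admissible_ops :: "nat \<Rightarrow> split_op set" where
  "admissible_ops i = {z \<in> gap_ops. over z 1 + plain z 2 < i}"

text \<open>
  The admissible overpartitions are cut into layers by the numbers of parts $\overline{1}$ and $2$;
  \<open>layer0\<close> also forbids the part $1$.
\<close>

definition layer :: "nat \<Rightarrow> nat \<Rightarrow> split_op set" where
  "layer a c = {z \<in> gap_ops. over z 1 = a \<and> plain z 2 = c}"

definition layer0 :: "nat \<Rightarrow> nat \<Rightarrow> split_op set" where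
  "layer0 a c = {z \<in> layer a c. plain z 1 = 0}"

lemma gap_ops_subset: "gap_ops \<subseteq> ops" by (auto simp: gap_ops_def)
lemma admissible_ops_subset: "admissible_ops i \<subseteq> ops" using gap_ops_subset by (auto simp: admissible_ops_def)
lemma layer_subset: "layer a c \<subseteq> ops" using gap_ops_subset by (auto simp: layer_def)
lemma layer0_subset: "layer0 a c \<subseteq> ops" using layer_subset by (auto simp: layer0_def)

lemma gf_admissible_0: "gf (admissible_ops 0) = 0"
  using gf_empty by (simp add: admissible_ops_def)

lemma gf_admissible_1: "gf (admissible_ops 1) = gf (layer 0 0)"
  by (rule arg_cong[where f = gf]) (auto simp: admissible_ops_def layer_def)

text \<open>The overlined part 1 occurs at most once, so the additional value \<open>p\<close> of
  the bounded sum arises in two ways only.\<close>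

lemma gf_admissible_Suc:
  assumes "p \<ge> 1"
  shows "gf (admissible_ops (Suc p)) = gf (admissible_ops p) + gf (layer 0 p) + gf (layer 1 (p - 1))"
proof -
  have "admissible_ops (Suc p) = admissible_ops p \<union> layer 0 p \<union> layer 1 (p - 1)"
    using assms by (auto simp: admissible_ops_def layer_def over_def)
  moreover have "gf (admissible_ops p \<union> layer 0 p \<union> layer 1 (p - 1)) = gf (admissible_ops p \<union> layer 0 p) + gf (layer 1 (p - 1))"
    by (rule gf_Un) (use admissible_ops_subset layer_subset assms in \<open>auto simp: admissible_ops_def layer_def\<close>)
  moreover have "gf (admissible_ops p \<union> layer 0 p) = gf (admissible_ops p) + gf (layer 0 p)"
    by (rule gf_Un) (use admissible_ops_subset layer_subset assms in \<open>auto simp: admissible_ops_def layer_def\<close>)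
  ultimately show ?thesis by simp
qed

text \<open>The condition on odd parts at \<open>t = 0\<close> excludes a plain part 1 once there
  are $k - 1$ plain parts 2.\<close>

lemma gf_layer_top:
  assumes "c + 1 \<ge> k"
  shows "gf (layer a c) = gf (layer0 a c)"
proof -
  have "plain z 1 = 0" if "z \<in> layer a c" for z
  proof -
    have "plain z (2*0+1) \<ge> 1 \<longrightarrow> plain z (2*0+2) + 1 < k"
      using that unfolding layer_def gap_ops_def by blast
    then show ?thesis using that assms by (auto simp: layer_def numeral_2_eq_2)
  qed
  then show ?thesis by (intro arg_cong[where f = gf]) (auto simp: layer0_def)
qed

lemma dilate_one: "dilate 1 f = f"
  by (rule fps_ext) simp

text \<open>The plain part 1 occurs only in the condition on odd parts at \<open>t = 0\<close>,
  which holds here in any case. Adding one such part maps the layer bijectively onto its members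
  that contain one, which gives the geometric factor $1/(1 - xq)$.\<close>

lemma gf_layer_low:
  assumes "c + 1 < k"
  shows "(1 - fps_X * fps_const fls_X) * gf (layer a c) = gf (layer0 a c)"
proof -
  define f where "f z = (add_mset 1 (fst z), snd z)" for z :: split_op
  have pl: "plain (f z) t = plain z t + (if t = 1 then 1 else 0)" for z t
    by (simp add: f_def plain_def)
  have ov: "over (f z) t = over z t" for z t by (simp add: f_def over_def)
  have mem: "f z \<in> layer a c \<longleftrightarrow> z \<in> layer a c" for z
  proof -
    have "f z \<in> ops \<longleftrightarrow> z \<in> ops" by (cases z) (auto simp: f_def ops_def)
    moreover have "plain (f z) (2*t) = plain z (2*t)" "plain (f z) (2*t+2) = plain z (2*t+2)" for t
      by (simp_all add: pl)
    moreover have "plain (f z) 2 = plain z 2" by (simp add: pl)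
    moreover have "(plain (f z) (2*t+1) \<ge> 1 \<longrightarrow> plain z (2*t+2) + 1 < k) \<longleftrightarrow> (plain z (2*t+1) \<ge> 1 \<longrightarrow> plain z (2*t+2) + 1 < k)"
      if "plain z 2 = c" for t
      using that assms by (cases "t = 0") (auto simp: pl numeral_2_eq_2)
    ultimately show ?thesis unfolding layer_def gap_ops_def by (auto simp: ov)
  qed
  have bij: "bij_betw f (layer a c) {z \<in> layer a c. plain z 1 \<ge> 1}"
  proof (rule bij_betwI')
    show "f z = f y \<longleftrightarrow> z = y" for z y by (auto simp: f_def prod_eq_iff)
    show "f z \<in> {z \<in> layer a c. plain z 1 \<ge> 1}" if "z \<in> layer a c" for z
      using that mem by (simp add: pl)
    fix y assume y: "y \<in> {z \<in> layer a c. plain z 1 \<ge> 1}"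
    define z where "z = (fst y - {#1#}, snd y)"
    have "1 \<in># fst y" using y by (simp add: plain_def)
    then have "f z = y" by (simp add: f_def z_def prod_eq_iff)
    then show "\<exists>z\<in>layer a c. y = f z" using mem[of z] y by auto
  qed
  have "gf {z \<in> layer a c. plain z 1 \<ge> 1} = fps_X ^ 1 * fps_const (fls_X ^ 1) * dilate (fls_X ^ 0) (gf (layer a c))"
    by (rule gf_bij[OF bij]) (auto simp: f_def parts_def weight_def)
  then have 1: "gf {z \<in> layer a c. plain z 1 \<ge> 1} = fps_X * fps_const fls_X * gf (layer a c)"
    by (simp add: dilate_one)
  have "layer a c = layer0 a c \<union> {z \<in> layer a c. plain z 1 \<ge> 1}"
    by (auto simp: layer0_def)
  moreover have "gf (layer0 a c \<union> {z \<in> layer a c. plain z 1 \<ge> 1}) = gf (layer0 a c) + gf {z \<in> layer a c. plain z 1 \<ge> 1}"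
    by (rule gf_Un) (use layer_subset layer0_subset in \<open>auto simp: layer0_def\<close>)
  ultimately have "gf (layer a c) = gf (layer0 a c) + fps_X * fps_const fls_X * gf (layer a c)"
    using 1 by metis
  then show ?thesis by (simp add: algebra_simps)
qed

text \<open>Inverse of the removal of small parts: \<open>a\<close> counts overlined parts 1,
  \<open>c\<close> plain parts 2, \<open>d\<close> overlined parts 2. The layer does not fix
  \<open>d\<close>, but the bound left for the larger parts depends on it.\<close>

definition push :: "nat \<Rightarrow> nat \<Rightarrow> nat \<Rightarrow> split_op \<Rightarrow> split_op" where
  "push a c d z = (replicate_mset c 2 + image_mset (\<lambda>t. t + 2) (fst z),
     {t. t = 1 \<and> a = 1 \<or> t = 2 \<and> d = 1} \<union> (\<lambda>t. t + 2) ` snd z)"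

lemma plain_push:
  assumes "z \<in> ops"
  shows "plain (push a c d z) t = (if t = 2 then c else if t < 2 then 0 else plain z (t - 2))"
proof -
  have z0: "count (fst z) 0 = 0" using assms by (auto simp: ops_def not_in_iff)
  have "count (image_mset (\<lambda>t. t + 2) U) t = (if t < 2 then 0 else count U (t - 2))" for U :: "nat multiset" and t
    by (induction U) auto
  then show ?thesis using z0 by (auto simp: plain_def push_def)
qed

lemma over_push:
  assumes "z \<in> ops" "a \<le> 1" "d \<le> 1"
  shows "over (push a c d z) t = (if t = 0 then 0 else if t = 1 then a else if t = 2 then d else over z (t - 2))"
proof -
  have z0: "0 \<notin> snd z" using assms by (auto simp: ops_def)
  have "t \<in> (\<lambda>t. t + 2) ` snd z \<longleftrightarrow> 2 \<le> t \<and> t - 2 \<in> snd z" for t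
    by (auto simp: image_iff intro!: bexI[of _ "t - 2"])
  then show ?thesis using z0 assms(2,3)
    by (auto simp: over_def push_def le_Suc_eq)
qed

lemma push_ops: "push a c d z \<in> ops" if "z \<in> ops"
  using that by (auto simp: push_def ops_def)

text \<open>The gap condition at \<open>t = 1\<close> adds \<open>c + d\<close> to the counts of
  overlined 3 and plain 4, which are overlined 1 and plain 2 in \<open>z\<close>; this is the bound
  \<open>k - c - d\<close>. At \<open>t = 0\<close> one condition is \<open>a + c < k\<close> and
  the other is void; the rest are those of \<open>z\<close> shifted. For $c + d \<ge> k$ truncated
  subtraction gives the empty set, as it must.\<close>

lemma push_mem:
  assumes "z \<in> ops" "a \<le> 1" "d \<le> 1" "a + c < k"
  shows "push a c d z \<in> layer0 a c \<longleftrightarrow> z \<in> admissible_ops (k - c - d)"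
proof -
  have z0: "plain z 0 = 0" "over z 0 = 0" using assms(1) by (auto simp: ops_def plain_def over_def not_in_iff)
  note pl = plain_push[OF assms(1), of a c d] and ov = over_push[OF assms(1-3), of c]
  define y where "y = push a c d z"
  have all: "(\<forall>t. P t) \<longleftrightarrow> P 0 \<and> P 1 \<and> (\<forall>t. P (t + 2))" for P :: "nat \<Rightarrow> bool"
    by (metis One_nat_def add_2_eq_Suc' not0_implies_Suc)
  have all1: "(\<forall>t. P t) \<longleftrightarrow> P 0 \<and> (\<forall>t. P (t + 1))" for P :: "nat \<Rightarrow> bool"
    by (metis Suc_eq_plus1 not0_implies_Suc)
  have c2: "(\<forall>t. over y (2*t) + plain y (2*t) + over y (2*t+1) + plain y (2*t+2) < k) \<longleftrightarrow>
     d + c + over z 1 + plain z 2 < k \<and>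
     (\<forall>t. over z (2*(t+1)) + plain z (2*(t+1)) + over z (2*(t+1)+1) + plain z (2*(t+1)+2) < k)"
    unfolding all[of "\<lambda>t. over y (2*t) + plain y (2*t) + over y (2*t+1) + plain y (2*t+2) < k"]
    using assms(4) by (simp add: y_def pl ov add.commute numeral_eq_Suc)
  have c3: "(\<forall>t. plain y (2*t+1) \<ge> 1 \<longrightarrow> plain y (2*t+2) + 1 < k) \<longleftrightarrow>
     (\<forall>t. plain z (2*t+1) \<ge> 1 \<longrightarrow> plain z (2*t+2) + 1 < k)"
    unfolding all1[of "\<lambda>t. plain y (2*t+1) \<ge> 1 \<longrightarrow> plain y (2*t+2) + 1 < k"]
    by (simp add: y_def pl)
  have z2: "(\<forall>t. over z (2*t) + plain z (2*t) + over z (2*t+1) + plain z (2*t+2) < k) \<longleftrightarrow>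
     over z 1 + plain z 2 < k \<and>
     (\<forall>t. over z (2*(t+1)) + plain z (2*(t+1)) + over z (2*(t+1)+1) + plain z (2*(t+1)+2) < k)"
    unfolding all1[of "\<lambda>t. over z (2*t) + plain z (2*t) + over z (2*t+1) + plain z (2*t+2) < k"]
    by (simp add: z0 numeral_2_eq_2)
  have y: "over y 1 = a" "plain y 2 = c" "plain y 1 = 0" "y \<in> ops"
    using push_ops[OF assms(1)] by (simp_all add: y_def pl ov)
  have "y \<in> layer0 a c \<longleftrightarrow> d + c + over z 1 + plain z 2 < k \<and>
     (\<forall>t. over z (2*(t+1)) + plain z (2*(t+1)) + over z (2*(t+1)+1) + plain z (2*(t+1)+2) < k) \<and>
     (\<forall>t. plain z (2*t+1) \<ge> 1 \<longrightarrow> plain z (2*t+2) + 1 < k)"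
    unfolding layer0_def layer_def gap_ops_def using y c2 c3 by simp
  also have "\<dots> \<longleftrightarrow> z \<in> admissible_ops (k - c - d)"
    unfolding admissible_ops_def gap_ops_def using z2 assms(1) by auto
  finally show ?thesis unfolding y_def .
qed

lemma push_surj:
  assumes "y \<in> ops" "over y 1 = a" "plain y 1 = 0" "plain y 2 = c" "over y 2 = d"
  shows "\<exists>z\<in>ops. y = push a c d z"
proof -
  obtain U V where y: "y = (U, V)" by (cases y)
  define U' where "U' = image_mset (\<lambda>t. t - 2) (filter_mset (\<lambda>t. 2 < t) U)"
  define V' where "V' = (\<lambda>t. t - 2) ` {t \<in> V. 2 < t}"
  have z: "(U', V') \<in> ops" using assms(1) by (auto simp: ops_def y U'_def V'_def)
  have "image_mset (\<lambda>t. t + 2) U' = filter_mset (\<lambda>t. 2 < t) U"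
    unfolding U'_def multiset.map_comp
    by (subst multiset.map_cong0[where g = id]) auto
  moreover have "filter_mset (\<lambda>t. \<not> 2 < t) U = replicate_mset c 2"
  proof (rule multiset_eqI)
    fix t
    have "count U 0 = 0" "count U 1 = 0" "count U 2 = c"
      using assms by (auto simp: ops_def y plain_def not_in_iff)
    then show "count (filter_mset (\<lambda>t. \<not> 2 < t) U) t = count (replicate_mset c 2) t"
      by (cases "t = 0"; cases "t = 1"; cases "t = 2") auto
  qed
  ultimately have "U = replicate_mset c 2 + image_mset (\<lambda>t. t + 2) U'"
    by (metis add.commute multiset_partition)
  moreover have "V = {t. t = 1 \<and> a = 1 \<or> t = 2 \<and> d = 1} \<union> (\<lambda>t. t + 2) ` V'"
  proof -
    have "(\<lambda>t. t + 2) ` V' = {t \<in> V. 2 < t}"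
    proof -
      have "(\<lambda>t. t + 2) ` V' = (\<lambda>t. t) ` {t \<in> V. 2 < t}"
        unfolding V'_def image_image by (rule image_cong) auto
      then show ?thesis by simp
    qed
    moreover have "0 \<notin> V" using assms(1) by (simp add: ops_def y)
    moreover have "1 \<in> V \<longleftrightarrow> a = 1" "2 \<in> V \<longleftrightarrow> d = 1"
      using assms(2,5) by (auto simp: over_def y split: if_splits)
    ultimately have "t \<in> V \<longleftrightarrow> t = 1 \<and> a = 1 \<or> t = 2 \<and> d = 1 \<or> t \<in> (\<lambda>t. t + 2) ` V'" for t
    proof -
      assume a: "(\<lambda>t. t + 2) ` V' = {t \<in> V. 2 < t}" "0 \<notin> V" "1 \<in> V \<longleftrightarrow> a = 1" "2 \<in> V \<longleftrightarrow> d = 1"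
      consider "t = 0" | "t = 1" | "t = 2" | "2 < t" by linarith
      then show ?thesis unfolding a(1) by cases (use a in simp_all)
    qed
    then show ?thesis by blast
  qed
  ultimately show ?thesis using z by (intro bexI[of _ "(U', V')"]) (auto simp: push_def y)
qed

lemma inj_push:
  assumes "a \<le> 1" "d \<le> 1"
  shows "inj_on (push a c d) ops"
proof (rule inj_onI)
  fix z y assume z: "z \<in> ops" and y: "y \<in> ops" and eq: "push a c d z = push a c d y"
  have p: "plain z t = plain y t" for t
  proof (cases "t = 0")
    case True
    then show ?thesis using y z by (auto simp: ops_def plain_def not_in_iff)
  next
    case False
    then show ?thesis
      using arg_cong[OF eq, of "\<lambda>z. plain z (t + 2)"] by (simp add: plain_push z y)
  qed
  have o: "over z t = over y t" for t
  proof (cases "t = 0")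
    case True
    then show ?thesis using y z by (auto simp: ops_def over_def)
  next
    case False
    have "over (push a c d z) (t + 2) = over (push a c d y) (t + 2)" using eq by simp
    then show ?thesis
      unfolding over_push[OF z assms] over_push[OF y assms] using False by simp
  qed
  have "fst z = fst y" using p by (intro multiset_eqI) (simp add: plain_def)
  moreover have "t \<in> snd z \<longleftrightarrow> t \<in> snd y" for t
    using o[of t] by (auto simp: over_def split: if_splits)
  ultimately show "z = y" by (auto simp: prod_eq_iff)
qed

lemma parts_push:
  assumes "z \<in> ops" "a \<le> 1" "d \<le> 1"
  shows "parts (push a c d z) = parts z + (a + c + d)"
    and "weight (push a c d z) = weight z + 2 * parts z + (a + 2 * c + 2 * d)"
proof -
  define A where "A = {t::nat. t = 1 \<and> a = 1 \<or> t = 2 \<and> d = 1}"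
  have fin: "finite (snd z)" "0 \<notin> snd z" using assms(1) by (auto simp: ops_def)
  have A: "finite A" "card A = a + d" "\<Sum>A = a + 2 * d"
  proof -
    have "A = (if a = 1 then {1} else {}) \<union> (if d = 1 then {2} else {})" by (auto simp: A_def)
    then show "finite A" "card A = a + d" "\<Sum>A = a + 2 * d" using assms(2,3) by (auto simp: le_Suc_eq)
  qed
  have disj: "A \<inter> (\<lambda>t. t + 2) ` snd z = {}"
    using fin(2) by (auto simp: A_def)
  have inj: "inj_on (\<lambda>t. t + 2 :: nat) (snd z)" by (rule inj_onI) simp
  have "card (A \<union> (\<lambda>t. t + 2) ` snd z) = a + d + card (snd z)"
    using card_Un_disjoint[OF A(1) _ disj] fin A by (simp add: card_image[OF inj] del: add_2_eq_Suc')
  then show "parts (push a c d z) = parts z + (a + c + d)"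
    unfolding parts_def push_def A_def[symmetric] by (simp del: add_2_eq_Suc')
  have "\<Sum>(A \<union> (\<lambda>t. t + 2) ` snd z) = a + 2 * d + (\<Sum>t\<in>snd z. t + 2)"
    using sum.union_disjoint[OF A(1) _ disj, of "\<lambda>t. t"] fin A
    by (simp add: sum.reindex[OF inj] del: add_2_eq_Suc')
  also have "(\<Sum>t\<in>snd z. t + 2) = \<Sum>(snd z) + 2 * card (snd z)"
    by (simp add: sum.distrib del: add_2_eq_Suc')
  finally have V: "\<Sum>(A \<union> (\<lambda>t. t + 2) ` snd z) = a + 2 * d + (\<Sum>(snd z) + 2 * card (snd z))" .
  have U: "sum_mset (image_mset (\<lambda>t. t + 2) U) = sum_mset U + 2 * size U" for U :: "nat multiset"
    by (induction U) auto
  show "weight (push a c d z) = weight z + 2 * parts z + (a + 2 * c + 2 * d)"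
    using V U[of "fst z"] unfolding weight_def parts_def push_def A_def[symmetric]
    by (simp add: sum_mset_replicate_mset algebra_simps del: add_2_eq_Suc')
qed

text \<open>Split by the overlined part 2. This part contributes $xq^2$, the dilation of $x$, so its
  summand can be written inside the dilation.\<close>

lemma gf_layer0:
  assumes "a \<le> 1" "a + c < k"
  shows "gf (layer0 a c) = fps_X ^ (a + c) * fps_const (fls_X ^ (a + 2 * c)) *
    dilate (fls_X\<^sup>2) (gf (admissible_ops (k - c)) + fps_X * gf (admissible_ops (k - c - 1)))"
proof -
  define B where "B d = {z \<in> layer0 a c. over z 2 = d}" for d
  have gB: "gf (B d) = fps_X ^ (a + c + d) * fps_const (fls_X ^ (a + 2 * c + 2 * d)) * dilate (fls_X ^ 2) (gf (admissible_ops (k - c - d)))"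
    if d: "d \<le> 1" for d
  proof (rule gf_bij)
    note mem = push_mem[OF _ assms(1) d assms(2)]
    show "bij_betw (push a c d) (admissible_ops (k - c - d)) (B d)"
      unfolding bij_betw_def
    proof
      show "inj_on (push a c d) (admissible_ops (k - c - d))"
        by (rule inj_on_subset[OF inj_push[OF assms(1) d] admissible_ops_subset])
      show "push a c d ` admissible_ops (k - c - d) = B d"
      proof (intro equalityI subsetI)
        fix y assume "y \<in> push a c d ` admissible_ops (k - c - d)"
        then obtain z where z: "z \<in> admissible_ops (k - c - d)" "y = push a c d z" by blast
        then have zo: "z \<in> ops" using admissible_ops_subset by blast
        show "y \<in> B d" using mem[OF zo] z over_push[OF zo assms(1) d] by (simp add: B_def)
      next
        fix y assume y: "y \<in> B d"
        then have "y \<in> ops" using layer0_subset by (auto simp: B_def)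
        moreover have "over y 1 = a" "plain y 1 = 0" "plain y 2 = c" "over y 2 = d"
          using y by (auto simp: B_def layer0_def layer_def)
        ultimately obtain z where z: "z \<in> ops" "y = push a c d z" using push_surj by blast
        then show "y \<in> push a c d ` admissible_ops (k - c - d)" using mem[OF z(1)] y by (auto simp: B_def)
      qed
    qed
    show "parts (push a c d z) = parts z + (a + c + d)" if "z \<in> admissible_ops (k - c - d)" for z
      using that admissible_ops_subset parts_push(1) assms(1) d by blast
    show "weight (push a c d z) = weight z + 2 * parts z + (a + 2 * c + 2 * d)" if "z \<in> admissible_ops (k - c - d)" for z
      using that admissible_ops_subset parts_push(2) assms(1) d by blast
  qed
  have "layer0 a c = B 0 \<union> B 1" by (auto simp: B_def over_def)
  moreover have "gf (B 0 \<union> B 1) = gf (B 0) + gf (B 1)"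
    by (rule gf_Un) (use layer0_subset in \<open>auto simp: B_def\<close>)
  ultimately have "gf (layer0 a c) = gf (B 0) + gf (B 1)" by simp
  also have "gf (B 1) = fps_X ^ (a + c) * fps_const (fls_X ^ (a + 2 * c)) * dilate (fls_X\<^sup>2) (fps_X * gf (admissible_ops (k - c - 1)))"
    unfolding gB[OF order_refl]
    by (simp add: dilate_mult dilate_X power_add power2_eq_square mult_ac flip: fps_const_mult)
  also have "gf (B 0) = fps_X ^ (a + c) * fps_const (fls_X ^ (a + 2 * c)) * dilate (fls_X\<^sup>2) (gf (admissible_ops (k - c)))"
    using gB[of 0] by simp
  finally show ?thesis by (simp add: dilate_add distrib_left)
qed

end

text \<open>The bijection takes the overlined copy of each size out of the multiset and leaves the
  non-overlined parts.\<close>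

lemma O_gf_conv:
  assumes "k \<ge> 1"
  shows "O_gf k i = gf (admissible_ops k i)"
proof -
  have "O_num k i m n = card (slice (admissible_ops k i) m n)" for m n
  proof -
    define f where "f L = (fst L - mset_set (snd L), snd L)" for L :: overpartition
    have "bij_betw f {L \<in> overpartitions n. num_parts L = m \<and> admissible k i L} (slice (admissible_ops k i) m n)"
    proof (rule bij_betw_imageI)
      have fin: "finite S" "mset_set S \<subseteq># P" if "(P, S) \<in> overpartitions n" for P S
      proof -
        have S: "S \<subseteq> set_mset P" using that by (simp add: overpartitions_def)
        then show "finite S" by (rule finite_subset) simp
        then show "mset_set S \<subseteq># P" using S by (auto simp: subseteq_mset_def count_mset_set' Suc_le_eq)
      qed
      show "inj_on f {L \<in> overpartitions n. num_parts L = m \<and> admissible k i L}"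
      proof (rule inj_onI, clarsimp simp: f_def)
        fix P Q S assume "(P, S) \<in> overpartitions n" "(Q, S) \<in> overpartitions n" "P - mset_set S = Q - mset_set S"
        then show "P = Q" using fin by (metis subset_mset.diff_add)
      qed
      have adm_iff: "admissible k i L \<and> L \<in> overpartitions n \<and> num_parts L = m \<longleftrightarrow> f L \<in> slice (admissible_ops k i) m n"
        if "L = (U + mset_set V, V)" "finite V" for L U V
      proof -
        have fL: "f L = (U, V)" by (simp add: f_def that)
        have o: "f_over L = over (U, V)" by (rule ext) (simp add: f_over_def over_def that)
        have p: "f_plain L = plain (U, V)"
          by (rule ext) (auto simp: f_plain_def f_over_def plain_def that count_mset_set')
        have "L \<in> overpartitions n \<longleftrightarrow> (U, V) \<in> ops \<and> weight (U, V) = n"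
          using that(2) by (auto simp: that(1) overpartitions_def ops_def weight_def sum_unfold_sum_mset Suc_le_eq
            intro!: gr0I)
        moreover have "num_parts L = parts (U, V)"
          by (simp add: that(1) num_parts_def parts_def)
        moreover have "admissible k i L \<longleftrightarrow> (U, V) \<in> admissible_ops k i" if "(U, V) \<in> ops"
        proof -
          have int_iffs: "int a \<le> int j - 1 \<longleftrightarrow> a < j" "int a \<le> int j - 2 \<longleftrightarrow> a + 1 < j" for a j
            by linarith+
          show ?thesis using that unfolding admissible_def o p int_iffs admissible_ops_def gap_ops_def by auto
        qed
        ultimately show ?thesis unfolding fL slice_def by (auto simp: admissible_ops_def gap_ops_def)
      qed
      show "f ` {L \<in> overpartitions n. num_parts L = m \<and> admissible k i L} = slice (admissible_ops k i) m n"
      proof (intro equalityI subsetI)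
        fix z assume "z \<in> f ` {L \<in> overpartitions n. num_parts L = m \<and> admissible k i L}"
        then obtain P S where L: "(P, S) \<in> overpartitions n" "num_parts (P, S) = m" "admissible k i (P, S)" "z = f (P, S)"
          by auto
        have "(P, S) = ((P - mset_set S) + mset_set S, S)" using fin[OF L(1)] by simp
        from adm_iff[OF this fin(1)[OF L(1)]] L show "z \<in> slice (admissible_ops k i) m n" by blast
      next
        fix z assume z: "z \<in> slice (admissible_ops k i) m n"
        obtain U V where zUV: "z = (U, V)" by (cases z)
        have "finite V" using z by (auto simp: zUV slice_def admissible_ops_def gap_ops_def ops_def)
        from adm_iff[OF refl this, of U] z
        show "z \<in> f ` {L \<in> overpartitions n. num_parts L = m \<and> admissible k i L}"
          by (intro image_eqI[of _ _ "(U + mset_set V, V)"]) (auto simp: zUV f_def)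
      qed
    qed
    then show ?thesis unfolding O_num_def by (rule bij_betw_same_card)
  qed
  then show ?thesis by (simp add: O_gf_def gf_def)
qed

lemma gf_admissible_nth_0:
  assumes "i \<ge> 1" "k \<ge> 1"
  shows "gf (admissible_ops k i) $ 0 = 1"
proof -
  have "slice (admissible_ops k i) 0 n = (if n = 0 then {({#}, {})} else {})" for n
  proof -
    have "({#}, {}) \<in> admissible_ops k i" using assms by (simp add: admissible_ops_def gap_ops_def ops_def over_def plain_def)
    moreover have "z = ({#}, {})" if "z \<in> admissible_ops k i" "parts z = 0" for z
      using that by (cases z) (auto simp: admissible_ops_def gap_ops_def ops_def parts_def)
    moreover have "parts ({#}, {}) = 0" "weight ({#}, {}) = 0" by (simp_all add: parts_def weight_def)
    ultimately show ?thesis unfolding slice_def by (cases "n = 0") (force, force)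
  qed
  then have "Abs_fps (\<lambda>n. of_nat (card (slice (admissible_ops k i) 0 n)) :: rat) = 1"
    by (intro fps_ext) simp
  then show ?thesis by (simp add: gf_def)
qed

subsection \<open>q-Pochhammer symbols of Laurent series\<close>

text \<open>The distance is $2^{-v}$, where $v$ is the subdegree of the difference. Equality is
  listed separately because the zero series has subdegree \<open>0\<close>.\<close>

lemma fls_tendsto_iff:
  fixes X :: "'b \<Rightarrow> 'a::group_add fls"
  shows "(X \<longlongrightarrow> L) F \<longleftrightarrow>
    (\<forall>M. eventually (\<lambda>n. X n = L \<or> int M \<le> fls_subdegree (X n - L)) F)" (is "_ \<longleftrightarrow> ?rhs")
proof
  assume lim: "(X \<longlongrightarrow> L) F"
  show ?rhs
  proof
    fix M
    have "eventually (\<lambda>n. dist (X n) L < inverse (2 ^ M)) F"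
      by (rule tendstoD[OF lim]) simp
    then show "eventually (\<lambda>n. X n = L \<or> int M \<le> fls_subdegree (X n - L)) F"
    proof eventually_elim
      case (elim n)
      show ?case
      proof (rule ccontr)
        assume H: "\<not> ?thesis"
        have "inverse (2 ^ M) \<le> (1 :: real)" by (simp add: inverse_le_1_iff)
        moreover have "(1::real) \<le> 2 ^ nat (- fls_subdegree (X n - L))" by simp
        moreover have "inverse ((2::real) ^ M) \<le> inverse (2 ^ nat (fls_subdegree (X n - L)))"
          using H by (intro le_imp_inverse_le power_increasing) auto
        ultimately have "inverse (2 ^ M) \<le> dist (X n) L"
          using H unfolding dist_fls_def by (auto intro: order.trans)
        then show False using elim by simp
      qed
    qed
  qed
next
  assume R: ?rhs
  show "(X \<longlongrightarrow> L) F"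
  proof (rule tendstoI)
    fix e :: real assume "e > 0"
    then obtain M where M: "inverse (2 ^ M) < e"
      using reals_power_lt_ex[of e 2] by (metis inverse_eq_divide one_less_numeral_iff power_one_over semiring_norm(76))
    from R have "eventually (\<lambda>n. X n = L \<or> int M \<le> fls_subdegree (X n - L)) F" by blast
    then show "eventually (\<lambda>n. dist (X n) L < e) F"
    proof eventually_elim
      case (elim n)
      have "dist (X n) L \<le> inverse (2 ^ M)"
      proof (cases "X n = L")
        case False
        then have "int M \<le> fls_subdegree (X n - L)" using elim by simp
        then have "inverse (2 ^ nat (fls_subdegree (X n - L))) \<le> inverse ((2::real) ^ M)"
          by (intro le_imp_inverse_le power_increasing) auto
        moreover have "dist (X n) L = inverse (2 ^ nat (fls_subdegree (X n - L)))"
          unfolding dist_fls_def using False \<open>int M \<le> _\<close> by auto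
        ultimately show ?thesis by simp
      qed simp
      then show ?case using M by simp
    qed
  qed
qed

lemma fls_tendsto_cmult:
  fixes X :: "'b \<Rightarrow> 'a::field fls"
  assumes "(X \<longlongrightarrow> L) F"
  shows "((\<lambda>n. c * X n) \<longlongrightarrow> c * L) F"
proof (cases "c = 0")
  case False
  show ?thesis
    unfolding fls_tendsto_iff
  proof
    fix M
    from assms[unfolded fls_tendsto_iff, rule_format, of "nat (int M - fls_subdegree c)"]
    show "eventually (\<lambda>n. c * X n = c * L \<or> int M \<le> fls_subdegree (c * X n - c * L)) F"
    proof eventually_elim
      case (elim n)
      have "fls_subdegree (c * X n - c * L) = fls_subdegree c + fls_subdegree (X n - L)" if "X n \<noteq> L"
        using that False by (simp flip: right_diff_distrib)
      then show ?case using elim by (cases "X n = L") (simp, linarith)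
    qed
  qed
qed simp

text \<open>The coefficient of $q^m$ is constant from the partial product with index
  \<open>m\<close> on, so the limit is read off on the diagonal. It has constant term $1$, hence is
  not zero.\<close>

lemma qprod_converges_pos:
  fixes b :: "rat fps"
  assumes "b $ 0 = 0"
  shows "\<exists>L. L \<noteq> 0 \<and> (\<lambda>n. \<Prod>j\<le>n. 1 - fps_to_fls b * (fls_X\<^sup>2) ^ j) \<longlonglongrightarrow> L"
proof -
  define P where "P n = (\<Prod>j\<le>n. 1 - b * (fps_X\<^sup>2) ^ j)" for n
  define R where "R = Abs_fps (\<lambda>m. P m $ m)"
  have step: "P (Suc n) $ m = P n $ m" if "m \<le> n" for m n
  proof -
    have "P (Suc n) = P n - fps_X ^ (2 * Suc n) * (P n * b)"
    proof -
      have "P (Suc n) = P n * (1 - b * fps_X ^ (2 * Suc n))"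
        by (simp only: P_def prod.atMost_Suc power_mult)
      then show ?thesis by (simp add: right_diff_distrib mult_ac del: mult_Suc_right power_Suc)
    qed
    moreover have "m < 2 * Suc n" using that by simp
    ultimately show ?thesis by (simp add: fps_X_power_mult_nth del: power_Suc mult_Suc_right)
  qed
  have stable: "P (m + l) $ m = P m $ m" for m l
    by (induction l) (simp_all add: step)
  have fls: "(\<Prod>j\<le>n. 1 - fps_to_fls b * (fls_X\<^sup>2) ^ j) = fps_to_fls (P n)" for n
    unfolding P_def
    by (induction n) (simp_all add: fls_times_fps_to_fls fps_to_fls_power)
  have "(\<lambda>n. fps_to_fls (P n)) \<longlonglongrightarrow> fps_to_fls R"
    unfolding fls_tendsto_iff
  proof
    fix M
    show "eventually (\<lambda>n. fps_to_fls (P n) = fps_to_fls R \<or> int M \<le> fls_subdegree (fps_to_fls (P n) - fps_to_fls R)) sequentially"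
    proof (rule eventually_sequentiallyI)
      fix n assume n: "M \<le> n"
      show "fps_to_fls (P n) = fps_to_fls R \<or> int M \<le> fls_subdegree (fps_to_fls (P n) - fps_to_fls R)"
      proof (cases "P n = R")
        case False
        have "int M \<le> fls_subdegree (fps_to_fls (P n - R))"
        proof (rule fls_subdegree_geI)
          show "fps_to_fls (P n - R) \<noteq> 0" using False by simp
          fix i assume i: "i < int M"
          show "fls_nth (fps_to_fls (P n - R)) i = 0"
          proof (cases "i < 0")
            case False
            then have "P n $ nat i = P (nat i) $ nat i"
              using stable[of "nat i" "n - nat i"] n i by simp
            then show ?thesis using False by (simp add: R_def)
          qed simp
        qed
        then show ?thesis by simp
      qed simp
    qed
  qed
  moreover have "R $ 0 = 1" using assms by (simp add: R_def P_def)
  then have "fps_to_fls R \<noteq> 0" by auto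
  ultimately show ?thesis unfolding fls by blast
qed

text \<open>Negative powers of $q$ in \<open>a\<close> are removed by splitting off leading factors:
  each shift $a q^2$ raises the subdegree by 2 until the previous lemma applies. The limit must be
  nonzero for \<open>has_prod\<close> to accept it as a product.\<close>

lemma qprod_converges:
  fixes a :: "rat fls"
  assumes nz: "\<And>j. 1 - a * (fls_X\<^sup>2) ^ j \<noteq> 0"
  shows "\<exists>L. L \<noteq> 0 \<and> (\<lambda>n. \<Prod>j\<le>n. 1 - a * (fls_X\<^sup>2) ^ j) \<longlonglongrightarrow> L"
proof (cases "a = 0")
  case True
  then show ?thesis using qprod_converges_pos[of 0] by simp
next
  case False
  have "\<exists>L. L \<noteq> 0 \<and> (\<lambda>n. \<Prod>j\<le>n. 1 - a * (fls_X\<^sup>2) ^ j) \<longlonglongrightarrow> L"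
    if "a \<noteq> 0" "fls_subdegree a + 2 * int M > 0" "\<And>j. 1 - a * (fls_X\<^sup>2) ^ j \<noteq> 0" for M and a :: "rat fls"
    using that
  proof (induction M arbitrary: a)
    case 0
    then have "a = fps_to_fls (fls_regpart a)" by (simp add: fls_regpart_to_fls_trivial)
    moreover have "fls_regpart a $ 0 = 0" using 0 by simp
    ultimately show ?case using qprod_converges_pos[of "fls_regpart a"] by metis
  next
    case (Suc M)
    have sh: "1 - (a * fls_X\<^sup>2) * (fls_X\<^sup>2) ^ j = 1 - a * (fls_X\<^sup>2) ^ Suc j" for j
      by (simp add: mult_ac)
    have "\<exists>L. L \<noteq> 0 \<and> (\<lambda>n. \<Prod>j\<le>n. 1 - (a * fls_X\<^sup>2) * (fls_X\<^sup>2) ^ j) \<longlonglongrightarrow> L"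
    proof (rule Suc.IH)
      show "a * fls_X\<^sup>2 \<noteq> 0" using Suc.prems by simp
      show "0 < fls_subdegree (a * fls_X\<^sup>2) + 2 * int M"
        using Suc.prems by (simp add: fls_subdegree_pow)
      show "1 - a * fls_X\<^sup>2 * (fls_X\<^sup>2) ^ j \<noteq> 0" for j using Suc.prems(3)[of "Suc j"] unfolding sh .
    qed
    then obtain L where L: "L \<noteq> 0" "(\<lambda>n. \<Prod>j\<le>n. 1 - (a * fls_X\<^sup>2) * (fls_X\<^sup>2) ^ j) \<longlonglongrightarrow> L" by blast
    have "(\<lambda>n. (1 - a) * (\<Prod>j\<le>n. 1 - (a * fls_X\<^sup>2) * (fls_X\<^sup>2) ^ j)) \<longlonglongrightarrow> (1 - a) * L"
      by (rule fls_tendsto_cmult[OF L(2)])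
    also have "(\<lambda>n. (1 - a) * (\<Prod>j\<le>n. 1 - (a * fls_X\<^sup>2) * (fls_X\<^sup>2) ^ j)) = (\<lambda>n. \<Prod>j\<le>Suc n. 1 - a * (fls_X\<^sup>2) ^ j)"
      unfolding sh by (rule ext, subst prod.atMost_Suc_shift) simp
    finally have "(\<lambda>n. \<Prod>j\<le>n. 1 - a * (fls_X\<^sup>2) ^ j) \<longlonglongrightarrow> (1 - a) * L"
      by (rule LIMSEQ_imp_Suc)
    moreover have "(1 - a) * L \<noteq> 0" using L(1) Suc.prems(3)[of 0] by simp
    ultimately show ?case by blast
  qed
  moreover have "0 < fls_subdegree a + 2 * int (nat (1 - fls_subdegree a))" by linarith
  ultimately show ?thesis using False nz by blast
qed

lemma qpoch_inf_tendsto: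
  fixes a :: "rat fls"
  assumes nz: "\<And>j. 1 - a * (fls_X\<^sup>2) ^ j \<noteq> 0"
  shows "(\<lambda>n. \<Prod>j\<le>n. 1 - a * (fls_X\<^sup>2) ^ j) \<longlonglongrightarrow> qpoch_inf a (fls_X\<^sup>2)"
    and "qpoch_inf a (fls_X\<^sup>2) \<noteq> 0"
proof -
  obtain L where L: "L \<noteq> 0" "(\<lambda>n. \<Prod>j\<le>n. 1 - a * (fls_X\<^sup>2) ^ j) \<longlonglongrightarrow> L"
    using qprod_converges[OF nz] by blast
  then have "(\<lambda>j. 1 - a * (fls_X\<^sup>2) ^ j) has_prod L"
    by (simp add: has_prod_def raw_has_prod_def)
  then have "qpoch_inf a (fls_X\<^sup>2) = L"
    unfolding qpoch_inf_def by (rule has_prod_unique[symmetric])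
  then show "(\<lambda>n. \<Prod>j\<le>n. 1 - a * (fls_X\<^sup>2) ^ j) \<longlonglongrightarrow> qpoch_inf a (fls_X\<^sup>2)" "qpoch_inf a (fls_X\<^sup>2) \<noteq> 0"
    using L by simp_all
qed

lemma qpoch_inf_shift:
  fixes a :: "rat fls"
  assumes nz: "\<And>j. 1 - a * (fls_X\<^sup>2) ^ j \<noteq> 0"
  shows "qpoch_inf a (fls_X\<^sup>2) = (1 - a) * qpoch_inf (a * fls_X\<^sup>2) (fls_X\<^sup>2)"
proof -
  have sh: "1 - (a * fls_X\<^sup>2) * (fls_X\<^sup>2) ^ j = 1 - a * (fls_X\<^sup>2) ^ Suc j" for j
    by (simp add: mult_ac)
  have "1 - (a * fls_X\<^sup>2) * (fls_X\<^sup>2) ^ j \<noteq> 0" for j using nz[of "Suc j"] unfolding sh .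
  from fls_tendsto_cmult[OF qpoch_inf_tendsto(1)[OF this], of "1 - a"]
  have "(\<lambda>n. (1 - a) * (\<Prod>j\<le>n. 1 - (a * fls_X\<^sup>2) * (fls_X\<^sup>2) ^ j)) \<longlonglongrightarrow> (1 - a) * qpoch_inf (a * fls_X\<^sup>2) (fls_X\<^sup>2)" .
  also have "(\<lambda>n. (1 - a) * (\<Prod>j\<le>n. 1 - (a * fls_X\<^sup>2) * (fls_X\<^sup>2) ^ j)) = (\<lambda>n. \<Prod>j\<le>Suc n. 1 - a * (fls_X\<^sup>2) ^ j)"
    unfolding sh by (rule ext, subst prod.atMost_Suc_shift) simp
  finally have "(\<lambda>n. \<Prod>j\<le>n. 1 - a * (fls_X\<^sup>2) ^ j) \<longlonglongrightarrow> (1 - a) * qpoch_inf (a * fls_X\<^sup>2) (fls_X\<^sup>2)"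
    by (rule LIMSEQ_imp_Suc)
  then show ?thesis using qpoch_inf_tendsto(1)[OF nz] LIMSEQ_unique by blast
qed

lemma qpoch_nat:
  fixes a :: "rat fls"
  assumes nz: "\<And>j. 1 - a * (fls_X\<^sup>2) ^ j \<noteq> 0"
  shows "qpoch a (fls_X\<^sup>2) (int n) = (\<Prod>j<n. 1 - a * (fls_X\<^sup>2) ^ j)"
proof -
  have sh: "1 - (a * (fls_X\<^sup>2) ^ n) * (fls_X\<^sup>2) ^ j = 1 - a * (fls_X\<^sup>2) ^ (n + j)" for j n
    by (simp add: power_add mult_ac)
  have nz': "1 - (a * (fls_X\<^sup>2) ^ n) * (fls_X\<^sup>2) ^ j \<noteq> 0" for j n using nz[of "n + j"] unfolding sh .
  have split: "qpoch_inf a (fls_X\<^sup>2) = (\<Prod>j<n. 1 - a * (fls_X\<^sup>2) ^ j) * qpoch_inf (a * (fls_X\<^sup>2) ^ n) (fls_X\<^sup>2)" for n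
  proof (induction n)
    case (Suc n)
    then show ?case using qpoch_inf_shift[OF nz', of n] by (simp add: mult_ac)
  qed simp
  show ?thesis
    unfolding qpoch_def power_int_of_nat
    using split[of n] qpoch_inf_tendsto(2)[OF nz', of n] by (metis nonzero_mult_div_cancel_right)
qed

text \<open>Needed at $N_1 = 0$: for \<open>a = - 1\<close> this is $(-q^2;q^2)_{-1} = 1/2$.\<close>

lemma qpoch_minus_1:
  fixes a :: "rat fls"
  assumes nz: "\<And>j. 1 - a * (fls_X\<^sup>2) ^ j \<noteq> 0"
  shows "qpoch (a * fls_X\<^sup>2) (fls_X\<^sup>2) (- 1) = 1 / (1 - a)"
proof -
  have sh: "1 - (a * fls_X\<^sup>2) * (fls_X\<^sup>2) ^ j = 1 - a * (fls_X\<^sup>2) ^ Suc j" for j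
    by (simp add: mult_ac)
  have "1 - (a * fls_X\<^sup>2) * (fls_X\<^sup>2) ^ j \<noteq> 0" for j using nz[of "Suc j"] unfolding sh .
  then have "qpoch_inf (a * fls_X\<^sup>2) (fls_X\<^sup>2) \<noteq> 0" by (rule qpoch_inf_tendsto(2))
  moreover have cancel: "a * fls_X\<^sup>2 * (fls_X\<^sup>2) powi (- 1) = a"
  proof -
    have "(fls_X :: rat fls)\<^sup>2 \<noteq> 0" by simp
    then show ?thesis by (metis mult.assoc mult.right_neutral power_int_minus power_int_1_right right_inverse)
  qed
  ultimately show ?thesis
    unfolding qpoch_def cancel using qpoch_inf_shift[OF nz] by simp
qed

lemma one_plus_fls_X_powi_nz: "1 + (fls_X :: rat fls) powi e \<noteq> 0"
proof
  assume "1 + (fls_X :: rat fls) powi e = 0"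
  then have "fls_nth (1 + (fls_X :: rat fls) powi e) 0 = 0" by simp
  then show False by (simp add: fls_X_power_int split: if_splits)
qed

context qbase
begin

subsection \<open>The multisum over tuples\<close>

text \<open>The index set of \<open>beta k i l n\<close>: end pieces from $N_{k-l} = n$ to
  $N_{k-1}$, extended by zero, which includes $N_k = 0$. With this extension, prepending an index is
  a function update.\<close>

definition tails :: "nat \<Rightarrow> nat \<Rightarrow> nat \<Rightarrow> (nat \<Rightarrow> nat) set" where
  "tails k l n = {N. (\<forall>j. j \<notin> {k-l..<k} \<longrightarrow> N j = 0) \<and> (\<forall>j\<in>{k-l..<k}. N (Suc j) \<le> N j) \<and> N (k - l) = n}"

definition tail_term :: "nat \<Rightarrow> nat \<Rightarrow> nat \<Rightarrow> (nat \<Rightarrow> nat) \<Rightarrow> 'a fps" where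
  "tail_term k i l N = (\<Prod>j\<in>{k-l<..k}. step_weight i j (N j)) * (\<Prod>j\<in>{k-l..<k}. d (N j - N (Suc j)))"

lemma tails_0: "tails k 0 n = (if n = 0 then {\<lambda>_. 0} else {})"
  by (auto simp: tails_def)

lemma tails_Suc:
  assumes "l < k"
  shows "bij_betw (\<lambda>(m, N). N(k - Suc l := n)) (SIGMA m:{..n}. tails k l m) (tails k (Suc l) n)"
proof -
  define a where "a = k - Suc l"
  have a: "k - l = Suc a" "k - Suc l = a" "a < k" using assms by (auto simp: a_def)
  have int: "{a..<k} = insert a {Suc a..<k}" using a by auto
  show ?thesis unfolding a(2)
  proof (rule bij_betw_byWitness[where f' = "\<lambda>N. (N (Suc a), N(a := 0))"])
    show "\<forall>x\<in>SIGMA m:{..n}. tails k l m. (\<lambda>N. (N (Suc a), N(a := 0))) ((\<lambda>(m, N). N(a := n)) x) = x"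
      by (auto simp: tails_def a fun_eq_iff)
    show "\<forall>N\<in>tails k (Suc l) n. (\<lambda>(m, N). N(a := n)) (N (Suc a), N(a := 0)) = N"
      by (auto simp: tails_def a fun_eq_iff)
    show "(\<lambda>(m, N). N(a := n)) ` (SIGMA m:{..n}. tails k l m) \<subseteq> tails k (Suc l) n"
      by (auto simp: tails_def a int)
    show "(\<lambda>N. (N (Suc a), N(a := 0))) ` tails k (Suc l) n \<subseteq> (SIGMA m:{..n}. tails k l m)"
      by (auto simp: tails_def a int)
  qed
qed

lemma finite_tails: "l \<le> k \<Longrightarrow> finite (tails k l n)"
proof (induction l arbitrary: n)
  case 0
  then show ?case by (simp add: tails_0)
next
  case (Suc l)
  then have "finite (SIGMA m:{..n}. tails k l m)" by auto
  then show ?case using bij_betw_finite[OF tails_Suc[of l k n]] Suc.prems by simp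
qed

lemma beta_tails: "l \<le> k \<Longrightarrow> beta k i l n = (\<Sum>N\<in>tails k l n. tail_term k i l N)"
proof (induction l arbitrary: n)
  case 0
  then show ?case by (simp add: tails_0 tail_term_def)
next
  case (Suc l)
  define a where "a = k - Suc l"
  have a: "k - l = Suc a" "k - Suc l = a" "a < k" using Suc.prems by (auto simp: a_def)
  have int: "{a..<k} = insert a {Suc a..<k}" "{a<..k} = insert (Suc a) {Suc a<..k}" using a by auto
  have tt: "tail_term k i (Suc l) (N(a := n)) = step_weight i (Suc a) m * tail_term k i l N * d (n - m)"
    if "N \<in> tails k l m" for N m
  proof -
    have "N (Suc a) = m" using that by (simp add: tails_def a)
    moreover have "(\<Prod>j\<in>{Suc a<..k}. step_weight i j ((N(a := n)) j)) = (\<Prod>j\<in>{Suc a<..k}. step_weight i j (N j))"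
      by (rule prod.cong) auto
    moreover have "(\<Prod>j\<in>{Suc a..<k}. d ((N(a := n)) j - (N(a := n)) (Suc j))) = (\<Prod>j\<in>{Suc a..<k}. d (N j - N (Suc j)))"
      by (rule prod.cong) auto
    ultimately show ?thesis unfolding tail_term_def a int by (simp add: mult_ac)
  qed
  have "(\<Sum>N\<in>tails k (Suc l) n. tail_term k i (Suc l) N) =
     (\<Sum>(m, N)\<in>(SIGMA m:{..n}. tails k l m). tail_term k i (Suc l) (N(a := n)))"
    using sum.reindex_bij_betw[OF tails_Suc[of l k n], of "tail_term k i (Suc l)"] Suc.prems
    by (simp add: a case_prod_unfold)
  also have "\<dots> = (\<Sum>m\<le>n. \<Sum>N\<in>tails k l m. tail_term k i (Suc l) (N(a := n)))"
    using Suc.prems by (subst sum.Sigma) (auto simp: finite_tails)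
  also have "\<dots> = (\<Sum>m\<le>n. \<Sum>N\<in>tails k l m. step_weight i (Suc a) m * tail_term k i l N * d (n - m))"
    by (intro sum.cong refl tt)
  also have "\<dots> = beta k i (Suc l) n"
    using Suc by (simp add: a sum_distrib_left sum_distrib_right)
  finally show ?case ..
qed

definition full_term :: "nat \<Rightarrow> nat \<Rightarrow> (nat \<Rightarrow> nat) \<Rightarrow> 'a fps" where
  "full_term k i N = w (N 1) * fps_X ^ N 1 * (if i = 1 then 1 + Q ^ N 1 else 1) * tail_term k i (k - 1) N"

lemma tuples_tails:
  assumes "k \<ge> 1"
  shows "N \<in> tuples k \<longleftrightarrow> N \<in> tails k (k - 1) (N 1)"
proof -
  have "N \<in> tails k (k - 1) (N 1)" if "N \<in> tuples k"
  proof -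
    have "N (Suc j) \<le> N j" if "j \<in> {1..<k}" for j
      using \<open>N \<in> tuples k\<close> that by (cases "j = k - 1") (auto simp: tuples_def)
    then show ?thesis using \<open>N \<in> tuples k\<close> assms by (simp add: tails_def tuples_def)
  qed
  moreover have "N \<in> tuples k" if "N \<in> tails k (k - 1) (N 1)"
    using that assms by (auto simp: tails_def tuples_def)
  ultimately show ?thesis by blast
qed

text \<open>A tuple with $N_1 > m$ does not contribute to $x^m$, and as $N_1$ is the largest entry,
  only finitely many tuples remain for each coefficient.\<close>

lemma multisum_has_sum:
  assumes "k \<ge> 1"
  shows "(full_term k i has_sum multisum k i) (tuples k)"
  unfolding has_sum_def
proof (rule tendsto_fpsI)
  fix m
  define A where "A = {N \<in> tuples k. N 1 \<le> m}"
  have A: "A = (\<Union>n\<le>m. tails k (k - 1) n)"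
  proof (intro equalityI subsetI)
    fix N assume "N \<in> A"
    then show "N \<in> (\<Union>n\<le>m. tails k (k - 1) n)"
      using tuples_tails[OF assms, of N] by (auto simp: A_def)
  next
    fix N assume "N \<in> (\<Union>n\<le>m. tails k (k - 1) n)"
    then obtain n where n: "n \<le> m" "N \<in> tails k (k - 1) n" by blast
    then have "N 1 = n" using assms by (simp add: tails_def)
    then show "N \<in> A" using n tuples_tails[OF assms, of N] by (auto simp: A_def)
  qed
  have finA: "finite A" unfolding A by (auto simp: finite_tails)
  have vanish: "full_term k i N $ m = 0" if "m < N 1" for N
    using that unfolding full_term_def
    by (metis (no_types, lifting) fps_X_power_mult_nth mult.assoc mult.commute)
  have "multisum k i $ m = (\<Sum>n\<le>m. (w n * fps_X ^ n * (if i = 1 then 1 + Q ^ n else 1) * beta k i (k - 1) n) $ m)"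
    by (simp add: multisum_def adic_sum_def)
  also have "\<dots> = (\<Sum>n\<le>m. \<Sum>N\<in>tails k (k - 1) n. full_term k i N $ m)"
  proof (rule sum.cong[OF refl])
    fix n
    have "N 1 = n" if "N \<in> tails k (k - 1) n" for N
      using that assms by (simp add: tails_def)
    then have "w n * fps_X ^ n * (if i = 1 then 1 + Q ^ n else 1) * beta k i (k - 1) n =
       (\<Sum>N\<in>tails k (k - 1) n. full_term k i N)"
      unfolding beta_tails[of "k - 1" k i n, OF diff_le_self] sum_distrib_left full_term_def by (intro sum.cong) auto
    then show "(w n * fps_X ^ n * (if i = 1 then 1 + Q ^ n else 1) * beta k i (k - 1) n) $ m =
       (\<Sum>N\<in>tails k (k - 1) n. full_term k i N $ m)"
      by (simp only: fps_sum_nth)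
  qed
  also have "\<dots> = (\<Sum>N\<in>A. full_term k i N $ m)"
    unfolding A
  proof (rule sum.UNION_disjoint[symmetric])
    show "\<forall>n\<in>{..m}. finite (tails k (k - 1) n)" by (simp add: finite_tails)
  qed (auto simp: tails_def)
  finally have S: "multisum k i $ m = (\<Sum>N\<in>A. full_term k i N $ m)" .
  show "eventually (\<lambda>Y. (sum (full_term k i) Y) $ m = multisum k i $ m) (finite_subsets_at_top (tuples k))"
    unfolding eventually_finite_subsets_at_top
  proof (intro exI[of _ A] conjI allI impI)
    show "finite A" by (rule finA)
    show "A \<subseteq> tuples k" by (auto simp: A_def)
    fix Y assume Y: "finite Y \<and> A \<subseteq> Y \<and> Y \<subseteq> tuples k"
    have "(\<Sum>N\<in>Y. full_term k i N $ m) = (\<Sum>N\<in>A. full_term k i N $ m)"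
    proof (rule sum.mono_neutral_right)
      show "\<forall>N\<in>Y - A. full_term k i N $ m = 0"
        using Y vanish unfolding A_def by (auto simp: not_le[symmetric] simp del: One_nat_def)
    qed (use Y in auto)
    then show "(sum (full_term k i) Y) $ m = multisum k i $ m"
      unfolding S by (simp add: fps_sum_nth)
  qed
qed

end

section \<open>The q-difference system for overpartitions, over Laurent series in q\<close>

interpretation qf: qbase "fls_X :: rat fls"
proof
  show "(fls_X :: rat fls) \<noteq> 0" by simp
  show "(fls_X :: rat fls) ^ Suc n \<noteq> 1" for n
  proof
    assume "(fls_X :: rat fls) ^ Suc n = 1"
    then have "fls_subdegree ((fls_X :: rat fls) ^ Suc n) = fls_subdegree (1 :: rat fls)" by simp
    then show False by (simp add: fls_subdegree_pow del: power_Suc)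
  qed
  show "(2 :: rat fls) \<noteq> 0" by simp
qed

text \<open>The layer without overlined 1 carries $q^{2p}$, the one with it $q^{2p-1}$. After
  multiplication by \<open>c\<close> both contain $(xQ)^p$, which is the dilation of $x^p$.\<close>

lemma op_system_gf:
  assumes "k \<ge> 1"
  shows "qf.op_system k (\<lambda>i. gf (admissible_ops k i))"
proof -
  define G where "G i = gf (admissible_ops k i)" for i
  define X where "X = (fps_X :: rat fls fps)"
  define c where "c = qf.c"
  define Q where "Q = qf.Q"
  have Qc: "Q = c * c" by (simp add: Q_def c_def qf.Q_def power2_eq_square)
  have G0: "G 0 = 0" by (simp add: G_def gf_admissible_0)
  have l0: "gf (layer0 k 0 p) = X ^ p * Q ^ p * qf.dil (G (k - p) + X * G (k - p - 1))" if "p < k" for p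
    using gf_layer0[of 0 p k] that
    by (simp add: G_def X_def Q_def qf.Q_const fps_const_power power_mult)
  have l1: "gf (layer0 k 1 (p - 1)) = X ^ p * c * Q ^ (p - 1) * qf.dil (G (k - p + 1) + X * G (k - p))"
    if "1 \<le> p" "p < k" for p
  proof -
    have "k - (p - 1) = k - p + 1" "k - (p - 1) - 1 = k - p" "1 + (p - 1) = p" using that by auto
    then show ?thesis
      using gf_layer0[of 1 "p - 1" k] that
      by (simp add: G_def X_def Q_def c_def qf.c_def qf.Q_const fps_const_power power_mult power_add mult_ac
          flip: fps_const_mult)
  qed
  have low: "(1 - X * c) * gf (layer k a p) = gf (layer0 k a p)" if "p + 1 < k" for a p
    using gf_layer_low[OF that] by (simp add: X_def c_def qf.c_def)
  have top: "gf (layer k a p) = gf (layer0 k a p)" if "k \<le> p + 1" for a p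
    using gf_layer_top[OF that] .
  have G1: "G 1 = gf (layer k 0 0)" unfolding G_def by (rule gf_admissible_1)
  have GS: "G (Suc p) - G p = gf (layer k 0 p) + gf (layer k 1 (p - 1))" if "1 \<le> p" for p
    using gf_admissible_Suc[OF that] by (simp add: G_def)
  have dX: "qf.dil X = X * Q" unfolding X_def Q_def by (rule qf.dil_X)
  have dc: "qf.dil c = c" unfolding c_def by (rule qf.dil_c)
  have cQ: "c * c * Q ^ (p - 1) = Q ^ p" if "1 \<le> p" for p
    using that Qc by (cases p) simp_all
  have "qf.op_system k G"
    unfolding qf.op_system_def X_def[symmetric] c_def[symmetric]
  proof (intro conjI allI impI)
    assume k: "k = 1"
    then show "G 1 = qf.dil (G 1)" using G1 top[of 0 0] l0[of 0] G0 by simp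
  next
    assume k: "2 \<le> k"
    then show "(1 - X * c) * G 1 = qf.dil (G k + X * G (k - 1))"
      unfolding G1 using low[of 0 0] l0[of 0] by simp
  next
    fix p assume p: "1 \<le> p" and k: "k = Suc p"
    \<comment> \<open>Here $p = k - 1$: the layer \<open>0 p\<close> is at the top and keeps the
      factor $1 - xc$, while the layer \<open>1 (p - 1)\<close> absorbs it.\<close>
    have "c * (1 - X * c) * (G k - G p) =
       c * (1 - X * c) * gf (layer0 k 0 p) + c * gf (layer0 k 1 (p - 1))"
    proof -
      have "c * (1 - X * c) * (G (Suc p) - G p) =
         c * (1 - X * c) * gf (layer k 0 p) + c * ((1 - X * c) * gf (layer k 1 (p - 1)))"
        unfolding GS[OF p] by (simp add: algebra_simps)
      then show ?thesis using top[of p 0] low[of "p - 1" 1] p k by simp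
    qed
    also have "\<dots> = c * (1 - X * c) * (X ^ p * Q ^ p * qf.dil (G 1))
       + (c * c * Q ^ (p - 1)) * X ^ p * (qf.dil (G 2) + X * Q * qf.dil (G 1))"
    proof -
      have kp: "p < k" "k - p = 1" "1 - 1 = (0::nat)" "1 + 1 = (2::nat)" using k by simp_all
      show ?thesis unfolding l0[OF kp(1)] l1[OF p kp(1)] kp(2-) G0
        by (simp add: dilate_add dilate_mult dX mult_ac)
    qed
    \<comment> \<open>The surplus $- xc^2$ of the top layer cancels the $xQ$ that the overlined part
      2 contributes in the other layer.\<close>
    also have "\<dots> = X ^ p * Q ^ p * (c * qf.dil (G 1) + qf.dil (G 2))"
      unfolding cQ[OF p] by (simp add: Qc algebra_simps)
    also have "\<dots> = qf.dil (X ^ p * (c * G 1 + G 2))"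
      by (simp add: dilate_mult dilate_add dilate_power dX dc power_mult_distrib)
    finally show "c * (1 - X * c) * (G k - G p) = qf.dil (X ^ p * (c * G 1 + G 2))" .
  next
    fix p u assume p: "1 \<le> p" and u: "1 \<le> u" and k: "k = Suc (p + u)"
    have "c * (1 - X * c) * (G (Suc p) - G p) = c * gf (layer0 k 0 p) + c * gf (layer0 k 1 (p - 1))"
    proof -
      have "c * (1 - X * c) * (G (Suc p) - G p) =
         c * ((1 - X * c) * gf (layer k 0 p)) + c * ((1 - X * c) * gf (layer k 1 (p - 1)))"
        unfolding GS[OF p] by (simp add: algebra_simps)
      then show ?thesis using low[of p 0] low[of "p - 1" 1] p u k by simp
    qed
    also have "\<dots> = c * (X ^ p * Q ^ p * qf.dil (G (Suc u) + X * G u))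
       + (c * c * Q ^ (p - 1)) * X ^ p * qf.dil (G (Suc (Suc u)) + X * G (Suc u))"
      using l0[of p] l1[OF p] k p u by (simp add: mult_ac)
    also have "\<dots> = X ^ p * Q ^ p * (c * qf.dil (G (Suc u) + X * G u) + qf.dil (G (Suc (Suc u)) + X * G (Suc u)))"
      unfolding cQ[OF p] by (simp add: algebra_simps)
    also have "\<dots> = qf.dil (X ^ p * (c * (G (Suc u) + X * G u) + G (Suc (Suc u)) + X * G (Suc u)))"
      by (simp add: dilate_mult dilate_add dilate_power dX dc power_mult_distrib add.assoc)
    finally show "c * (1 - X * c) * (G (Suc p) - G p) =
        qf.dil (X ^ p * (c * (G (Suc u) + X * G u) + G (Suc (Suc u)) + X * G (Suc u)))" .
  qed
  then show ?thesis by (simp only: G_def[abs_def])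
qed

lemma O_gf_eq_multisum:
  assumes "i \<ge> 1" "i \<le> k"
  shows "O_gf k i = qf.multisum k i"
proof -
  have "k \<ge> 1" using assms by simp
  then show ?thesis
    using qf.multisum_unique[OF op_system_gf[of k], of i] gf_admissible_nth_0 assms O_gf_conv[of k i] by simp
qed

section \<open>Translation of the summand of the statement\<close>

lemma qpoch_q2: "qpoch (fls_X\<^sup>2) (fls_X\<^sup>2) (int n) = (\<Prod>j<n. 1 - ((fls_X :: rat fls)\<^sup>2) ^ Suc j)"
proof -
  have "1 - (fls_X :: rat fls)\<^sup>2 * (fls_X\<^sup>2) ^ j \<noteq> 0" for j
    using qf.q2_root[of j] by simp
  from qpoch_nat[OF this, of n] show ?thesis by simp
qed

lemma d_qpoch: "qf.d n = fps_const (inverse (qpoch (fls_X\<^sup>2) (fls_X\<^sup>2) (int n)))"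
  unfolding qf.d_def qpoch_q2 ..

lemma qpoch_neg:
  "qpoch (- ((fls_X :: rat fls) powi e)) (fls_X\<^sup>2) (int n) = (\<Prod>j<n. 1 + fls_X powi (e + 2 * int j))"
proof -
  have pw: "(fls_X :: rat fls) powi e * (fls_X\<^sup>2) ^ j = fls_X powi (e + 2 * int j)" for j
  proof -
    have "((fls_X :: rat fls)\<^sup>2) ^ j = fls_X powi int (2 * j)"
      by (simp only: power_int_of_nat power_mult)
    then show ?thesis by (simp only: power_int_add fls_X_nonzero of_nat_mult of_nat_numeral simp_thms)
  qed
  have factor: "1 - (- ((fls_X :: rat fls) powi e)) * (fls_X\<^sup>2) ^ j = 1 + fls_X powi (e + 2 * int j)" for j
    by (simp only: mult_minus_left diff_minus_eq_add pw)
  have nz: "1 - (- ((fls_X :: rat fls) powi e)) * (fls_X\<^sup>2) ^ j \<noteq> 0" for j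
    unfolding factor by (rule one_plus_fls_X_powi_nz)
  show ?thesis unfolding qpoch_nat[OF nz] factor ..
qed

text \<open>For $n \<ge> 1$ the two symbols, read backwards, are the products of $1 + q^{-j}$ over
  the even and the odd $j$ from $1$ to $2n - 1$. Turning each factor into $1 + q^j$ uses $1 + ... +
  (2n - 1) = 2n^2 - n$ of the exponent $2n^2$ and leaves $q^n$.\<close>

lemma w_qpoch:
  "qf.w n = fps_const (qpoch (- (fls_X powi (2 - 2 * int n))) (fls_X\<^sup>2) (int n - 1) *
     qpoch (- (fls_X powi (1 - 2 * int n))) (fls_X\<^sup>2) (int n) * fls_X ^ (2 * n\<^sup>2))"
proof (cases n)
  case 0
  have nz: "1 - (- 1 :: rat fls) * (fls_X\<^sup>2) ^ j \<noteq> 0" for j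
  proof -
    have "((fls_X :: rat fls)\<^sup>2) ^ j = fls_X powi int (2 * j)"
      by (simp only: power_int_of_nat power_mult)
    then show ?thesis using one_plus_fls_X_powi_nz[of "int (2 * j)"] by (metis diff_minus_eq_add mult_1 mult_minus_left)
  qed
  show ?thesis using 0 qpoch_minus_1[OF nz] qpoch_neg[of 1 0] by (simp add: power_int_numeral inverse_eq_divide)
next
  case (Suc m)
  define f where "f j = 1 + (fls_X :: rat fls) powi (- int j)" for j
  have 1: "qpoch (- (fls_X powi (2 - 2 * int (Suc m)))) (fls_X\<^sup>2) (int (Suc m) - 1) = (\<Prod>j<m. f (2 * j + 2))" for m
  proof -
    have "qpoch (- (fls_X powi (2 - 2 * int (Suc m)))) (fls_X\<^sup>2) (int (Suc m) - 1) =
      (\<Prod>j<m. 1 + (fls_X :: rat fls) powi (- 2 * int m + 2 * int j))"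
      using qpoch_neg[of "- 2 * int m" m] by simp
    also have "\<dots> = (\<Prod>j<m. f (2 * j + 2))"
      unfolding f_def
      by (rule prod.reindex_bij_witness[of _ "\<lambda>j. m - Suc j" "\<lambda>j. m - Suc j"])
         (auto simp: of_nat_diff algebra_simps)
    finally show ?thesis .
  qed
  have 2: "qpoch (- (fls_X powi (1 - 2 * int n))) (fls_X\<^sup>2) (int n) = (\<Prod>j<n. f (2 * j + 1))" for n
  proof -
    have "qpoch (- (fls_X powi (1 - 2 * int n))) (fls_X\<^sup>2) (int n) =
      (\<Prod>j<n. 1 + (fls_X :: rat fls) powi (1 - 2 * int n + 2 * int j))"
      by (rule qpoch_neg)
    also have "\<dots> = (\<Prod>j<n. f (2 * j + 1))"
      unfolding f_def
      by (rule prod.reindex_bij_witness[of _ "\<lambda>j. n - Suc j" "\<lambda>j. n - Suc j"])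
         (auto simp: of_nat_diff algebra_simps)
    finally show ?thesis .
  qed
  have fX: "f j * fls_X ^ j = 1 + fls_X ^ j" for j
  proof -
    have "(fls_X :: rat fls) powi (- int j) * fls_X ^ j = 1"
      by (simp add: power_int_minus)
    then show ?thesis by (simp add: f_def algebra_simps)
  qed
  have w1: "qf.w (Suc m) = fps_const ((\<Prod>j<m. f (2 * j + 2)) * (\<Prod>j<Suc m. f (2 * j + 1)) * fls_X ^ (2 * (Suc m)\<^sup>2))" for m
  proof (induction m)
    case 0
    have "f 1 * fls_X ^ 2 = fls_X * (f 1 * fls_X ^ 1)" by (simp add: power2_eq_square mult_ac)
    also have "\<dots> = fls_X * (1 + fls_X)" unfolding fX by simp
    finally have f1: "f (Suc 0) * fls_X ^ 2 = fls_X * (1 + fls_X)" by simp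
    have "qf.w (Suc 0) = fps_const (inverse 2 * fls_X * 2 * (1 + fls_X))"
      by (simp add: qf.c_def flip: fps_const_mult fps_const_add)
    then show ?case by (simp add: f1)
  next
    case (Suc m)
    define A where "A = (\<Prod>j<m. f (2 * j + 2)) * (\<Prod>j<Suc m. f (2 * j + 1)) * fls_X ^ (2 * (Suc m)\<^sup>2)"
    have Qm: "qf.Q ^ Suc m = fps_const (fls_X ^ (2 * m + 2))"
      by (simp add: qf.Q_const fps_const_power flip: power_mult power_Suc)
    have "qf.w (Suc (Suc m)) = fps_const A * qf.c * (1 + qf.Q ^ Suc m) * (1 + qf.c * qf.Q ^ Suc m)"
      unfolding qf.w.simps(2)[of "Suc m"] Suc A_def ..
    also have "\<dots> = fps_const (A * fls_X * (1 + fls_X ^ (2 * m + 2)) * (1 + fls_X ^ (2 * m + 3)))"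
      unfolding Qm qf.c_def
      by (simp add: power_add eval_nat_numeral mult_ac flip: fps_const_mult fps_const_add fps_const_1_eq_1)
    also have "A * fls_X * (1 + fls_X ^ (2 * m + 2)) * (1 + fls_X ^ (2 * m + 3)) =
       A * f (2 * m + 2) * f (2 * m + 3) * (fls_X * fls_X ^ (2 * m + 2) * fls_X ^ (2 * m + 3))"
      unfolding fX[symmetric] by (simp only: mult_ac)
    also have "\<dots> = (\<Prod>j<Suc m. f (2 * j + 2)) * (\<Prod>j<Suc (Suc m). f (2 * j + 1)) *
        (fls_X ^ (2 * (Suc m)\<^sup>2) * (fls_X * fls_X ^ (2 * m + 2) * fls_X ^ (2 * m + 3)))"
      unfolding A_def by (simp add: eval_nat_numeral mult_ac)
    also have "fls_X ^ (2 * (Suc m)\<^sup>2) * (fls_X * fls_X ^ (2 * m + 2) * fls_X ^ (2 * m + 3)) =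
       (fls_X :: rat fls) ^ (2 * (Suc (Suc m))\<^sup>2)"
    proof -
      have "2 * (Suc (Suc m))\<^sup>2 = 2 * (Suc m)\<^sup>2 + (1 + (2 * m + 2) + (2 * m + 3))"
        by (simp add: power2_eq_square)
      then show ?thesis by (simp only: power_add power_one_right mult_ac)
    qed
    finally show ?case .
  qed
  show ?thesis unfolding Suc 1 2 by (rule w1)
qed

lemma step_weight_conv:
  "qf.step_weight i j m = fps_const (fls_X ^ (2 * (m\<^sup>2 + (if j > i then m else 0))) * (if j = i then 1 + fls_X ^ (2 * m) else 1)) * fps_X ^ m"
proof -
  have Q: "qf.Q ^ n = fps_const (fls_X ^ (2 * n))" for n
    by (simp add: qf.Q_const fps_const_power flip: power_mult)
  have one: "1 + fps_const (fls_X ^ (2 * m)) = fps_const (1 + fls_X ^ (2 * m) :: rat fls)"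
    by (simp flip: fps_const_1_eq_1)
  show ?thesis
    unfolding qf.step_weight_def Q using one by (simp add: power_add distrib_left mult_ac)
qed

lemma prod_step_weight:
  assumes "i \<ge> 1" "i \<le> k"
  shows "(\<Prod>j\<in>{1<..k}. qf.step_weight i j (N j)) =
    fps_const (fls_X ^ (2 * ((\<Sum>j\<in>{1<..k}. (N j)\<^sup>2) + (\<Sum>j\<in>{1<..k}. if j > i then N j else 0))) *
      (if i = 1 then 1 else 1 + fls_X ^ (2 * N i))) * fps_X ^ (\<Sum>j\<in>{1<..k}. N j)"
proof -
  have const: "(\<Prod>j\<in>A. fps_const (f j)) = fps_const (\<Prod>j\<in>A. f j)" for A and f :: "nat \<Rightarrow> rat fls"
    by (induction A rule: infinite_finite_induct) auto
  have "(\<Prod>j\<in>{1<..k}. if j = i then 1 + (fls_X :: rat fls) ^ (2 * N j) else 1) =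
      (if i = 1 then 1 else 1 + fls_X ^ (2 * N i))"
    using assms by (subst prod.delta) auto
  moreover have "(\<Prod>j\<in>{1<..k}. (fls_X :: rat fls) ^ (2 * ((N j)\<^sup>2 + (if j > i then N j else 0)))) =
     fls_X ^ (2 * ((\<Sum>j\<in>{1<..k}. (N j)\<^sup>2) + (\<Sum>j\<in>{1<..k}. if j > i then N j else 0)))"
    unfolding power_sum[symmetric] sum_distrib_left[symmetric] sum.distrib ..
  ultimately show ?thesis
    unfolding step_weight_conv prod.distrib const power_sum by simp
qed

text \<open>The statement runs over the indices from $1$ to $k - 1$, the chain over those from $2$
  to $k$: the index $1$ is split off, and $k$ is added with $N_k = 0$.\<close>

lemma multisum_term_conv:
  assumes "i \<ge> 1" "i \<le> k" and N: "N \<in> tuples k"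
  shows "multisum_term k i N = qf.full_term k i N"
proof -
  have k: "k \<ge> 1" using assms by simp
  have N0: "N j = 0" if "j \<notin> {1..<k}" for j using N that by (simp add: tuples_def)
  have Nle: "N (Suc j) \<le> N j" if "j \<in> {1..<k-1}" for j using N that by (simp add: tuples_def)
  have range: "(\<Sum>j=1..k-1. g j) = g 1 + (\<Sum>j\<in>{1<..k}. g j)" if "g k = 0" for g :: "nat \<Rightarrow> nat"
  proof -
    have "(\<Sum>j=1..k-1. g j) = (\<Sum>j=1..k. g j)"
    proof (rule sum.mono_neutral_left)
      have "j = k" if "j \<in> {1..k} - {1..k-1}" for j using that by auto
      then show "\<forall>j\<in>{1..k} - {1..k-1}. g j = 0" using that by blast
    qed auto
    also have "{1..k} = insert 1 {1<..k}" using k by auto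
    finally show ?thesis by simp
  qed
  have sums: "(\<Sum>j=1..k-1. N j) = N 1 + (\<Sum>j\<in>{1<..k}. N j)"
    "(\<Sum>j=1..k-1. (N j)\<^sup>2) = (N 1)\<^sup>2 + (\<Sum>j\<in>{1<..k}. (N j)\<^sup>2)"
    using range[of N] range[of "\<lambda>j. (N j)\<^sup>2"] N0[of k] by simp_all
  have upper: "(\<Sum>j=i+1..k-1. N j) = (\<Sum>j\<in>{1<..k}. if j > i then N j else 0)"
    by (rule sum.mono_neutral_cong_left) (use assms N0 in auto)
  define B where "B = (\<Prod>j\<in>{1..<k-1}. qpoch (fls_X\<^sup>2) (fls_X\<^sup>2) (int (N j) - int (N (j+1)))) *
      qpoch ((fls_X :: rat fls)\<^sup>2) (fls_X\<^sup>2) (int (N (k-1)))"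
  have den: "(\<Prod>j\<in>{1..<k}. qf.d (N j - N (Suc j))) = fps_const (inverse B)"
  proof -
    have const: "(\<Prod>j\<in>A. fps_const (f j)) = fps_const (\<Prod>j\<in>A. f j)" for A and f :: "nat \<Rightarrow> rat fls"
      by (induction A rule: infinite_finite_induct) auto
    have eq: "(\<Prod>j\<in>{1..<k-1}. qf.d (N j - N (Suc j))) =
      fps_const (inverse (\<Prod>j\<in>{1..<k-1}. qpoch (fls_X\<^sup>2) (fls_X\<^sup>2) (int (N j) - int (N (j+1)))))"
      unfolding d_qpoch const prod_inversef[symmetric] comp_def
      by (rule arg_cong[where f = fps_const], rule prod.cong) (use Nle in \<open>auto simp: of_nat_diff\<close>)
    show ?thesis
    proof (cases "k = 1")
      \<comment> \<open>For \<open>k = 1\<close> the last denominator of the statement refers to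
        \<open>N 0\<close>, which is zero for a tuple.\<close>
      case True
      then have "N (k - 1) = 0" using N0[of 0] by simp
      then show ?thesis using qpoch_q2[of 0] True by (simp add: B_def)
    next
      case False
      then have "{1..<k} = insert (k - 1) {1..<k-1}" "Suc (k - 1) = k" using k by auto
      then have "(\<Prod>j\<in>{1..<k}. qf.d (N j - N (Suc j))) = qf.d (N (k - 1)) * (\<Prod>j\<in>{1..<k-1}. qf.d (N j - N (Suc j)))"
        using N0[of k] by simp
      then show ?thesis unfolding eq unfolding d_qpoch[of "N (k - 1)"] B_def by (simp add: mult.commute)
    qed
  qed
  define a where "a = qpoch (- (fls_X powi (2 - 2 * int (N 1)))) (fls_X\<^sup>2) (int (N 1) - 1) *
     qpoch (- ((fls_X :: rat fls) powi (1 - 2 * int (N 1)))) (fls_X\<^sup>2) (int (N 1))"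
  define s where "s = (\<Sum>j\<in>{1<..k}. (N j)\<^sup>2) + (\<Sum>j\<in>{1<..k}. if j > i then N j else 0)"
  define h where "h = 1 + (fls_X :: rat fls) ^ (2 * N i)"
  \<comment> \<open>The factor $1 + q^{2N_i}$ comes from the outer index for \<open>i = 1\<close>
    and from a chain step otherwise.\<close>
  have Qn: "(if i = 1 then 1 + qf.Q ^ N 1 else 1) * fps_const (if i = 1 then 1 else h) = fps_const h"
    by (simp add: h_def qf.Q_const fps_const_power flip: power_mult fps_const_1_eq_1)
  have "qf.full_term k i N = (fps_const (a * fls_X ^ (2 * (N 1)\<^sup>2)) * fps_X ^ N 1 * (if i = 1 then 1 + qf.Q ^ N 1 else 1)) *
     ((fps_const (fls_X ^ (2 * s) * (if i = 1 then 1 else h)) * fps_X ^ (\<Sum>j\<in>{1<..k}. N j)) * fps_const (inverse B))"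
  proof -
    have "k - (k - 1) = 1" using k by simp
    then show ?thesis
      unfolding qf.full_term_def qf.tail_term_def
      by (simp only: den prod_step_weight[OF assms(1,2)] w_qpoch a_def s_def h_def)
  qed
  also have "\<dots> = fps_const (a * fls_X ^ (2 * (N 1)\<^sup>2)) * fps_const (fls_X ^ (2 * s)) *
     ((if i = 1 then 1 + qf.Q ^ N 1 else 1) * fps_const (if i = 1 then 1 else h)) * fps_const (inverse B) *
     (fps_X ^ N 1 * fps_X ^ (\<Sum>j\<in>{1<..k}. N j))"
    unfolding fps_const_mult[symmetric] by (simp only: mult_ac)
  also have "\<dots> = fps_const (a * (fls_X ^ (2 * (N 1)\<^sup>2) * fls_X ^ (2 * s)) * h / B) * fps_X ^ (\<Sum>j=1..k-1. N j)"
    unfolding Qn sums power_add by (simp add: divide_inverse mult_ac)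
  also have "fls_X ^ (2 * (N 1)\<^sup>2) * fls_X ^ (2 * s) = (fls_X :: rat fls) ^ (2 * ((\<Sum>j=1..k-1. (N j)\<^sup>2) + (\<Sum>j=i+1..k-1. N j)))"
    unfolding sums upper s_def by (simp add: distrib_left power_add mult_ac)
  finally show ?thesis
    unfolding multisum_term_def Let_def a_def h_def B_def by simp
qed

theorem theorem1p9:
  fixes k i :: nat
  assumes "k \<ge> i" and "i \<ge> 1"
  shows "(multisum_term k i has_sum O_gf k i) (tuples k)"
proof -
  have "(qf.full_term k i has_sum qf.multisum k i) (tuples k)"
    using assms by (intro qf.multisum_has_sum) simp
  then show ?thesis
    unfolding O_gf_eq_multisum[OF assms(2,1)]
    using has_sum_cong[of "tuples k" "multisum_term k i" "qf.full_term k i"] multisum_term_conv[OF assms(2,1)]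
    by blast
qed

end
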